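(* Let $G$ be a Lie group and let $P_n$, $n=0,1,2,\dots$, be dissipative distributions on $G$ with corresponding semigroups of (subprobability) measures $\mu_n(t)$, $t>0$, such that $$\langle \mu_n(t), f\rangle \longrightarrow \langle \mu_0(t), f\rangle \quad (n\to\infty)\qquad\text{for all } f\in C_b(G),\ t>0.$$ Let $\pi$ be a strongly continuous representation of $G$ on a Banach space $X$ such that, for every $n\ge 0$, $$\int_{G\setminus U}\|\pi(x)\|\,P_n(dx)<\infty$$ for an open neighbourhood $U$ of the identity. Then for every $u\in C^2(\pi,X)$ and every $v\in X'$, $$\langle \pi_{P_n}u, v\rangle\longrightarrow\langle\pi_{P_0}u,v\rangle\quad (n\to\infty).$$
   Context: $G$ is a Lie group with identity $e$, and $X_1,\dots,X_d$ is a fixed basis of the left-invariant vector fields on $G$. $C_b(G)$ is the Banach space of bounded continuous functions with the sup norm $\|\cdot\|_\infty$. For a multi-index $\alpha$, $X^\alpha=X_1^{\alpha_1}\cdots X_d^{\alpha_d}$, and $$C_b^2(G)=\{f\in C^2(G): \|f\|_{C^2}<\infty\},\qquad \|f\|_{C^2}=\max_{|\alpha|\le 2}\|X^\alpha f\|_\infty .$$ A Schwartz distribution $P$ on $G$ is called dissipative if $\langle P,f\rangle\le 0$ for every real $f\in C_c^\infty(G)$ which attains its maximal value at $e$. Such a $P$ coincides on $G\setminus\{e\}$ with a positive Radon measure, denoted $P(dx)$, which is bounded (finite) outside any open neighbourhood of $e$. $P$ extends to a continuous linear functional on $C_b^2(G)$, still denoted $P$, such that $\langle P,f\rangle=\int_G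 f(x)\,P(dx)$ whenever $f\in C_b^2(G)$ and $f(e)=X_jf(e)=X_jX_kf(e)=0$ for all $1\le j,k\le d$. $\langle P,f\rangle$ for $f\in C_b^2(G)$ refers to this extension (concretely, $\langle P,f\rangle=\langle P,\varphi f\rangle+\int_G (1-\varphi(x))f(x)\,P(dx)$ for any $\varphi\in C_c^\infty(G)$ equal to $1$ near $e$). By Hunt theory, every dissipative distribution $P$ is the generating functional of a unique weakly continuous convolution semigroup $(\mu(t))_{t>0}$ of subprobability measures on $G$: $\mu(s)\star\mu(t)=\mu(s+t)$, $\mu(t)\to\delta_e$ weakly as $t\to0^+$, and $\langle P,f\rangle=\lim_{t\to 0^+}\frac1t\langle\mu(t)-\delta_e,f\rangle$ for $f\in C_c^\infty(G)$. This is the semigroup corresponding to $P$. Here $\langle\mu,f\rangle=\int_G f\,d\mu$. $X'$ is the dual Banach space of $X$. For $u\in X$, $v\in X'$ put $f_{u,v}(x)=\langle\pi(x)u,v\rangle$, $x\in G$, and $$C^2(\pi,X)=\{u\in X: f_{u,v}\in C_b^2(G)\text{ for every } v\in X'\}.$$ For a dissipative $P$ with corresponding semigroup $\mu(t)$, $\pi_P$ denotes the infinitesimal generator of the operator semigroup $\pi_{\mu(t)}u=\int_G\pi(x)u\,\mu(t)(dx)$; on $C^2(\pi,X)$ it is given by $$\langle\pi_Pu,v\rangle=\langle P,f_{u,v}\rangle,\qquad u\in C^2(\pi,X),\ v\in X'.$$ *)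

theory Defs
  imports "HOL-Probability.Probability"
begin

section \<open>Lie groups\<close>

text \<open>
  The group is a type of class \<open>topological_group_add\<close> (which is not assumed commutative), so
  the group product is written \<open>+\<close>, the inverse \<open>-\<close> and the identity \<open>0\<close>. Manifolds are
  Hausdorff and second countable. Charts take values in a real normed space \<open>'e\<close>, which
  \<open>left_invariant_basis\<close> below makes finite dimensional; the class \<open>euclidean_space\<close> would
  exclude dimension zero, that is, discrete groups.
\<close>

text \<open>
  \<open>Ck_on k S f\<close> is meant for open \<open>S\<close>: the iterated directional derivatives of \<open>f\<close> up to
  order \<open>k\<close> exist on \<open>S\<close> and are continuous.
\<close>

primrec Ck_on ::
  "nat \<Rightarrow> 'e::real_normed_vector set \<Rightarrow> ('e \<Rightarrow> 'b::real_normed_vector) \<Rightarrow> bool" where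
  "Ck_on 0 S f \<longleftrightarrow> continuous_on S f"
| "Ck_on (Suc k) S f \<longleftrightarrow> (\<forall>x\<in>S. f differentiable (at x)) \<and>
     (\<forall>v. Ck_on k S (\<lambda>x. frechet_derivative f (at x) v))"

definition smooth_on ::
  "'e::real_normed_vector set \<Rightarrow> ('e \<Rightarrow> 'b::real_normed_vector) \<Rightarrow> bool" where
  "smooth_on S f \<longleftrightarrow> (\<forall>k. Ck_on k S f)"

type_synonym ('g, 'e) atlas = "('g set \<times> ('g \<Rightarrow> 'e)) set"

definition chart :: "'g::topological_space set \<Rightarrow> ('g \<Rightarrow> 'e::real_normed_vector) \<Rightarrow> bool" where
  "chart U \<phi> \<longleftrightarrow> open U \<and> open (\<phi> ` U) \<and> homeomorphism U (\<phi> ` U) \<phi> (inv_into U \<phi>)"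

definition lie_group ::
  "('g::{topological_group_add, t2_space, second_countable_topology}, 'e::real_normed_vector) atlas
     \<Rightarrow> bool" where
  "lie_group A \<longleftrightarrow>
     (\<forall>(U, \<phi>)\<in>A. chart U \<phi>) \<and>
     (\<Union>(U, \<phi>)\<in>A. U) = UNIV \<and>
     (\<forall>(U, \<phi>)\<in>A. \<forall>(V, \<psi>)\<in>A. smooth_on (\<phi> ` (U \<inter> V)) (\<psi> \<circ> inv_into U \<phi>)) \<and>
     (\<forall>(U, \<phi>)\<in>A. \<forall>(V, \<psi>)\<in>A. \<forall>(W, \<theta>)\<in>A.
        smooth_on {(a, b). a \<in> \<phi> ` U \<and> b \<in> \<psi> ` V \<and> inv_into U \<phi> a + inv_into V \<psi> b \<in> W}
          (\<lambda>(a, b). \<theta> (inv_into U \<phi> a + inv_into V \<psi> b))) \<and>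
     (\<forall>(U, \<phi>)\<in>A. \<forall>(W, \<theta>)\<in>A.
        smooth_on {a. a \<in> \<phi> ` U \<and> - inv_into U \<phi> a \<in> W} (\<lambda>a. \<theta> (- inv_into U \<phi> a)))"

definition Ck_fun ::
  "('g, 'e::real_normed_vector) atlas \<Rightarrow> nat \<Rightarrow> ('g \<Rightarrow> 'k::real_normed_vector) \<Rightarrow> bool" where
  "Ck_fun A k f \<longleftrightarrow> (\<forall>(U, \<phi>)\<in>A. Ck_on k (\<phi> ` U) (f \<circ> inv_into U \<phi>))"

text \<open>
  A left-invariant vector field \<open>X\<close> is determined by its value at the identity:
  \<open>X f (x) = X\<^sub>e (f \<circ> L\<^sub>x)\<close> with \<open>L\<^sub>x\<close> the left translation by \<open>x\<close>. Here \<open>w\<close> is the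
  coordinate vector of \<open>X\<^sub>e\<close> in a chart \<open>(U, \<phi>)\<close> around the identity.
\<close>

definition left_invariant_field ::
  "'g::group_add set \<Rightarrow> ('g \<Rightarrow> 'e::real_normed_vector) \<Rightarrow> 'e \<Rightarrow>
     ('g \<Rightarrow> 'k::real_normed_vector) \<Rightarrow> 'g \<Rightarrow> 'k" where
  "left_invariant_field U \<phi> w f x =
     frechet_derivative (\<lambda>y. f (x + inv_into U \<phi> y)) (at (\<phi> 0)) w"

lemma left_invariant_field_translate:
  "left_invariant_field U \<phi> w (\<lambda>y. f (g + y)) x = left_invariant_field U \<phi> w f (g + x)"
  by (simp add: left_invariant_field_def add.assoc)

text \<open>The basis is indexed by \<open>0, \<dots>, d - 1\<close>.\<close>

definition left_invariant_basis ::
  "('g::group_add, 'e::real_normed_vector) atlas \<Rightarrow> nat \<Rightarrow>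
     (nat \<Rightarrow> ('g \<Rightarrow> 'k::real_normed_vector) \<Rightarrow> 'g \<Rightarrow> 'k) \<Rightarrow> bool" where
  "left_invariant_basis A d X \<longleftrightarrow>
     (\<exists>(U, \<phi>)\<in>A. 0 \<in> U \<and>
       (\<exists>w. inj_on w {..<d} \<and> independent (w ` {..<d}) \<and> span (w ` {..<d}) = UNIV \<and>
            (\<forall>j<d. X j = left_invariant_field U \<phi> (w j))))"

section \<open>Function spaces\<close>

text \<open>
  Functions take values in \<open>'k :: {real_normed_field, euclidean_space}\<close>; by the Frobenius
  theorem the instances of this sort are, up to isomorphism, exactly the real and the complex
  field.
\<close>

definition multi_indices :: "nat \<Rightarrow> nat \<Rightarrow> (nat \<Rightarrow> nat) set" where
  "multi_indices d m = {\<alpha>. (\<forall>j\<ge>d. \<alpha> j = 0) \<and> (\<Sum>j<d. \<alpha> j) \<le> m}"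

definition Xpow ::
  "nat \<Rightarrow> (nat \<Rightarrow> ('g \<Rightarrow> 'k) \<Rightarrow> 'g \<Rightarrow> 'k) \<Rightarrow> (nat \<Rightarrow> nat) \<Rightarrow> ('g \<Rightarrow> 'k) \<Rightarrow> 'g \<Rightarrow> 'k" where
  "Xpow d X \<alpha> f = foldr (\<lambda>j. X j ^^ \<alpha> j) [0..<d] f"

definition Ck_norm ::
  "nat \<Rightarrow> (nat \<Rightarrow> ('g \<Rightarrow> 'k::real_normed_vector) \<Rightarrow> 'g \<Rightarrow> 'k) \<Rightarrow> nat \<Rightarrow> ('g \<Rightarrow> 'k) \<Rightarrow> real" where
  "Ck_norm d X m f = (MAX \<alpha>\<in>multi_indices d m. SUP x. norm (Xpow d X \<alpha> f x))"

text \<open>The condition that \<open>Ck_norm d X 2 f\<close> be finite appears as boundedness of each \<open>X\<^sup>\<alpha> f\<close>.\<close>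

definition Cb2 ::
  "('g, 'e::real_normed_vector) atlas \<Rightarrow> nat \<Rightarrow>
     (nat \<Rightarrow> ('g \<Rightarrow> 'k::real_normed_vector) \<Rightarrow> 'g \<Rightarrow> 'k) \<Rightarrow> ('g \<Rightarrow> 'k) set" where
  "Cb2 A d X = {f. Ck_fun A 2 f \<and> (\<forall>\<alpha>\<in>multi_indices d 2. bounded (range (Xpow d X \<alpha> f)))}"

definition supported_in :: "('g \<Rightarrow> 'k::zero) \<Rightarrow> 'g set \<Rightarrow> bool" where
  "supported_in f K \<longleftrightarrow> (\<forall>x. x \<notin> K \<longrightarrow> f x = 0)"

definition test_functions ::
  "('g::topological_space, 'e::real_normed_vector) atlas \<Rightarrow>
     ('g \<Rightarrow> 'k::real_normed_vector) set" where
  "test_functions A = {f. (\<forall>k. Ck_fun A k f) \<and> (\<exists>K. compact K \<and> supported_in f K)}"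

definition linear_functional_on ::
  "('g \<Rightarrow> 'k::comm_ring_1) set \<Rightarrow> (('g \<Rightarrow> 'k) \<Rightarrow> 'k) \<Rightarrow> bool" where
  "linear_functional_on F L \<longleftrightarrow>
     (\<forall>f\<in>F. \<forall>g\<in>F. L (\<lambda>x. f x + g x) = L f + L g) \<and>
     (\<forall>a. \<forall>f\<in>F. L (\<lambda>x. a * f x) = a * L f)"

section \<open>Dissipative distributions\<close>

definition distribution ::
  "('g::topological_space, 'e::real_normed_vector) atlas \<Rightarrow> nat \<Rightarrow>
     (nat \<Rightarrow> ('g \<Rightarrow> 'k::real_normed_field) \<Rightarrow> 'g \<Rightarrow> 'k) \<Rightarrow> (('g \<Rightarrow> 'k) \<Rightarrow> 'k) \<Rightarrow> bool" where
  "distribution A d X P \<longleftrightarrow>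
     linear_functional_on (test_functions A) P \<and>
     (\<forall>K. compact K \<longrightarrow>
        (\<exists>m C. \<forall>f\<in>test_functions A. supported_in f K \<longrightarrow> norm (P f) \<le> C * Ck_norm d X m f))"

definition dissipative ::
  "('g::{topological_space, zero}, 'e::real_normed_vector) atlas \<Rightarrow> nat \<Rightarrow>
     (nat \<Rightarrow> ('g \<Rightarrow> 'k::real_normed_field) \<Rightarrow> 'g \<Rightarrow> 'k) \<Rightarrow> (('g \<Rightarrow> 'k) \<Rightarrow> 'k) \<Rightarrow> bool" where
  "dissipative A d X P \<longleftrightarrow>
     distribution A d X P \<and>
     (\<forall>f\<in>test_functions A. \<forall>h. f = (\<lambda>x. of_real (h x)) \<and> (\<forall>x. h x \<le> h 0) \<longrightarrow>
        (\<exists>r\<le>0. P f = of_real r))"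

text \<open>
  The measure \<open>P(dx)\<close> lives on the complement of the identity; \<open>\<nu>\<close> is its extension by zero
  to the whole group. On a second countable locally compact space the Radon measures are the
  Borel measures that are finite on compact sets.
\<close>

definition levy_measure ::
  "('g::{topological_space, zero}, 'e::real_normed_vector) atlas \<Rightarrow>
     (('g \<Rightarrow> 'k::{real_normed_field, euclidean_space}) \<Rightarrow> 'k) \<Rightarrow> 'g measure \<Rightarrow> bool" where
  "levy_measure A P \<nu> \<longleftrightarrow>
     sets \<nu> = sets borel \<and> emeasure \<nu> {0} = 0 \<and>
     (\<forall>K. compact K \<and> 0 \<notin> K \<longrightarrow> emeasure \<nu> K < \<infinity>) \<and>
     (\<forall>f\<in>test_functions A. (\<exists>K. compact K \<and> 0 \<notin> K \<and> supported_in f K) \<longrightarrow>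
        P f = (\<integral>x. f x \<partial>\<nu>))"

text \<open>
  \<open>Q\<close> is the extension of \<open>P\<close> to a functional on \<open>Cb2\<close>. It is uniquely determined on \<open>Cb2\<close>:
  every element of \<open>Cb2\<close> is the sum of a test function and of an element of \<open>Cb2\<close> whose
  derivatives of order at most two vanish at the identity.
\<close>

definition Cb2_extension ::
  "('g::{topological_space, zero}, 'e::real_normed_vector) atlas \<Rightarrow> nat \<Rightarrow>
     (nat \<Rightarrow> ('g \<Rightarrow> 'k::{real_normed_field, euclidean_space}) \<Rightarrow> 'g \<Rightarrow> 'k) \<Rightarrow>
     (('g \<Rightarrow> 'k) \<Rightarrow> 'k) \<Rightarrow> 'g measure \<Rightarrow> (('g \<Rightarrow> 'k) \<Rightarrow> 'k) \<Rightarrow> bool" where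
  "Cb2_extension A d X P \<nu> Q \<longleftrightarrow>
     linear_functional_on (Cb2 A d X) Q \<and>
     (\<exists>C. \<forall>f\<in>Cb2 A d X. norm (Q f) \<le> C * Ck_norm d X 2 f) \<and>
     (\<forall>f\<in>test_functions A. Q f = P f) \<and>
     (\<forall>f\<in>Cb2 A d X. f 0 = 0 \<and> (\<forall>j<d. X j f 0 = 0) \<and> (\<forall>j<d. \<forall>k<d. X j (X k f) 0 = 0) \<longrightarrow>
        integrable \<nu> f \<and> Q f = (\<integral>x. f x \<partial>\<nu>))"

text \<open>
  The constant \<open>convolution\<close> of the library is restricted to Euclidean spaces, hence the
  explicit image measure.
\<close>

definition convolution_semigroup ::
  "('g::{topological_group_add, t2_space, second_countable_topology}, 'e::real_normed_vector) atlas \<Rightarrow>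
     (('g \<Rightarrow> 'k::{real_normed_field, euclidean_space}) \<Rightarrow> 'k) \<Rightarrow> (real \<Rightarrow> 'g measure) \<Rightarrow> bool" where
  "convolution_semigroup A P \<mu> \<longleftrightarrow>
     (\<forall>t>0. sets (\<mu> t) = sets borel \<and> subprob_space (\<mu> t)) \<and>
     (\<forall>s>0. \<forall>t>0. distr (\<mu> s \<Otimes>\<^sub>M \<mu> t) borel (\<lambda>(x, y). x + y) = \<mu> (s + t)) \<and>
     (\<forall>f\<in>(bcontfun :: ('g \<Rightarrow> 'k) set). ((\<lambda>t. \<integral>x. f x \<partial>\<mu> t) \<longlongrightarrow> f 0) (at_right 0)) \<and>
     (\<forall>f\<in>test_functions A.
        ((\<lambda>t. ((\<integral>x. f x \<partial>\<mu> t) - f 0) /\<^sub>R t) \<longlongrightarrow> P f) (at_right 0))"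

section \<open>Representations on Banach spaces\<close>

text \<open>
  A Banach space over \<open>'k\<close> is a real Banach space with a compatible multiplication \<open>smul\<close>
  by the elements of \<open>'k\<close>.
\<close>

definition banach_over ::
  "('k::{real_normed_field, euclidean_space} \<Rightarrow> 'x::banach \<Rightarrow> 'x) \<Rightarrow> bool" where
  "banach_over smul \<longleftrightarrow> vector_space smul \<and>
     (\<forall>r u. smul (of_real r) u = r *\<^sub>R u) \<and>
     (\<forall>a u. norm (smul a u) = norm a * norm u)"

definition dual ::
  "('k::{real_normed_field, euclidean_space} \<Rightarrow> 'x::banach \<Rightarrow> 'x) \<Rightarrow> ('x \<Rightarrow> 'k) set" where
  "dual smul = {v. bounded_linear v \<and> (\<forall>a u. v (smul a u) = a * v u)}"

definition strongly_continuous_rep ::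
  "('k::{real_normed_field, euclidean_space} \<Rightarrow> 'x::banach \<Rightarrow> 'x) \<Rightarrow>
     ('g::topological_group_add \<Rightarrow> 'x \<Rightarrow>\<^sub>L 'x) \<Rightarrow> bool" where
  "strongly_continuous_rep smul \<pi> \<longleftrightarrow>
     (\<forall>x a u. \<pi> x (smul a u) = smul a (\<pi> x u)) \<and>
     \<pi> 0 = id_blinfun \<and> (\<forall>x y. \<pi> (x + y) = \<pi> x o\<^sub>L \<pi> y) \<and>
     (\<forall>u. continuous_on UNIV (\<lambda>x. \<pi> x u))"

definition coeff_fun :: "('g \<Rightarrow> 'x::real_normed_vector \<Rightarrow>\<^sub>L 'x) \<Rightarrow> 'x \<Rightarrow> ('x \<Rightarrow> 'k) \<Rightarrow> 'g \<Rightarrow> 'k" where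
  "coeff_fun \<pi> u v x = v (\<pi> x u)"

definition C2_vectors ::
  "('g, 'e::real_normed_vector) atlas \<Rightarrow> nat \<Rightarrow>
     (nat \<Rightarrow> ('g \<Rightarrow> 'k::{real_normed_field, euclidean_space}) \<Rightarrow> 'g \<Rightarrow> 'k) \<Rightarrow>
     ('k \<Rightarrow> 'x::banach \<Rightarrow> 'x) \<Rightarrow> ('g \<Rightarrow> 'x \<Rightarrow>\<^sub>L 'x) \<Rightarrow> 'x set" where
  "C2_vectors A d X smul \<pi> = {u. \<forall>v\<in>dual smul. coeff_fun \<pi> u v \<in> Cb2 A d X}"

text \<open>
  \<open>gen_pairing Q \<pi> u v\<close> is \<open>\<langle>\<pi>\<^sub>P u, v\<rangle> = \<langle>P, f\<^bsub>u,v\<^esub>\<rangle>\<close> for \<open>u\<close> in \<open>C2_vectors\<close>, with \<open>Q\<close> the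
  extension of \<open>P\<close> to \<open>Cb2\<close>. As a functional of \<open>v\<close> it lies in the bidual; it need not come
  from a vector, since \<open>C2_vectors\<close> is defined through the weak topology and is not always
  contained in the domain of the infinitesimal generator.
\<close>

definition gen_pairing ::
  "(('g \<Rightarrow> 'k) \<Rightarrow> 'k) \<Rightarrow> ('g \<Rightarrow> 'x::real_normed_vector \<Rightarrow>\<^sub>L 'x) \<Rightarrow> 'x \<Rightarrow> ('x \<Rightarrow> 'k) \<Rightarrow> 'k" where
  "gen_pairing Q \<pi> u v = Q (coeff_fun \<pi> u v)"

text \<open>
  \<open>rep_integral\<close> expresses \<open>w = \<integral> \<pi>(x) u \<mu>(dx)\<close> as a weak integral (the Bochner integral of the
  library needs a second countable space), and \<open>rep_generator\<close> expresses that \<open>u\<close> belongs to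
  the domain of the infinitesimal generator of the operator semigroup \<open>\<pi>\<^bsub>\<mu>(t)\<^esub>\<close> and is mapped
  to \<open>w\<close> by it.
\<close>

definition rep_integral ::
  "('k::{real_normed_field, euclidean_space} \<Rightarrow> 'x::banach \<Rightarrow> 'x) \<Rightarrow> ('g \<Rightarrow> 'x \<Rightarrow>\<^sub>L 'x) \<Rightarrow>
     'g measure \<Rightarrow> 'x \<Rightarrow> 'x \<Rightarrow> bool" where
  "rep_integral smul \<pi> M u w \<longleftrightarrow>
     (\<forall>v\<in>dual smul. integrable M (coeff_fun \<pi> u v) \<and> v w = (\<integral>x. coeff_fun \<pi> u v x \<partial>M))"

definition rep_generator ::
  "('k::{real_normed_field, euclidean_space} \<Rightarrow> 'x::banach \<Rightarrow> 'x) \<Rightarrow> ('g \<Rightarrow> 'x \<Rightarrow>\<^sub>L 'x) \<Rightarrow>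
     (real \<Rightarrow> 'g measure) \<Rightarrow> 'x \<Rightarrow> 'x \<Rightarrow> bool" where
  "rep_generator smul \<pi> \<mu> u w \<longleftrightarrow>
     (\<exists>T. (\<forall>t>0. rep_integral smul \<pi> (\<mu> t) u (T t)) \<and>
          ((\<lambda>t. (T t - u) /\<^sub>R t) \<longlongrightarrow> w) (at_right 0))"

end

theory Submission
  imports Defs
begin

text \<open>
  For \<open>f\<close> in \<open>Cb2\<close> the difference quotients \<open>(\<langle>\<mu>\<^sub>n(s), f\<rangle> - f(e)) / s\<close> converge to \<open>\<langle>P\<^sub>n, f\<rangle>\<close> as \<open>s\<close> tends to
  \<open>0\<close>, and for fixed \<open>s\<close> they converge as \<open>n\<close> tends to infinity; so everything rests on uniformity in \<open>n\<close>.
  Averaging in time and comparison with a random walk having one big jump show that \<open>\<mu>\<^sub>n(s) / s\<close> has uniformly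
  bounded mass away from \<open>e\<close> and is uniformly tight at infinity. Writing the increment over the time \<open>N s\<close> as a
  sum of \<open>N\<close> increments over the time \<open>s\<close> and expanding \<open>f\<close> to second order in a chart, the difference
  quotients for \<open>N s\<close> and for \<open>s\<close> differ by at most a small multiple of one plus the first and second moments of
  \<open>\<mu>\<^sub>n(s) / s\<close>. Applied to the coordinate functions and their squares this bounds the moments, and then it
  gives uniform convergence of the difference quotients of test functions. Finally \<open>f\<close> is the sum of a test
  function with the same 2-jet at \<open>e\<close> and of a function that vanishes to second order there, whose integrals
  are controlled by the moment and tail bounds.
\<close>

section \<open>Finite-dimensional normed spaces\<close>

text \<open>The hypothesis gives convergence for each time separately and without a rate, so it says
  nothing about \<open>\<mu> n s\<close> divided by a small \<open>s\<close>. The semigroup law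
  links the times: when \<open>N * s\<close> has a fixed size, the quotient for \<open>N * s\<close>
  is bounded by a sup norm, and it is the mean over \<open>k < N\<close> of the expected quotient at
  the position reached after \<open>k\<close> steps. That quotient differs little from the one at
  the identity as long as the position is near the identity, and the time up to which this is likely
  must not depend on \<open>n\<close>; this uniformity is what the average in time is for. The error
  is proportional to the moments of \<open>\<mu> n s / s\<close>, the very quantities in want of a
  bound; since the factor is small, they can be absorbed. The moments also explain the use of
  2-jets: a function with vanishing 2-jet is \<open>o(zeta_sq)\<close> at the identity, so bounded
  second moments make its contribution there negligible, uniformly in \<open>n\<close>.\<close>

lemma norm_lower_bound_independent:
  fixes B :: "'e::real_normed_vector set"
  assumes "finite B" "independent B"
  shows "\<exists>C>0. \<forall>c. \<forall>b\<in>B. \<bar>c b\<bar> \<le> C * norm (\<Sum>b\<in>B. c b *\<^sub>R b)"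
  using assms
proof (induction B rule: finite_induct)
  case empty
  then show ?case by (auto intro: exI[of _ 1])
next
  case (insert b B)
  from insert have ind: "independent B" and nb: "b \<notin> span B"
    by (auto simp: independent_insert)
  with insert obtain C where C: "C > 0" "\<And>c x. x \<in> B \<Longrightarrow> \<bar>c x\<bar> \<le> C * norm (\<Sum>b\<in>B. c b *\<^sub>R b)"
    by blast
  \<comment> \<open>The span of \<open>B\<close> is closed: the induction hypothesis turns
    convergence of a sequence in the span into convergence of its coefficients. As \<open>b\<close>
    is not in the span, it has a positive distance from it.\<close>
  have "\<exists>\<delta>>0. \<forall>c. \<delta> \<le> norm (b - (\<Sum>b\<in>B. c b *\<^sub>R b))"
  proof (rule ccontr)
    assume "\<not> ?thesis"
    then have "\<forall>n. \<exists>c. norm (b - (\<Sum>b\<in>B. c b *\<^sub>R b)) < inverse (real (Suc n))"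
      by (metis inverse_positive_iff_positive not_le of_nat_0_less_iff zero_less_Suc)
    then obtain c where c: "\<And>n. norm (b - (\<Sum>b\<in>B. c n b *\<^sub>R b)) < inverse (real (Suc n))"
      by metis
    define v where "v n = (\<Sum>b\<in>B. c n b *\<^sub>R b)" for n
    have "(\<lambda>n. b - v n) \<longlonglongrightarrow> 0"
      by (rule Lim_null_comparison[OF _ LIMSEQ_inverse_real_of_nat])
        (use c in \<open>auto intro!: always_eventually less_imp_le simp: v_def\<close>)
    then have vb: "v \<longlonglongrightarrow> b"
      using tendsto_diff[OF tendsto_const[of b]] by fastforce
    then have cau: "Cauchy v"
      by (rule LIMSEQ_imp_Cauchy)
    have "convergent (\<lambda>n. c n x)" if "x \<in> B" for x
    proof -
      have "Cauchy (\<lambda>n. c n x)"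
      proof (rule metric_CauchyI)
        fix e :: real assume "e > 0"
        then have "e / C > 0" using C by simp
        from metric_CauchyD[OF cau this] obtain M where
          M: "\<And>m n. m \<ge> M \<Longrightarrow> n \<ge> M \<Longrightarrow> dist (v m) (v n) < e / C" by blast
        have "dist (c m x) (c n x) < e" if "m \<ge> M" "n \<ge> M" for m n
        proof -
          have "\<bar>c m x - c n x\<bar> \<le> C * norm (\<Sum>b\<in>B. (c m b - c n b) *\<^sub>R b)"
            using C(2)[OF \<open>x \<in> B\<close>, of "\<lambda>x. c m x - c n x"] .
          also have "(\<Sum>b\<in>B. (c m b - c n b) *\<^sub>R b) = v m - v n"
            by (simp add: v_def scaleR_diff_left sum_subtractf)
          also have "C * norm (v m - v n) < C * (e / C)"
            using M[OF that] C by (intro mult_strict_left_mono) (auto simp: dist_norm)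
          finally show ?thesis using C by (simp add: dist_norm)
        qed
        then show "\<exists>M. \<forall>m\<ge>M. \<forall>n\<ge>M. dist (c m x) (c n x) < e" by blast
      qed
      then show ?thesis by (rule Cauchy_convergent)
    qed
    then have "\<forall>x\<in>B. \<exists>l. (\<lambda>n. c n x) \<longlonglongrightarrow> l" by (auto simp: convergent_def)
    then obtain l where "\<And>x. x \<in> B \<Longrightarrow> (\<lambda>n. c n x) \<longlonglongrightarrow> l x" by metis
    then have "v \<longlonglongrightarrow> (\<Sum>b\<in>B. l b *\<^sub>R b)"
      unfolding v_def by (intro tendsto_intros) auto
    then have "b = (\<Sum>b\<in>B. l b *\<^sub>R b)"
      using vb LIMSEQ_unique by blast
    moreover have "(\<Sum>b\<in>B. l b *\<^sub>R b) \<in> span B"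
      by (intro span_sum span_scale span_base)
    ultimately show False using nb by simp
  qed
  then obtain \<delta> where \<delta>: "\<delta> > 0" "\<And>c. \<delta> \<le> norm (b - (\<Sum>b\<in>B. c b *\<^sub>R b))" by blast
  \<comment> \<open>The distance \<delta> bounds \<open>c b\<close>; the induction hypothesis,
    applied to \<open>s - c b *\<^sub>R b\<close>, then bounds the other coefficients.\<close>
  have main: "\<bar>c x\<bar> \<le> (1/\<delta> + C * (1 + norm b / \<delta>)) * norm (\<Sum>b\<in>insert b B. c b *\<^sub>R b)"
    if x: "x \<in> insert b B" for c x
  proof -
    define s where "s = (\<Sum>b\<in>insert b B. c b *\<^sub>R b)"
    have s: "s = c b *\<^sub>R b + (\<Sum>b\<in>B. c b *\<^sub>R b)"
      using insert by (simp add: s_def)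
    have cb: "\<bar>c b\<bar> * \<delta> \<le> norm s"
    proof (cases "c b = 0")
      case False
      have "s = c b *\<^sub>R (b - (\<Sum>x\<in>B. (- c x / c b) *\<^sub>R x))"
        using False by (simp add: s scaleR_diff_right scaleR_sum_right flip: sum_negf)
      then have "norm s = \<bar>c b\<bar> * norm (b - (\<Sum>x\<in>B. (- c x / c b) *\<^sub>R x))"
        by simp
      then show ?thesis
        using mult_left_mono[OF \<delta>(2)[of "\<lambda>x. - c x / c b"], of "\<bar>c b\<bar>"] by simp
    qed simp
    then have cb': "\<bar>c b\<bar> \<le> norm s / \<delta>" using \<delta> by (simp add: pos_le_divide_eq)
    show ?thesis
    proof (cases "x = b")
      case True
      have "0 \<le> C * (1 + norm b / \<delta>) * norm s" using C \<delta> by simp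
      then show ?thesis using True cb' by (simp add: s_def[symmetric] algebra_simps)
    next
      case False
      then have "\<bar>c x\<bar> \<le> C * norm (\<Sum>b\<in>B. c b *\<^sub>R b)" using C(2) x by simp
      also have "\<dots> \<le> C * (norm s + \<bar>c b\<bar> * norm b)"
      proof (rule mult_left_mono)
        have "(\<Sum>b\<in>B. c b *\<^sub>R b) = s - c b *\<^sub>R b" using s by simp
        then show "norm (\<Sum>b\<in>B. c b *\<^sub>R b) \<le> norm s + \<bar>c b\<bar> * norm b"
          by (metis norm_scaleR norm_triangle_ineq4)
      qed (use C in simp)
      also have "\<dots> \<le> C * (norm s + norm s / \<delta> * norm b)"
        using C cb' by (intro mult_left_mono add_left_mono mult_right_mono) auto
      also have "\<dots> \<le> (1/\<delta> + C * (1 + norm b / \<delta>)) * norm s"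
        using C \<delta> by (simp add: algebra_simps)
      finally show ?thesis by (simp add: s_def)
    qed
  qed
  moreover have "1/\<delta> + C * (1 + norm b / \<delta>) > 0"
    using C \<delta> by (intro add_pos_nonneg) auto
  ultimately show ?case by blast
qed

text \<open>\<open>crd i\<close> is the \<open>i\<close>-th coordinate functional of the basis \<open>w\<close>.\<close>
locale finite_basis =
  fixes d :: nat and w :: "nat \<Rightarrow> 'e::real_normed_vector" and crd :: "nat \<Rightarrow> 'e \<Rightarrow> real"
  assumes bounded_linear_crd: "\<And>i. bounded_linear (crd i)"
    and crd_sum: "\<And>z. (\<Sum>i<d. crd i z *\<^sub>R w i) = z"
    and crd_basis: "\<And>i j. i < d \<Longrightarrow> j < d \<Longrightarrow> crd i (w j) = (if i = j then 1 else 0)"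

text \<open>The chain rule \<open>Ck_on_compose\<close> needs a basis of the middle space; this
  instance serves for outer functions of one real variable.\<close>

lemma finite_basis_real: "finite_basis (Suc 0) (\<lambda>_. 1::real) (\<lambda>_ x. x)"
  unfolding finite_basis_def by (simp add: bounded_linear_ident)

lemma finite_basis_exists:
  fixes w :: "nat \<Rightarrow> 'e::real_normed_vector"
  assumes inj: "inj_on w {..<d}" and ind: "independent (w ` {..<d})"
    and sp: "span (w ` {..<d}) = UNIV"
  shows "\<exists>crd. finite_basis d w crd"
proof -
  define B where "B = w ` {..<d}"
  define crd where "crd i z = representation B z (w i)" for i z
  have B: "finite B" "independent B" "span B = UNIV" using assms by (auto simp: B_def)
  have sumB: "(\<Sum>b\<in>B. representation B z b *\<^sub>R b) = z" for z
    using B sum_representation_eq[of B z B] by auto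
  then have sum: "(\<Sum>i<d. crd i z *\<^sub>R w i) = z" for z
    using inj by (simp add: B_def crd_def sum.reindex)
  obtain C where C: "C > 0" "\<And>c b. b \<in> B \<Longrightarrow> \<bar>c b\<bar> \<le> C * norm (\<Sum>b\<in>B. c b *\<^sub>R b)"
    using norm_lower_bound_independent[OF B(1,2)] by blast
  have bl: "bounded_linear (crd i)" for i
  proof (rule bounded_linear_intro[where K = C])
    show "crd i (x + y) = crd i x + crd i y" for x y
      by (simp add: crd_def representation_add[OF B(2)] B)
    show "crd i (r *\<^sub>R x) = r *\<^sub>R crd i x" for r x
      by (simp add: crd_def representation_scale[OF B(2)] B)
    show "norm (crd i x) \<le> norm x * C" for x
    proof (cases "w i \<in> B")
      case True
      then show ?thesis
        using C(2)[of "w i" "representation B x"] sumB[of x] by (simp add: crd_def mult.commute)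
    next
      case False
      then show ?thesis
        using representation_ne_zero[of B x "w i"] C(1) by (cases "crd i x = 0") (auto simp: crd_def)
    qed
  qed
  have "crd i (w j) = (if i = j then 1 else 0)" if "i < d" "j < d" for i j
    using that inj representation_basis[OF B(2), of "w j"]
    by (auto simp: crd_def B_def inj_on_def)
  with bl sum have "finite_basis d w crd" unfolding finite_basis_def by blast
  then show ?thesis by blast
qed

context finite_basis
begin

lemma crd_simps [simp]:
  "crd i (x + y) = crd i x + crd i y" "crd i (x - y) = crd i x - crd i y"
  "crd i (r *\<^sub>R x) = r * crd i x" "crd i 0 = 0"
  using bounded_linear_crd[of i]
  by (simp_all add: linear_simps)

lemma continuous_on_crd [continuous_intros]:
  "continuous_on S f \<Longrightarrow> continuous_on S (\<lambda>x. crd i (f x))"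
  by (rule bounded_linear.continuous_on[OF bounded_linear_crd])

lemma linear_expand:
  assumes "linear L" shows "L v = (\<Sum>i<d. crd i v *\<^sub>R L (w i))"
proof -
  have "L v = L (\<Sum>i<d. crd i v *\<^sub>R w i)" by (simp only: crd_sum)
  also have "\<dots> = (\<Sum>i<d. crd i v *\<^sub>R L (w i))"
    using assms by (simp add: linear_sum linear_cmul)
  finally show ?thesis .
qed

text \<open>The squared Euclidean norm in coordinates. It replaces the norm of \<open>'e\<close>,
  which need not be differentiable off the origin.\<close>

definition sqn :: "'e \<Rightarrow> real" where "sqn z = (\<Sum>i<d. (crd i z)\<^sup>2)"

lemma sqn_nonneg [simp]: "0 \<le> sqn z"
  by (simp add: sqn_def sum_nonneg)

lemma sqn_0 [simp]: "sqn 0 = 0"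
  by (simp add: sqn_def)

lemma sqn_scaleR [simp]: "sqn (t *\<^sub>R z) = t\<^sup>2 * sqn z"
  by (simp add: sqn_def power_mult_distrib sum_distrib_left)

lemma crd_le_sqn: "i < d \<Longrightarrow> (crd i z)\<^sup>2 \<le> sqn z"
  unfolding sqn_def by (rule member_le_sum) auto

lemma abs_crd_le: "i < d \<Longrightarrow> \<bar>crd i z\<bar> \<le> sqrt (sqn z)"
  using crd_le_sqn[of i z] by (metis real_sqrt_abs real_sqrt_le_iff)

lemma continuous_on_sqn [continuous_intros]:
  "continuous_on S f \<Longrightarrow> continuous_on S (\<lambda>x. sqn (f x))"
  unfolding sqn_def by (intro continuous_intros)

lemma norm_le_sqn: "\<exists>C>0. \<forall>z. norm z \<le> C * sqrt (sqn z)"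
proof (intro exI conjI allI)
  show "1 + (\<Sum>i<d. norm (w i)) > 0" by (simp add: add_pos_nonneg sum_nonneg)
  fix z
  have "norm z = norm (\<Sum>i<d. crd i z *\<^sub>R w i)" by (simp only: crd_sum)
  also have "\<dots> \<le> (\<Sum>i<d. \<bar>crd i z\<bar> * norm (w i))"
    by (rule order_trans[OF norm_sum]) simp
  also have "\<dots> \<le> (\<Sum>i<d. sqrt (sqn z) * norm (w i))"
    by (intro sum_mono mult_right_mono abs_crd_le) auto
  also have "\<dots> \<le> (1 + (\<Sum>i<d. norm (w i))) * sqrt (sqn z)"
    by (simp add: algebra_simps sum_distrib_left)
  finally show "norm z \<le> (1 + (\<Sum>i<d. norm (w i))) * sqrt (sqn z)" .
qed

text \<open>Induction on the number \<open>n\<close> of coordinates that are kept: the truncated box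
  is the Minkowski sum of the previous one and a compact segment, and at \<open>n = d\<close>
  nothing is truncated.\<close>

lemma compact_box: "compact {z. \<forall>i<d. \<bar>crd i z\<bar> \<le> r}"
proof -
  have "compact ((\<lambda>z. \<Sum>i<n. crd i z *\<^sub>R w i) ` {z. \<forall>i<d. \<bar>crd i z\<bar> \<le> r} )"
    if "n \<le> d" "r \<ge> 0" for n
    using that
  proof (induction n)
    case 0
    have "(\<lambda>z::'e. 0::'e) ` {z. \<forall>i<d. \<bar>crd i z\<bar> \<le> r} = {0}"
      using 0 by (auto intro!: image_eqI[of _ _ 0])
    then show ?case by simp
  next
    case (Suc n)
    define S where "S = {z. \<forall>i<d. \<bar>crd i z\<bar> \<le> r}"
    have crdsum: "crd i (\<Sum>j<n. crd j z *\<^sub>R w j) = (if i < n then crd i z else 0)" if "i < d" for i z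
    proof -
      have "crd i (\<Sum>j<n. crd j z *\<^sub>R w j) = (\<Sum>j<n. crd j z * crd i (w j))"
        by (subst linear_sum[OF bounded_linear.linear[OF bounded_linear_crd[of i]]]) simp
      also have "\<dots> = (\<Sum>j<n. if i = j then crd j z else 0)"
        using Suc that by (intro sum.cong) (auto simp: crd_basis)
      also have "\<dots> = (if i < n then crd i z else 0)" by simp
      finally show ?thesis .
    qed
    have "(\<lambda>z. \<Sum>i<Suc n. crd i z *\<^sub>R w i) ` S =
       {x + y |x y. x \<in> (\<lambda>z. \<Sum>i<n. crd i z *\<^sub>R w i) ` S \<and> y \<in> (\<lambda>t. t *\<^sub>R w n) ` {-r..r}}"
    proof safe
      fix z assume "z \<in> S"
      then show "\<exists>x y. (\<Sum>i<Suc n. crd i z *\<^sub>R w i) = x + y \<and>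
         x \<in> (\<lambda>z. \<Sum>i<n. crd i z *\<^sub>R w i) ` S \<and> y \<in> (\<lambda>t. t *\<^sub>R w n) ` {-r..r}"
        using Suc.prems
        by (intro exI[of _ "\<Sum>i<n. crd i z *\<^sub>R w i"] exI[of _ "crd n z *\<^sub>R w n"])
          (auto simp: S_def abs_le_iff minus_le_iff intro!: imageI)
    next
      fix z t assume z: "z \<in> S" and t: "t \<in> {-r..r}"
      define z' where "z' = (\<Sum>i<n. crd i z *\<^sub>R w i) + t *\<^sub>R w n"
      have c: "crd i z' = (if i < n then crd i z else if i = n then t else 0)" if "i < d" for i
        using that Suc.prems by (auto simp: z'_def crdsum crd_basis)
      have "z' \<in> S" using z t Suc.prems by (auto simp: S_def c abs_le_iff)
      moreover have "(\<Sum>i<Suc n. crd i z' *\<^sub>R w i) = z'"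
      proof -
        have "(\<Sum>i<n. crd i z' *\<^sub>R w i) = (\<Sum>i<n. crd i z *\<^sub>R w i)"
          using Suc.prems by (intro sum.cong) (auto simp: c)
        then show ?thesis using Suc.prems by (simp add: c) (simp add: z'_def)
      qed
      ultimately have "z' \<in> (\<lambda>z. \<Sum>i<Suc n. crd i z *\<^sub>R w i) ` S"
        by (intro image_eqI[of _ _ z']) auto
      then show "(\<Sum>i<n. crd i z *\<^sub>R w i) + t *\<^sub>R w n \<in> (\<lambda>z. \<Sum>i<Suc n. crd i z *\<^sub>R w i) ` S"
        by (simp only: z'_def)
    qed
    moreover have "compact ((\<lambda>t. t *\<^sub>R w n) ` {-r..r})"
      by (intro compact_continuous_image continuous_intros) auto
    ultimately show ?case
      using compact_sums[of "(\<lambda>z. \<Sum>i<n. crd i z *\<^sub>R w i) ` S" "(\<lambda>t. t *\<^sub>R w n) ` {-r..r}"] Suc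
      by (simp add: S_def)
  qed
  from this[of d] show ?thesis
  proof (cases "r \<ge> 0")
    \<comment> \<open>For negative \<open>r\<close> the box is empty, except in dimension zero,
      where the condition on the coordinates is void and the box is \<open>{0}\<close>.\<close>
    case False
    show ?thesis
    proof (cases "d = 0")
      case True
      then have "z = 0" for z :: 'e using crd_sum[of z] by simp
      then have "{z. \<forall>i<d. \<bar>crd i z\<bar> \<le> r} = {0}" using True by auto
      then show ?thesis by simp
    next
      case False2: False
      have "{z. \<forall>i<d. \<bar>crd i z\<bar> \<le> r} = {}" using False False2 by (force intro!: exI[of _ 0])
      then show ?thesis by (simp only: compact_empty)
    qed
  qed (simp add: crd_sum)
qed

lemma compact_sqn_ball: "compact {z. sqn (z - p) \<le> r}"
proof -
  have "{z. sqn z \<le> r} \<subseteq> {z. \<forall>i<d. \<bar>crd i z\<bar> \<le> sqrt r}"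
    by (auto intro: order_trans[OF abs_crd_le] real_sqrt_le_mono)
  moreover have "closed {z. sqn z \<le> r}"
    by (intro closed_Collect_le continuous_intros)
  ultimately have "compact {z. sqn z \<le> r}"
    using compact_Int_closed[OF compact_box[of "sqrt r"], of "{z. sqn z \<le> r}"]
    by (simp add: inf.absorb2)
  then have "compact ((+) p ` {z. sqn z \<le> r})" by (rule compact_translation)
  also have "(+) p ` {z. sqn z \<le> r} = {z. sqn (z - p) \<le> r}"
  proof safe
    fix z assume "sqn (z - p) \<le> r"
    then show "z \<in> (+) p ` {z. sqn z \<le> r}" by (intro image_eqI[of _ _ "z - p"]) auto
  qed auto
  finally show ?thesis .
qed

lemma sqn_ball_in_open:
  assumes "open S" "p \<in> S"
  shows "\<exists>r>0. {z. sqn (z - p) \<le> r} \<subseteq> S"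
proof -
  obtain e where e: "e > 0" "ball p e \<subseteq> S" using assms open_contains_ball by blast
  obtain C where C: "C > 0" "\<And>z. norm z \<le> C * sqrt (sqn z)" using norm_le_sqn by blast
  define r where "r = (e / (2 * C))\<^sup>2"
  have "r > 0" using e C by (simp add: r_def)
  moreover have "{z. sqn (z - p) \<le> r} \<subseteq> S"
  proof safe
    fix z assume "sqn (z - p) \<le> r"
    then have "sqrt (sqn (z - p)) \<le> e / (2 * C)"
      using e C unfolding r_def by (intro real_le_lsqrt) auto
    then have "norm (z - p) \<le> C * (e / (2 * C))"
      using C by (intro order_trans[OF C(2)] mult_left_mono) auto
    then have "dist p z < e" using C e by (simp add: dist_norm norm_minus_commute)
    then show "z \<in> S" using e by auto
  qed
  ultimately show ?thesis by blast
qed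

end

section \<open>Calculus of the classes \<open>C\<^sup>k\<close>\<close>

lemma Ck_on_Suc_imp: "Ck_on (Suc k) S f \<Longrightarrow> Ck_on k S f"
proof (induction k arbitrary: f)
  case 0
  then show ?case
    by (auto intro!: continuous_at_imp_continuous_on differentiable_imp_continuous_within)
next
  case (Suc k)
  then show ?case by auto
qed

lemma Ck_on_mono: "Ck_on k S f \<Longrightarrow> j \<le> k \<Longrightarrow> Ck_on j S f"
proof (induction k)
  case (Suc k)
  then show ?case using Ck_on_Suc_imp[of k S f] by (cases "j = Suc k") auto
qed simp

lemma Ck_on_imp_continuous_on: "Ck_on k S f \<Longrightarrow> continuous_on S f"
  using Ck_on_mono[of k S f 0] by simp

lemma Ck_on_subset: "Ck_on k S f \<Longrightarrow> T \<subseteq> S \<Longrightarrow> Ck_on k T f"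
  by (induction k arbitrary: f) (auto intro: continuous_on_subset)

lemma frechet_derivative_cong_open:
  assumes "open S" "x \<in> S" "\<And>x. x \<in> S \<Longrightarrow> f x = g x"
  shows "frechet_derivative f (at x) = frechet_derivative g (at x)"
proof -
  have "(f has_derivative D) (at x) \<longleftrightarrow> (g has_derivative D) (at x)" for D
    using has_derivative_transform_within_open[OF _ assms(1,2), of f D UNIV g]
      has_derivative_transform_within_open[OF _ assms(1,2), of g D UNIV f] assms(3) by auto
  then show ?thesis unfolding frechet_derivative_def by simp
qed

lemma differentiable_cong_open:
  assumes "open S" "x \<in> S" "\<And>x. x \<in> S \<Longrightarrow> f x = g x" "f differentiable (at x)"
  shows "g differentiable (at x)"
  using has_derivative_transform_within_open[OF _ assms(1,2), of f _ UNIV g] assms(3,4)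
  unfolding differentiable_def by auto

lemma Ck_on_cong:
  assumes "open S" "Ck_on k S f" "\<And>x. x \<in> S \<Longrightarrow> f x = g x"
  shows "Ck_on k S g"
  using assms(2,3)
proof (induction k arbitrary: f g)
  case 0
  then show ?case by (auto cong: continuous_on_cong)
next
  case (Suc k)
  then have "\<forall>x\<in>S. g differentiable (at x)"
    using differentiable_cong_open[OF assms(1) _ Suc.prems(2)] by auto
  moreover have "Ck_on k S (\<lambda>x. frechet_derivative g (at x) v)" for v
  proof (rule Suc.IH)
    show "Ck_on k S (\<lambda>x. frechet_derivative f (at x) v)" using Suc.prems(1) by simp
    show "frechet_derivative f (at x) v = frechet_derivative g (at x) v" if "x \<in> S" for x
      using frechet_derivative_cong_open[OF assms(1) that Suc.prems(2)] by simp
  qed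
  ultimately show ?case by simp
qed

text \<open>\<open>Ck_on\<close> is tied to the particular term \<open>frechet_derivative\<close>;
  by uniqueness of the derivative any explicit formula may take its place. The closure rules that
  involve a differentiation rule go through this lemma.\<close>

lemma Ck_on_SucI:
  assumes "open S" "\<And>x. x \<in> S \<Longrightarrow> (f has_derivative f' x) (at x)"
    "\<And>v. Ck_on k S (\<lambda>x. f' x v)"
  shows "Ck_on (Suc k) S f"
proof -
  have "f' x = frechet_derivative f (at x)" if "x \<in> S" for x
    using assms(2)[OF that] by (rule frechet_derivative_at)
  then show ?thesis
    using assms by (auto simp: differentiable_def intro: Ck_on_cong[OF assms(1) assms(3)])
qed

lemma Ck_on_Suc_has_derivative:
  "Ck_on (Suc k) S f \<Longrightarrow> x \<in> S \<Longrightarrow> (f has_derivative frechet_derivative f (at x)) (at x)"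
  using frechet_derivative_works by auto

lemma Ck_on_Suc_derivative: "Ck_on (Suc k) S f \<Longrightarrow> Ck_on k S (\<lambda>x. frechet_derivative f (at x) v)"
  by simp

lemma Ck_on_Un_family:
  assumes "\<And>i. i \<in> I \<Longrightarrow> open (S i)" "\<And>i. i \<in> I \<Longrightarrow> Ck_on k (S i) f"
  shows "Ck_on k (\<Union>i\<in>I. S i) f"
  using assms(2)
proof (induction k arbitrary: f)
  case 0
  then show ?case using continuous_on_open_UN[of I S f] assms(1) by simp
next
  case (Suc k)
  then show ?case by (simp add: ball_UN)
qed

lemma Ck_on_locally:
  assumes "\<And>x. x \<in> S \<Longrightarrow> \<exists>T. open T \<and> x \<in> T \<and> Ck_on k T f"
  shows "Ck_on k S f"
proof -
  obtain T where T: "\<And>x. x \<in> S \<Longrightarrow> open (T x) \<and> x \<in> T x \<and> Ck_on k (T x) f"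
    using assms by metis
  then have "Ck_on k (\<Union>x\<in>S. T x) f" by (intro Ck_on_Un_family) auto
  then show ?thesis by (rule Ck_on_subset) (use T in auto)
qed

lemma Ck_on_const [simp]: "Ck_on k S (\<lambda>_. c)"
  by (induction k arbitrary: c) auto

lemma Ck_on_bounded_linear:
  assumes "bounded_linear L" shows "Ck_on k UNIV L"
proof (cases k)
  case 0
  then show ?thesis by (simp add: linear_continuous_on[OF assms])
next
  case (Suc j)
  have "Ck_on (Suc j) UNIV L"
    by (rule Ck_on_SucI[where f' = "\<lambda>_. L"])
      (simp_all add: bounded_linear_imp_has_derivative[OF assms])
  then show ?thesis by (simp only: Suc)
qed

lemma Ck_on_bounded_linear_comp:
  assumes L: "bounded_linear L" and "open S" "Ck_on k S f"
  shows "Ck_on k S (\<lambda>x. L (f x))"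
  using assms(3)
proof (induction k arbitrary: f)
  case 0
  then show ?case by (simp add: bounded_linear.continuous_on[OF L])
next
  case (Suc k)
  show ?case
    by (rule Ck_on_SucI[OF \<open>open S\<close>])
      (rule bounded_linear.has_derivative[OF L] Suc.IH Ck_on_Suc_has_derivative[OF Suc.prems]
        Ck_on_Suc_derivative[OF Suc.prems] | assumption)+
qed

lemma Ck_on_add:
  assumes "open S" "Ck_on k S f" "Ck_on k S g"
  shows "Ck_on k S (\<lambda>x. f x + g x)"
  using assms(2,3)
proof (induction k arbitrary: f g)
  case 0
  then show ?case by (auto intro: continuous_on_add)
next
  case (Suc k)
  show ?case
    by (rule Ck_on_SucI[OF \<open>open S\<close>])
      (rule has_derivative_add Suc.IH Suc.prems[THEN Ck_on_Suc_has_derivative]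
        Suc.prems[THEN Ck_on_Suc_derivative] | assumption)+
qed

lemma Ck_on_sum:
  assumes "open S" "\<And>i. i \<in> I \<Longrightarrow> Ck_on k S (f i)"
  shows "Ck_on k S (\<lambda>x. \<Sum>i\<in>I. f i x)"
  using assms(2)
  by (induction I rule: infinite_finite_induct) (auto intro: Ck_on_add[OF assms(1)])

lemma Ck_on_bilinear:
  assumes B: "bounded_bilinear B" and "open S" "Ck_on k S f" "Ck_on k S g"
  shows "Ck_on k S (\<lambda>x. B (f x) (g x))"
  using assms(3,4)
proof (induction k arbitrary: f g)
  case 0
  then show ?case by (simp add: bounded_bilinear.continuous_on[OF B])
next
  case (Suc k)
  show ?case
    by (rule Ck_on_SucI[OF \<open>open S\<close>])
      (rule bounded_bilinear.FDERIV[OF B] Ck_on_add[OF \<open>open S\<close>] Suc.IH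
        Suc.prems[THEN Ck_on_Suc_has_derivative] Suc.prems[THEN Ck_on_Suc_derivative]
        Suc.prems[THEN Ck_on_Suc_imp] | assumption)+
qed

lemmas Ck_on_scaleR = Ck_on_bilinear[OF bounded_bilinear_scaleR]
lemmas Ck_on_mult = Ck_on_bilinear[OF bounded_bilinear_mult]

lemma Ck_on_minus: "open S \<Longrightarrow> Ck_on k S f \<Longrightarrow> Ck_on k S (\<lambda>x. - f x)"
  by (rule Ck_on_bounded_linear_comp[OF bounded_linear_minus[OF bounded_linear_ident]])

lemma Ck_on_diff:
  "open S \<Longrightarrow> Ck_on k S f \<Longrightarrow> Ck_on k S g \<Longrightarrow> Ck_on k S (\<lambda>x. f x - g x)"
  using Ck_on_add[of S k f "\<lambda>x. - g x"] Ck_on_minus[of S k g] by simp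

lemma Ck_on_prod:
  fixes f :: "'i \<Rightarrow> 'e::real_normed_vector \<Rightarrow> real"
  assumes "open S" "\<And>i. i \<in> I \<Longrightarrow> Ck_on k S (f i)"
  shows "Ck_on k S (\<lambda>x. \<Prod>i\<in>I. f i x)"
  using assms(2)
  by (induction I rule: infinite_finite_induct) (auto intro: Ck_on_mult[OF assms(1)])

lemma Ck_on_inverse:
  fixes f :: "'e::real_normed_vector \<Rightarrow> real"
  assumes "open S" "Ck_on k S f" "\<And>x. x \<in> S \<Longrightarrow> f x \<noteq> 0"
  shows "Ck_on k S (\<lambda>x. inverse (f x))"
  using assms(2)
proof (induction k)
  case 0
  then show ?case using assms(3) by (auto intro: continuous_on_inverse)
next
  case (Suc k)
  note IH = Suc.IH[OF Ck_on_Suc_imp[OF Suc.prems]]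
  show ?case
  proof (rule Ck_on_SucI[OF \<open>open S\<close>])
    show "((\<lambda>x. inverse (f x)) has_derivative
       (\<lambda>v. - (inverse (f x) * frechet_derivative f (at x) v * inverse (f x)))) (at x)" if "x \<in> S" for x
      by (rule Deriv.has_derivative_inverse[OF assms(3)[OF that] Ck_on_Suc_has_derivative[OF Suc.prems that]])
    show "Ck_on k S (\<lambda>x. - (inverse (f x) * frechet_derivative f (at x) v * inverse (f x)))" for v
      by (intro Ck_on_minus Ck_on_mult IH \<open>open S\<close> Ck_on_Suc_derivative[OF Suc.prems])
  qed
qed

text \<open>A chain rule for affine inner maps that asks for no basis of the middle space;
  \<open>joint_slice\<close> applies it with the product of two copies of \<open>'e\<close> in the
  middle.\<close>

lemma Ck_on_affine_comp:
  assumes l: "bounded_linear l" and "open S" "Ck_on k S f"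
  shows "Ck_on k {z. l z + c \<in> S} (\<lambda>z. f (l z + c))"
  using assms(3)
proof (induction k arbitrary: f)
  case 0
  then show ?case
    by (auto intro!: continuous_on_compose2[of S f] continuous_intros bounded_linear.continuous_on[OF l])
next
  case (Suc k)
  show ?case
  proof (rule Ck_on_SucI)
    have "open ((\<lambda>z. l z + c) -` S)"
      by (intro open_vimage \<open>open S\<close> continuous_intros bounded_linear.continuous_on[OF l])
    then show "open {z. l z + c \<in> S}" by (simp add: vimage_def)
    show "((\<lambda>z. f (l z + c)) has_derivative (\<lambda>v. frechet_derivative f (at (l z + c)) (l v))) (at z)"
      if "z \<in> {z. l z + c \<in> S}" for z
    proof (rule has_derivative_compose[of "\<lambda>z. l z + c" l])
      show "((\<lambda>z. l z + c) has_derivative l) (at z)"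
        using has_derivative_add[OF bounded_linear_imp_has_derivative[OF l] has_derivative_const, of c]
        by simp
      show "(f has_derivative frechet_derivative f (at (l z + c))) (at (l z + c))"
        using that Suc.prems Ck_on_Suc_has_derivative by auto
    qed
    show "Ck_on k {z. l z + c \<in> S} (\<lambda>z. frechet_derivative f (at (l z + c)) (l v))" for v
      using Suc.prems by (intro Suc.IH[of "\<lambda>x. frechet_derivative f (at x) (l v)"]) auto
  qed
qed

context finite_basis
begin

text \<open>In the derivative of the composite the direction at which \<open>g\<close> is
  differentiated varies with \<open>x\<close>, which the induction hypothesis cannot handle.
  Expanding that direction in the basis leaves products of a coordinate function with derivatives of
  \<open>g\<close> in the fixed directions \<open>w i\<close>.\<close>

lemma Ck_on_compose:
  assumes "open S" "open T" "Ck_on k S f" "Ck_on k T g" "\<And>x. x \<in> S \<Longrightarrow> f x \<in> T"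
  shows "Ck_on k S (\<lambda>x. g (f x :: 'e))"
  using assms(3,4)
proof (induction k arbitrary: g)
  case 0
  then show ?case using assms(5) by (auto intro: continuous_on_compose2)
next
  case (Suc k)
  have f: "(f has_derivative frechet_derivative f (at x)) (at x)" if "x \<in> S" for x
    using Ck_on_Suc_has_derivative Suc.prems(1) that .
  have g: "(g has_derivative frechet_derivative g (at (f x))) (at (f x))" if "x \<in> S" for x
    using Ck_on_Suc_has_derivative Suc.prems(2) assms(5)[OF that] .
  show ?case
  proof (rule Ck_on_SucI[OF \<open>open S\<close>])
    fix x assume x: "x \<in> S"
    have "(\<lambda>u. frechet_derivative g (at (f x)) u) =
        (\<lambda>u. \<Sum>i<d. crd i u *\<^sub>R frechet_derivative g (at (f x)) (w i))"
      by (rule ext) (rule linear_expand[OF has_derivative_linear[OF g[OF x]]])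
    from this[unfolded fun_eq_iff, rule_format, symmetric] show "((\<lambda>x. g (f x)) has_derivative
       (\<lambda>v. \<Sum>i<d. crd i (frechet_derivative f (at x) v) *\<^sub>R frechet_derivative g (at (f x)) (w i))) (at x)"
      using has_derivative_compose[OF f[OF x] g[OF x]] by (simp only:)
  next
    fix v
    show "Ck_on k S (\<lambda>x. \<Sum>i<d. crd i (frechet_derivative f (at x) v) *\<^sub>R frechet_derivative g (at (f x)) (w i))"
      by (intro Ck_on_sum Ck_on_scaleR Ck_on_bounded_linear_comp[OF bounded_linear_crd] \<open>open S\<close>
          Suc.IH[of "\<lambda>y. frechet_derivative g (at y) (w i)" for i]
          Ck_on_Suc_derivative Suc.prems Ck_on_Suc_imp[OF Suc.prems(1)])
  qed
qed

end

text \<open>This family is closed under differentiation up to linear combinations, whence smoothness at \<open>0\<close>.\<close>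

definition flat_exp :: "nat \<Rightarrow> real \<Rightarrow> real" where
  "flat_exp m t = (if t > 0 then exp (- inverse t) * inverse t ^ m else 0)"

lemma flat_exp_nonneg: "0 \<le> flat_exp m t"
  by (simp add: flat_exp_def)

lemma flat_exp_pos: "t > 0 \<Longrightarrow> 0 < flat_exp m t"
  by (simp add: flat_exp_def)

lemma flat_exp_tendsto_0: "((\<lambda>t. flat_exp m t) \<longlongrightarrow> 0) (at 0)"
proof -
  have "((\<lambda>x::real. x ^ m / exp x) \<longlongrightarrow> 0) at_top" by (rule tendsto_power_div_exp_0)
  then have "((\<lambda>t::real. inverse t ^ m / exp (inverse t)) \<longlongrightarrow> 0) (at_right 0)"
    by (rule filterlim_compose) (rule filterlim_inverse_at_top_right)
  then have "((\<lambda>t. flat_exp m t) \<longlongrightarrow> 0) (at_right 0)"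
    by (rule Lim_transform_eventually)
      (auto simp: eventually_at_right_less flat_exp_def exp_minus field_simps
        intro!: eventually_mono[OF eventually_at_right_less[of 0]])
  moreover have "((\<lambda>t. flat_exp m t) \<longlongrightarrow> 0) (at_left 0)"
    by (rule Lim_transform_eventually[of "\<lambda>_. 0"])
      (auto simp: flat_exp_def eventually_at_left_field intro!: exI[of _ "-1"])
  ultimately show ?thesis by (simp add: filterlim_at_split)
qed

lemma flat_exp_has_derivative:
  "(flat_exp m has_derivative (\<lambda>v. v * (flat_exp (m + 2) t - m * flat_exp (m + 1) t))) (at t)"
proof -
  consider "t > 0" | "t < 0" | "t = 0" by linarith
  then have "(flat_exp m has_field_derivative (flat_exp (m + 2) t - m * flat_exp (m + 1) t)) (at t)"
  proof cases
    case 1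
    have "((\<lambda>t. exp (- inverse t) * inverse t ^ m) has_field_derivative
        (flat_exp (m + 2) t - m * flat_exp (m + 1) t)) (at t)"
      using 1 
      by (auto intro!: derivative_eq_intros simp: flat_exp_def)
        (cases m; simp add: field_simps power2_eq_square)
    then show ?thesis
      by (rule has_field_derivative_transform_within_open[of _ _ _ "{0<..}"])
        (use 1 in \<open>auto simp: flat_exp_def\<close>)
  next
    case 2
    have "((\<lambda>t. 0) has_field_derivative (flat_exp (m + 2) t - m * flat_exp (m + 1) t)) (at t)"
      using 2 by (simp add: flat_exp_def)
    then show ?thesis
      by (rule has_field_derivative_transform_within_open[of _ _ _ "{..<0}"])
        (use 2 in \<open>auto simp: flat_exp_def\<close>)
  next
    case 3
    \<comment> \<open>The difference quotient at \<open>0\<close> is itself a member of the family,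
      so its limit is known.\<close>
    have "(\<lambda>h. (flat_exp m (0 + h) - flat_exp m 0) / h) = flat_exp (Suc m)"
      by (auto simp: flat_exp_def fun_eq_iff divide_inverse)
    then have "(flat_exp m has_field_derivative 0) (at 0)"
      unfolding DERIV_def using flat_exp_tendsto_0[of "Suc m"] by simp
    then show ?thesis using 3 by (simp add: flat_exp_def)
  qed
  then show ?thesis
    by (simp only: has_field_derivative_def mult.commute[of _ "flat_exp (m + 2) t - m * flat_exp (m + 1) t"])
qed

lemma Ck_on_flat_exp: "Ck_on k UNIV (flat_exp m)"
proof (induction k arbitrary: m)
  case 0
  show ?case
    using has_derivative_continuous[OF flat_exp_has_derivative]
    by (simp add: continuous_at_imp_continuous_on)
next
  case (Suc k)
  have "Ck_on k UNIV (\<lambda>t. v * (flat_exp (m + 2) t - m * flat_exp (m + 1) t))" for v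
    by (intro Ck_on_mult Ck_on_diff Suc.IH) auto
  then show ?case by (intro Ck_on_SucI[OF _ flat_exp_has_derivative]) auto
qed

section \<open>Smooth cutoffs on the line and in coordinates\<close>

definition smooth_step :: "real \<Rightarrow> real" where
  "smooth_step t = flat_exp 0 (2 - t) * inverse (flat_exp 0 (2 - t) + flat_exp 0 (t - 1))"

lemma smooth_step_denom_pos: "flat_exp 0 (2 - t) + flat_exp 0 (t - 1) > 0"
  using flat_exp_pos[of "2 - t" 0] flat_exp_pos[of "t - 1" 0] flat_exp_nonneg[of 0 "2 - t"] flat_exp_nonneg[of 0 "t - 1"]
  by (cases "t < 2") linarith+

lemma smooth_step_bounds: "0 \<le> smooth_step t" "smooth_step t \<le> 1"
  using smooth_step_denom_pos[of t] flat_exp_nonneg[of 0 "2 - t"] flat_exp_nonneg[of 0 "t - 1"]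
  by (auto simp: smooth_step_def field_simps)

lemma smooth_step_eq_1: "t \<le> 1 \<Longrightarrow> smooth_step t = 1"
  using flat_exp_pos[of "2 - t" 0] by (simp add: smooth_step_def flat_exp_def[of 0 "t - 1"])

lemma smooth_step_eq_0: "t \<ge> 2 \<Longrightarrow> smooth_step t = 0"
  by (simp add: smooth_step_def flat_exp_def[of 0 "2 - t"])

lemma Ck_on_smooth_step: "Ck_on k UNIV smooth_step"
proof -
  have "Ck_on k UNIV (\<lambda>t. flat_exp 0 (2 - t))"
    using Ck_on_affine_comp[OF bounded_linear_minus[OF bounded_linear_ident] _ Ck_on_flat_exp[of k 0], of 2]
    by simp
  moreover have "Ck_on k UNIV (\<lambda>t. flat_exp 0 (t - 1))"
    using Ck_on_affine_comp[OF bounded_linear_ident _ Ck_on_flat_exp[of k 0], of "-1"] by simp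
  ultimately show ?thesis
    unfolding smooth_step_def using smooth_step_denom_pos
    by (intro Ck_on_mult Ck_on_inverse Ck_on_add) (auto simp: less_imp_neq[THEN not_sym])
qed

context finite_basis
begin

lemma Ck_on_crd: "Ck_on k UNIV (\<lambda>z. crd i (z - p))"
  using Ck_on_affine_comp[OF bounded_linear_ident _ Ck_on_bounded_linear[OF bounded_linear_crd[of i]], of k "-p"]
  by simp

definition bump :: "'e \<Rightarrow> real \<Rightarrow> 'e \<Rightarrow> real" where
  "bump p r z = smooth_step (sqn (z - p) / r)"

lemma bump_bounds: "0 \<le> bump p r z" "bump p r z \<le> 1"
  by (simp_all add: bump_def smooth_step_bounds)

lemma bump_eq_1: "r > 0 \<Longrightarrow> sqn (z - p) \<le> r \<Longrightarrow> bump p r z = 1"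
  by (simp add: bump_def smooth_step_eq_1)

lemma bump_eq_0: "r > 0 \<Longrightarrow> sqn (z - p) \<ge> 2 * r \<Longrightarrow> bump p r z = 0"
  by (simp add: bump_def smooth_step_eq_0 field_simps)

lemma Ck_on_bump: "Ck_on k UNIV (bump p r)"
proof -
  have "Ck_on k UNIV (\<lambda>z. sqn (z - p) / r)"
    unfolding sqn_def divide_inverse power2_eq_square
    by (intro Ck_on_mult Ck_on_sum Ck_on_crd) auto
  then show ?thesis
    unfolding bump_def
    by (intro finite_basis.Ck_on_compose[OF finite_basis_real _ _ _ Ck_on_smooth_step]) auto
qed

end

section \<open>Smooth functions on a Lie group\<close>

locale lie_chart = finite_basis d w crd
  for d :: nat and w :: "nat \<Rightarrow> 'e::real_normed_vector" and crd :: "nat \<Rightarrow> 'e \<Rightarrow> real" +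
  fixes A :: "('g::{topological_group_add, t2_space, second_countable_topology}, 'e) atlas"
    and U0 :: "'g set" and \<phi>0 :: "'g \<Rightarrow> 'e"
  assumes lie: "lie_group A" and chart0: "(U0, \<phi>0) \<in> A" and zero_in_U0: "0 \<in> U0"
begin

lemma chart_atlas: "(U, \<phi>) \<in> A \<Longrightarrow> chart U \<phi>"
  using lie by (auto simp: lie_group_def)

lemma chart_open: "(U, \<phi>) \<in> A \<Longrightarrow> open U"
  and chart_open_image: "(U, \<phi>) \<in> A \<Longrightarrow> open (\<phi> ` U)"
  and chart_continuous: "(U, \<phi>) \<in> A \<Longrightarrow> continuous_on U \<phi>"
  and chart_inv_continuous: "(U, \<phi>) \<in> A \<Longrightarrow> continuous_on (\<phi> ` U) (inv_into U \<phi>)"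
  using chart_atlas[of U \<phi>] by (auto simp: chart_def homeomorphism_def)

lemma chart_inv [simp]: "(U, \<phi>) \<in> A \<Longrightarrow> x \<in> U \<Longrightarrow> inv_into U \<phi> (\<phi> x) = x"
  using chart_atlas[of U \<phi>] by (auto simp: chart_def homeomorphism_def)

lemma chart_inv_mem: "z \<in> \<phi> ` U \<Longrightarrow> inv_into U \<phi> z \<in> U"
  by (rule inv_into_into)

lemma ex_chart: "\<exists>U \<phi>. (U, \<phi>) \<in> A \<and> x \<in> U"
proof -
  have "x \<in> (\<Union>(U, \<phi>)\<in>A. U)" using lie by (simp add: lie_group_def)
  then show ?thesis by auto
qed

lemma open_chart_vimage:
  assumes "(U, \<phi>) \<in> A" "open S"
  shows "open {z \<in> \<phi> ` U. inv_into U \<phi> z \<in> S}"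
  using continuous_open_preimage[OF chart_inv_continuous chart_open_image, OF assms(1,1) assms(2)]
  by (simp add: vimage_def Int_def)

lemma open_chart_image:
  assumes "(U, \<phi>) \<in> A" "open S"
  shows "open (\<phi> ` (U \<inter> S))"
proof -
  have "\<phi> ` (U \<inter> S) = {z \<in> \<phi> ` U. inv_into U \<phi> z \<in> S}"
  proof safe
    fix z assume "z \<in> U" "inv_into U \<phi> (\<phi> z) \<in> S"
    then show "\<phi> z \<in> \<phi> ` (U \<inter> S)" using assms by simp
  qed (use assms in auto)
  then show ?thesis using open_chart_vimage[OF assms] by simp
qed

lemma Ck_fun_const: "Ck_fun A k (\<lambda>_. c)"
  by (auto simp: Ck_fun_def o_def)

lemma Ck_fun_mono: "Ck_fun A k f \<Longrightarrow> j \<le> k \<Longrightarrow> Ck_fun A j f"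
  by (auto simp: Ck_fun_def intro: Ck_on_mono)

lemma Ck_fun_add: "Ck_fun A k f \<Longrightarrow> Ck_fun A k g \<Longrightarrow> Ck_fun A k (\<lambda>x. f x + g x)"
  by (auto simp: Ck_fun_def o_def intro!: Ck_on_add chart_open_image)

lemma Ck_fun_diff: "Ck_fun A k f \<Longrightarrow> Ck_fun A k g \<Longrightarrow> Ck_fun A k (\<lambda>x. f x - g x)"
  by (auto simp: Ck_fun_def o_def intro!: Ck_on_diff chart_open_image)

lemma Ck_fun_sum: "(\<And>i. i \<in> I \<Longrightarrow> Ck_fun A k (f i)) \<Longrightarrow> Ck_fun A k (\<lambda>x. \<Sum>i\<in>I. f i x)"
  by (auto simp: Ck_fun_def o_def intro!: Ck_on_sum chart_open_image)

lemma Ck_fun_scaleR: "Ck_fun A k f \<Longrightarrow> Ck_fun A k g \<Longrightarrow> Ck_fun A k (\<lambda>x. f x *\<^sub>R g x)"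
  by (auto simp: Ck_fun_def o_def intro!: Ck_on_scaleR chart_open_image)

lemma Ck_fun_mult:
  fixes f g :: "'g \<Rightarrow> 'b::real_normed_algebra"
  shows "Ck_fun A k f \<Longrightarrow> Ck_fun A k g \<Longrightarrow> Ck_fun A k (\<lambda>x. f x * g x)"
  by (auto simp: Ck_fun_def o_def intro!: Ck_on_mult chart_open_image)

lemma Ck_fun_prod:
  fixes f :: "'i \<Rightarrow> 'g \<Rightarrow> real"
  shows "(\<And>i. i \<in> I \<Longrightarrow> Ck_fun A k (f i)) \<Longrightarrow> Ck_fun A k (\<lambda>x. \<Prod>i\<in>I. f i x)"
  by (auto simp: Ck_fun_def o_def intro!: Ck_on_prod chart_open_image)

lemma Ck_fun_bounded_linear:
  "bounded_linear L \<Longrightarrow> Ck_fun A k f \<Longrightarrow> Ck_fun A k (\<lambda>x. L (f x))"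
  by (auto simp: Ck_fun_def o_def intro!: Ck_on_bounded_linear_comp[of L] chart_open_image)

lemma Ck_fun_locally:
  assumes "\<And>x. \<exists>N. open N \<and> x \<in> N \<and>
     (\<forall>(V, \<psi>)\<in>A. Ck_on k (\<psi> ` (V \<inter> N)) (\<lambda>z. f (inv_into V \<psi> z)))"
  shows "Ck_fun A k f"
  unfolding Ck_fun_def o_def
proof safe
  fix V \<psi> assume V: "(V, \<psi>) \<in> A"
  show "Ck_on k (\<psi> ` V) (\<lambda>z. f (inv_into V \<psi> z))"
  proof (rule Ck_on_locally)
    fix z assume z: "z \<in> \<psi> ` V"
    obtain N where N: "open N" "inv_into V \<psi> z \<in> N" "Ck_on k (\<psi> ` (V \<inter> N)) (\<lambda>z. f (inv_into V \<psi> z))"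
      using assms[of "inv_into V \<psi> z"] V by auto
    moreover have "z \<in> \<psi> ` (V \<inter> N)"
      using z N(2) V by auto
    ultimately show "\<exists>T. open T \<and> z \<in> T \<and> Ck_on k T (\<lambda>z. f (inv_into V \<psi> z))"
      using open_chart_image[OF V] by blast
  qed
qed

lemma Ck_fun_continuous_on:
  assumes "Ck_fun A k f" shows "continuous_on UNIV f"
proof -
  have "isCont f x" for x
  proof -
    obtain U \<phi> where U: "(U, \<phi>) \<in> A" "x \<in> U" using ex_chart by blast
    have "continuous_on (\<phi> ` U) (f \<circ> inv_into U \<phi>)"
      using assms U(1) by (intro Ck_on_imp_continuous_on[of k]) (auto simp: Ck_fun_def simp del: o_apply)
    then have "continuous_on U (\<lambda>y. (f \<circ> inv_into U \<phi>) (\<phi> y))"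
      by (rule continuous_on_compose2) (use chart_continuous[OF U(1)] in auto)
    then have "continuous_on U f"
      by (rule continuous_on_eq) (use U in auto)
    then show ?thesis
      using U chart_open continuous_on_eq_continuous_at by blast
  qed
  then show ?thesis by (simp add: continuous_at_imp_continuous_on)
qed

lemma Ck_on_transition:
  assumes U: "(U, \<phi>) \<in> A" and V: "(V, \<psi>) \<in> A" and \<rho>: "Ck_on k (\<phi> ` U) \<rho>"
  shows "Ck_on k (\<psi> ` (V \<inter> U)) (\<lambda>z. \<rho> (\<phi> (inv_into V \<psi> z)))"
proof (rule Ck_on_compose[OF open_chart_image[OF V chart_open[OF U]] chart_open_image[OF U] _ \<rho>])
  have "smooth_on (\<psi> ` (V \<inter> U)) (\<phi> \<circ> inv_into V \<psi>)"
    using lie U V by (auto simp: lie_group_def)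
  then show "Ck_on k (\<psi> ` (V \<inter> U)) (\<lambda>z. \<phi> (inv_into V \<psi> z))"
    by (simp add: smooth_on_def o_def)
  show "\<phi> (inv_into V \<psi> z) \<in> \<phi> ` U" if "z \<in> \<psi> ` (V \<inter> U)" for z
    using that V by auto
qed

text \<open>Regularity is checked on two open sets that cover the group: on \<open>U\<close> the
  transition maps apply, and on the complement of the compact set, open because the group is
  Hausdorff, the function is zero.\<close>

lemma Ck_fun_extend:
  assumes U: "(U, \<phi>) \<in> A" and C: "compact C" "C \<subseteq> \<phi> ` U"
    and \<rho>: "Ck_on k UNIV \<rho>" "\<And>z. z \<notin> C \<Longrightarrow> \<rho> z = 0"
  shows "Ck_fun A k (\<lambda>x. if x \<in> U then \<rho> (\<phi> x) else 0)"
    and "compact (inv_into U \<phi> ` C)" and "inv_into U \<phi> ` C \<subseteq> U"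
    and "x \<notin> inv_into U \<phi> ` C \<Longrightarrow> (if x \<in> U then \<rho> (\<phi> x) else 0) = 0"
proof -
  let ?f = "\<lambda>x. if x \<in> U then \<rho> (\<phi> x) else 0"
  let ?K = "inv_into U \<phi> ` C"
  show K: "compact ?K"
    by (rule compact_continuous_image[OF continuous_on_subset[OF chart_inv_continuous[OF U] C(2)] C(1)])
  show KU: "?K \<subseteq> U"
    by (rule image_subsetI) (rule chart_inv_mem[OF subsetD[OF C(2)]])
  have zero: "?f x = 0" if "x \<notin> ?K" for x
  proof (cases "x \<in> U")
    case True
    have "\<phi> x \<notin> C"
    proof
      assume "\<phi> x \<in> C"
      then have "inv_into U \<phi> (\<phi> x) \<in> ?K" by (rule imageI)
      with that U True show False by simp
    qed
    then show ?thesis using \<rho>(2) by simp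
  qed simp
  show "x \<notin> ?K \<Longrightarrow> ?f x = 0" by (rule zero)
  show "Ck_fun A k ?f"
  proof (rule Ck_fun_locally)
    fix x
    show "\<exists>N. open N \<and> x \<in> N \<and> (\<forall>(V, \<psi>)\<in>A. Ck_on k (\<psi> ` (V \<inter> N)) (\<lambda>z. ?f (inv_into V \<psi> z)))"
    proof (cases "x \<in> ?K")
      case True
      have "Ck_on k (\<psi> ` (V \<inter> U)) (\<lambda>z. ?f (inv_into V \<psi> z))" if V: "(V, \<psi>) \<in> A" for V \<psi>
      proof (rule Ck_on_cong[OF open_chart_image[OF V chart_open[OF U]]])
        show "Ck_on k (\<psi> ` (V \<inter> U)) (\<lambda>z. \<rho> (\<phi> (inv_into V \<psi> z)))"
          by (rule Ck_on_transition[OF U V Ck_on_subset[OF \<rho>(1)]]) auto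
      qed (use V in auto)
      moreover have "x \<in> U" using True KU by (rule subsetD[rotated])
      ultimately show ?thesis using chart_open[OF U] by (intro exI[of _ U] conjI ballI) auto
    next
      case False
      have "Ck_on k (\<psi> ` (V \<inter> - ?K)) (\<lambda>z. ?f (inv_into V \<psi> z))" if V: "(V, \<psi>) \<in> A" for V \<psi>
      proof (rule Ck_on_cong[OF open_chart_image[OF V]])
        show "open (- ?K)" using compact_imp_closed[OF K] by auto
        show "Ck_on k (\<psi> ` (V \<inter> - ?K)) (\<lambda>_. 0)" by simp
        show "0 = ?f (inv_into V \<psi> z)" if z: "z \<in> \<psi> ` (V \<inter> - ?K)" for z
        proof -
          have "inv_into V \<psi> z \<notin> ?K" using z V by auto
          from zero[OF this] show ?thesis by (rule sym)
        qed
      qed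
      moreover have "open (- ?K)" using compact_imp_closed[OF K] by auto
      ultimately show ?thesis using False by (intro exI[of _ "- ?K"] conjI ballI) auto
    qed
  qed
qed

section \<open>Smooth functions and cutoffs on the group\<close>

definition smooth :: "('g \<Rightarrow> 'b::real_normed_vector) \<Rightarrow> bool" where
  "smooth f \<longleftrightarrow> (\<forall>k. Ck_fun A k f)"

lemma smooth_const: "smooth (\<lambda>_. c)"
  and smooth_add: "smooth f \<Longrightarrow> smooth g \<Longrightarrow> smooth (\<lambda>x. f x + g x)"
  and smooth_diff: "smooth f \<Longrightarrow> smooth g \<Longrightarrow> smooth (\<lambda>x. f x - g x)"
  and smooth_sum: "(\<And>i. i \<in> I \<Longrightarrow> smooth (fi i)) \<Longrightarrow> smooth (\<lambda>x. \<Sum>i\<in>I. fi i x)"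
  and smooth_scaleR: "smooth r \<Longrightarrow> smooth g \<Longrightarrow> smooth (\<lambda>x. r x *\<^sub>R g x)"
  and smooth_mult: "smooth q \<Longrightarrow> smooth r \<Longrightarrow> smooth (\<lambda>x. q x * r x :: real)"
  and smooth_prod: "(\<And>i. i \<in> I \<Longrightarrow> smooth (ri i)) \<Longrightarrow> smooth (\<lambda>x. \<Prod>i\<in>I. ri i x :: real)"
  and smooth_bounded_linear: "bounded_linear L \<Longrightarrow> smooth f \<Longrightarrow> smooth (\<lambda>x. L (f x))"
  and smooth_continuous_on: "smooth f \<Longrightarrow> continuous_on UNIV f"
  by (auto simp: smooth_def intro: Ck_fun_const Ck_fun_add Ck_fun_diff Ck_fun_sum Ck_fun_scaleR
      Ck_fun_mult Ck_fun_prod Ck_fun_bounded_linear Ck_fun_continuous_on)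

lemma cutoff_point:
  assumes "open O'" "x \<in> O'"
  shows "\<exists>\<eta> V K. smooth \<eta> \<and> (\<forall>x. 0 \<le> \<eta> x \<and> \<eta> x \<le> (1::real)) \<and> open V \<and> x \<in> V \<and>
    (\<forall>x\<in>V. \<eta> x = 1) \<and> compact K \<and> K \<subseteq> O' \<and> (\<forall>x. x \<notin> K \<longrightarrow> \<eta> x = 0)"
proof -
  obtain U \<phi> where U: "(U, \<phi>) \<in> A" "x \<in> U" using ex_chart by blast
  obtain r where r: "r > 0" "{z. sqn (z - \<phi> x) \<le> r} \<subseteq> \<phi> ` (U \<inter> O')"
    using sqn_ball_in_open[OF open_chart_image[OF U(1) assms(1)], of "\<phi> x"] U assms by auto
  define C where "C = {z. sqn (z - \<phi> x) \<le> r}"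
  define V where "V = {y \<in> U. sqn (\<phi> y - \<phi> x) < r / 2}"
  \<comment> \<open>Half of \<open>r\<close>, as \<open>bump\<close> vanishes only from twice its
    parameter on.\<close>
  let ?\<rho> = "bump (\<phi> x) (r / 2)"
  let ?\<eta> = "\<lambda>y. if y \<in> U then ?\<rho> (\<phi> y) else 0"
  have C: "compact C" "C \<subseteq> \<phi> ` U"
    using r by (auto simp: C_def compact_sqn_ball)
  have z: "?\<rho> z = 0" if "z \<notin> C" for z
    using that r by (intro bump_eq_0) (auto simp: C_def)
  note ext = Ck_fun_extend[OF U(1) C Ck_on_bump z]
  have "inv_into U \<phi> ` C \<subseteq> O'"
    using r(2) U by (auto simp: C_def)
  moreover have "open V"
  proof -
    have "V = U \<inter> (\<lambda>y. sqn (\<phi> y - \<phi> x)) -` {..<r / 2}" by (auto simp: V_def)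
    moreover have "continuous_on U (\<lambda>y. sqn (\<phi> y - \<phi> x))"
      by (intro continuous_intros chart_continuous U(1))
    ultimately show ?thesis
      using chart_open[OF U(1)] by (metis continuous_open_preimage open_lessThan)
  qed
  moreover have "\<forall>y\<in>V. ?\<eta> y = 1" using r by (auto simp: V_def intro!: bump_eq_1)
  moreover have "x \<in> V" using U r by (auto simp: V_def)
  moreover have "smooth ?\<eta>" using ext(1) by (simp add: smooth_def)
  moreover have "\<forall>y. 0 \<le> ?\<eta> y \<and> ?\<eta> y \<le> 1" by (auto simp: bump_bounds)
  moreover have "\<forall>y. y \<notin> inv_into U \<phi> ` C \<longrightarrow> ?\<eta> y = 0" using ext(4) by blast
  moreover note ext(2)
  ultimately show ?thesis
    by (intro exI[of _ ?\<eta>] exI[of _ V] exI[of _ "inv_into U \<phi> ` C"] conjI)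
qed

lemma cutoff:
  assumes "open O'" "compact K" "K \<subseteq> O'"
  obtains \<eta> V K' where "smooth \<eta>" "\<And>x. 0 \<le> \<eta> x" "\<And>x. \<eta> x \<le> (1::real)" "open V" "K \<subseteq> V"
    "\<And>x. x \<in> V \<Longrightarrow> \<eta> x = 1" "compact K'" "K' \<subseteq> O'" "\<And>x. x \<notin> K' \<Longrightarrow> \<eta> x = 0"
proof -
  have "\<forall>x\<in>K. \<exists>\<eta> V K. smooth \<eta> \<and> (\<forall>x. 0 \<le> \<eta> x \<and> \<eta> x \<le> (1::real)) \<and> open V \<and> x \<in> V \<and>
    (\<forall>x\<in>V. \<eta> x = 1) \<and> compact K \<and> K \<subseteq> O' \<and> (\<forall>x. x \<notin> K \<longrightarrow> \<eta> x = 0)"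
    using cutoff_point[OF assms(1)] assms(3) by blast
  then obtain c V L where cVL: "\<And>x. x \<in> K \<Longrightarrow> smooth (c x) \<and> (\<forall>y. 0 \<le> c x y \<and> c x y \<le> (1::real)) \<and>
    open (V x) \<and> x \<in> V x \<and> (\<forall>y\<in>V x. c x y = 1) \<and> compact (L x) \<and> L x \<subseteq> O' \<and>
    (\<forall>y. y \<notin> L x \<longrightarrow> c x y = 0)"
    by metis
  have "\<exists>F. F \<subseteq> K \<and> finite F \<and> K \<subseteq> (\<Union>x\<in>F. V x)"
    by (rule compactE_image[OF assms(2), of K V]) (use cVL in auto)
  then obtain F where F: "F \<subseteq> K" "finite F" "K \<subseteq> (\<Union>x\<in>F. V x)" by blast
  have cVL': "smooth (c x)" "0 \<le> c x y" "c x y \<le> 1" "open (V x)" "compact (L x)" "L x \<subseteq> O'"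
    "y \<in> V x \<Longrightarrow> c x y = 1" "y \<notin> L x \<Longrightarrow> c x y = 0" if "x \<in> F" for x y
    using cVL[of x] that F(1) by auto
  \<comment> \<open>The product vanishes as soon as one of the cutoffs is 1 and equals 1 where all
    of them are 0; unlike the sum of the cutoffs this stays in the unit interval.\<close>
  define \<eta> where "\<eta> y = 1 - (\<Prod>x\<in>F. 1 - c x y)" for y
  show ?thesis
  proof (rule that[of \<eta> "\<Union>x\<in>F. V x" "\<Union>x\<in>F. L x"])
    show "smooth \<eta>"
      unfolding \<eta>_def by (intro smooth_diff smooth_prod smooth_const cVL')
    show "0 \<le> \<eta> x" for x
      using prod_le_1[of F "\<lambda>y. 1 - c y x"] cVL' by (simp add: \<eta>_def)
    show "\<eta> x \<le> 1" for x
      using prod_nonneg[of F "\<lambda>y. 1 - c y x"] cVL' by (simp add: \<eta>_def)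
    show "open (\<Union>x\<in>F. V x)" using cVL' by auto
    show "\<eta> y = 1" if "y \<in> (\<Union>x\<in>F. V x)" for y
    proof -
      have "(\<Prod>x\<in>F. 1 - c x y) = 0"
        using that F(2) cVL'(7) by (subst prod_zero_iff) auto
      then show ?thesis by (simp add: \<eta>_def)
    qed
    show "compact (\<Union>x\<in>F. L x)" using F(2) cVL' by (intro compact_UN) auto
    show "\<eta> y = 0" if "y \<notin> (\<Union>x\<in>F. L x)" for y
      using that cVL'(8) by (auto simp: \<eta>_def intro!: prod.neutral)
    show "(\<Union>x\<in>F. L x) \<subseteq> O'" using cVL'(6) by (rule UN_least)
  qed (rule F)
qed

subsection \<open>Translated functions in the chart at the identity\<close>

abbreviation inv0 :: "'e \<Rightarrow> 'g" where "inv0 \<equiv> inv_into U0 \<phi>0"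
abbreviation p0 :: 'e where "p0 \<equiv> \<phi>0 0"
abbreviation C0 :: "'e set" where "C0 \<equiv> \<phi>0 ` U0"

lemma open_C0: "open C0"
  using chart_open_image[OF chart0] .

lemma p0_in: "p0 \<in> C0"
  using zero_in_U0 by simp

lemma inv0_p0: "inv0 p0 = 0"
  using chart_inv[OF chart0 zero_in_U0] .

text \<open>Regularity jointly in the base point \<open>x\<close>, in any chart, and in the
  coordinate \<open>b\<close> at the identity. A derivative in \<open>b\<close> then leaves
  regularity in \<open>x\<close>, which regularity in each variable separately would not
  give.\<close>

definition joint :: "nat \<Rightarrow> ('g \<Rightarrow> 'e \<Rightarrow> 'b::real_normed_vector) \<Rightarrow> bool" where
  "joint k F \<longleftrightarrow> (\<forall>(V, \<psi>)\<in>A. Ck_on k (\<psi> ` V \<times> C0) (\<lambda>(a, b). F (inv_into V \<psi> a) b))"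

text \<open>Here the smoothness of the multiplication enters: near a given pair the product stays in
  one chart, and \<open>f\<close> is composed with the multiplication read in that chart.\<close>

lemma joint_translate:
  assumes f: "Ck_fun A k f"
  shows "joint k (\<lambda>x b. f (x + inv0 b))"
  unfolding joint_def
proof safe
  fix V \<psi> assume V: "(V, \<psi>) \<in> A"
  let ?m = "\<lambda>(a, b). inv_into V \<psi> a + inv0 b"
  have cm: "continuous_on (\<psi> ` V \<times> C0) ?m"
    unfolding split_beta
    by (intro continuous_intros continuous_on_compose2[OF chart_inv_continuous[OF V]]
        continuous_on_compose2[OF chart_inv_continuous[OF chart0]]) auto
  show "Ck_on k (\<psi> ` V \<times> C0) (\<lambda>(a, b). f (inv_into V \<psi> a + inv0 b))"
  proof (rule Ck_on_locally, clarify)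
    fix a b assume ab: "a \<in> V" "b \<in> U0"
    obtain W \<theta> where W: "(W, \<theta>) \<in> A" "inv_into V \<psi> (\<psi> a) + inv0 (\<phi>0 b) \<in> W" using ex_chart by blast
    define S where "S = {(a, b). a \<in> \<psi> ` V \<and> b \<in> C0 \<and> inv_into V \<psi> a + inv0 b \<in> W}"
    have "S = (\<psi> ` V \<times> C0) \<inter> ?m -` W" by (auto simp: S_def)
    then have S: "open S"
      using continuous_open_preimage[OF cm open_Times[OF chart_open_image[OF V] open_C0] chart_open[OF W(1)]]
      by simp
    have "smooth_on S (\<lambda>(a, b). \<theta> (inv_into V \<psi> a + inv0 b))"
      using lie V chart0 W(1) unfolding lie_group_def S_def by blast
    then have m: "Ck_on k S (\<lambda>(a, b). \<theta> (inv_into V \<psi> a + inv0 b))"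
      by (simp add: smooth_on_def)
    have "Ck_on k (\<theta> ` W) (f \<circ> inv_into W \<theta>)"
      using f W(1) by (auto simp: Ck_fun_def)
    from Ck_on_compose[OF S chart_open_image[OF W(1)] m this]
    have "Ck_on k S (\<lambda>x. (f \<circ> inv_into W \<theta>) ((\<lambda>(a, b). \<theta> (inv_into V \<psi> a + inv0 b)) x))"
      by (auto simp: S_def)
    then have "Ck_on k S (\<lambda>(a, b). f (inv_into V \<psi> a + inv0 b))"
      by (rule Ck_on_cong[OF S]) (use W in \<open>auto simp: S_def\<close>)
    moreover have "(\<psi> a, \<phi>0 b) \<in> S" using ab W by (auto simp: S_def)
    ultimately show "\<exists>T. open T \<and> (\<psi> a, \<phi>0 b) \<in> T \<and> Ck_on k T (\<lambda>(a, b). f (inv_into V \<psi> a + inv0 b))"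
      using S by blast
  qed
qed

text \<open>A derivative in \<open>b\<close> alone is the full derivative on the product in the
  direction \<open>(0, v)\<close>, so the order of \<open>Ck_on\<close> drops by one and joint
  regularity is preserved.\<close>

lemma joint_derivative:
  assumes F: "joint (Suc k) F"
  shows "b \<in> C0 \<Longrightarrow> (F x has_derivative frechet_derivative (F x) (at b)) (at b)"
    and "joint k (\<lambda>x b. frechet_derivative (F x) (at b) v)"
proof -
  have der: "(F (inv_into V \<psi> a) has_derivative
      (\<lambda>v. frechet_derivative (\<lambda>(a, b). F (inv_into V \<psi> a) b) (at (a, b)) (0, v))) (at b)"
    if V: "(V, \<psi>) \<in> A" and a: "a \<in> \<psi> ` V" and b: "b \<in> C0" for V \<psi> a b
  proof -
    let ?G = "\<lambda>(a, b). F (inv_into V \<psi> a) b"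
    have "Ck_on (Suc k) (\<psi> ` V \<times> C0) ?G" using F V by (auto simp: joint_def)
    then have G: "(?G has_derivative frechet_derivative ?G (at (a, b))) (at (a, b))"
      by (rule Ck_on_Suc_has_derivative) (use a b in auto)
    have "((\<lambda>b. (a, b)) has_derivative (\<lambda>v. (0, v))) (at b)"
      by (intro derivative_intros)
    from has_derivative_compose[OF this G] show ?thesis by simp
  qed
  show "(F x has_derivative frechet_derivative (F x) (at b)) (at b)" if b: "b \<in> C0"
  proof -
    obtain V \<psi> where V: "(V, \<psi>) \<in> A" "x \<in> V" using ex_chart by blast
    have "F x differentiable (at b)"
      using der[OF V(1) _ b, of "\<psi> x"] V by (auto simp: differentiable_def)
    then show ?thesis by (simp only: frechet_derivative_works)
  qed
  show "joint k (\<lambda>x b. frechet_derivative (F x) (at b) v)"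
    unfolding joint_def
  proof safe
    fix V \<psi> assume V: "(V, \<psi>) \<in> A"
    let ?G = "\<lambda>(a, b). F (inv_into V \<psi> a) b"
    have "Ck_on (Suc k) (\<psi> ` V \<times> C0) ?G" using F V by (auto simp: joint_def)
    then have "Ck_on k (\<psi> ` V \<times> C0) (\<lambda>x. frechet_derivative ?G (at x) (0, v))" by simp
    then show "Ck_on k (\<psi> ` V \<times> C0) (\<lambda>(a, b). frechet_derivative (F (inv_into V \<psi> a)) (at b) v)"
    proof (rule Ck_on_cong[OF open_Times[OF chart_open_image[OF V] open_C0]], clarify)
      fix a b assume "a \<in> V" "b \<in> U0"
      then show "frechet_derivative ?G (at (\<psi> a, \<phi>0 b)) (0, v) =
          frechet_derivative (F (inv_into V \<psi> (\<psi> a))) (at (\<phi>0 b)) v"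
        using frechet_derivative_at[OF der[OF V, of "\<psi> a" "\<phi>0 b"]] by (auto dest: fun_cong)
    qed
  qed
qed

lemma joint_continuous_on:
  assumes "joint k F"
  shows "continuous_on (UNIV \<times> C0) (\<lambda>(x, b). F x b)"
proof -
  have "continuous_on (\<Union>(V, \<psi>)\<in>A. V \<times> C0) (\<lambda>(x, b). F x b)"
  proof (rule continuous_on_open_UN)
    show "open (case i of (V, \<psi>) \<Rightarrow> V \<times> C0)" if "i \<in> A" for i
      using that by (cases i) (auto intro!: open_Times open_C0 chart_open)
    show "continuous_on (case i of (V, \<psi>) \<Rightarrow> V \<times> C0) (\<lambda>(x, b). F x b)" if "i \<in> A" for i
    proof (cases i)
      case (Pair V \<psi>)
      with that have V: "(V, \<psi>) \<in> A" by simp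
      have "continuous_on (\<psi> ` V \<times> C0) (\<lambda>(a, b). F (inv_into V \<psi> a) b)"
        using assms V by (intro Ck_on_imp_continuous_on[of k]) (auto simp: joint_def)
      then have "continuous_on (V \<times> C0) (\<lambda>x. (\<lambda>(a, b). F (inv_into V \<psi> a) b) (\<psi> (fst x), snd x))"
        by (rule continuous_on_compose2)
          (auto intro!: continuous_intros continuous_on_compose2[OF chart_continuous[OF V]])
      then show ?thesis using V Pair
        by (auto elim!: continuous_on_eq)
    qed
  qed
  moreover have "(\<Union>(V, \<psi>)\<in>A. V \<times> C0) = UNIV \<times> C0" using ex_chart by fastforce
  ultimately show ?thesis by simp
qed

lemma joint_slice:
  assumes "joint k F" "b \<in> C0"
  shows "Ck_fun A k (\<lambda>x. F x b)"
  unfolding Ck_fun_def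
proof safe
  fix V \<psi> assume V: "(V, \<psi>) \<in> A"
  have "Ck_on k (\<psi> ` V \<times> C0) (\<lambda>(a, b). F (inv_into V \<psi> a) b)"
    using assms(1) V by (auto simp: joint_def)
  from Ck_on_affine_comp[OF _ open_Times[OF chart_open_image[OF V] open_C0] this, of "\<lambda>a. (a, 0)" "(0, b)"]
  show "Ck_on k (\<psi> ` V) ((\<lambda>x. F x b) \<circ> inv_into V \<psi>)"
    using assms(2) by (simp add: o_def bounded_linear_Pair bounded_linear_ident)
qed

abbreviation lfield :: "nat \<Rightarrow> ('g \<Rightarrow> 'b::real_normed_vector) \<Rightarrow> 'g \<Rightarrow> 'b" where
  "lfield j \<equiv> left_invariant_field U0 \<phi>0 (w j)"

lemma Ck_fun_lfield:
  assumes "Ck_fun A (Suc k) f" shows "Ck_fun A k (lfield j f)"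
  using joint_slice[OF joint_derivative(2)[OF joint_translate[OF assms]] p0_in]
  unfolding left_invariant_field_def .

lemma lfield_diff:
  assumes "Ck_fun A (Suc 0) f" "Ck_fun A (Suc 0) g"
  shows "lfield j (\<lambda>x. f x - g x) = (\<lambda>x. lfield j f x - lfield j g x)"
proof
  fix x
  note D = joint_derivative(1)[OF joint_translate p0_in]
  show "lfield j (\<lambda>x. f x - g x) x = lfield j f x - lfield j g x"
    using frechet_derivative_at[OF has_derivative_diff[OF D[OF assms(1), of x] D[OF assms(2), of x]]]
    by (simp add: left_invariant_field_def) (metis (no_types, lifting))
qed

lemma lfield_zero_outside:
  assumes "closed K" "\<And>x. x \<notin> K \<Longrightarrow> f x = 0" "x \<notin> K"
  shows "lfield j f x = 0"
proof -
  have "continuous_on C0 (\<lambda>b. x + inv0 b)"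
    by (intro continuous_intros chart_inv_continuous[OF chart0])
  then have S: "open (C0 \<inter> (\<lambda>b. x + inv0 b) -` (- K))"
    by (rule continuous_open_preimage[OF _ open_C0]) (use assms in auto)
  have "((\<lambda>b. f (x + inv0 b)) has_derivative (\<lambda>_. 0)) (at p0)"
    by (rule has_derivative_transform_within_open[OF has_derivative_const[of 0] S])
      (use assms p0_in inv0_p0 in auto)
  from frechet_derivative_at[OF this] show ?thesis
    by (simp add: left_invariant_field_def fun_eq_iff)
qed

end

section \<open>Taylor expansion in the chart at the identity\<close>

lemma norm_increment_le:
  fixes f :: "real \<Rightarrow> 'b::real_normed_vector"
  assumes "0 \<le> s" "\<And>t. 0 \<le> t \<Longrightarrow> t \<le> s \<Longrightarrow> (f has_vector_derivative f' t) (at t)"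
    "\<And>t. 0 \<le> t \<Longrightarrow> t \<le> s \<Longrightarrow> norm (f' t) \<le> M"
  shows "norm (f s - f 0) \<le> M * s"
proof -
  have "norm (f s - f 0) \<le> M * norm (s - 0)"
  proof (rule differentiable_bound[of "{0..s}" f "\<lambda>t h. h *\<^sub>R f' t"])
    show "(f has_derivative (\<lambda>h. h *\<^sub>R f' x)) (at x within {0..s})" if "x \<in> {0..s}" for x
      using assms(2)[of x] that
      by (auto simp: has_vector_derivative_def intro: has_derivative_at_withinI)
    show "onorm (\<lambda>h. h *\<^sub>R f' x) \<le> M" if "x \<in> {0..s}" for x
    proof (rule onorm_bound)
      have "norm (f' x) \<le> M" using assms(3) that by auto
      then show "0 \<le> M" using norm_ge_zero order_trans by blast
      show "norm (h *\<^sub>R f' x) \<le> M * norm h" for h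
        using mult_right_mono[OF \<open>norm (f' x) \<le> M\<close>, of "\<bar>h\<bar>"] by (simp add: mult.commute)
    qed
  qed (use assms in auto)
  then show ?thesis using assms(1) by simp
qed

lemma has_vector_derivative_along_line:
  assumes "(f has_derivative f') (at (p + t *\<^sub>R v))"
  shows "((\<lambda>t. f (p + t *\<^sub>R v)) has_vector_derivative f' v) (at t)"
proof -
  have "((\<lambda>t. p + t *\<^sub>R v) has_derivative (\<lambda>h. h *\<^sub>R v)) (at t)"
    by (auto intro!: derivative_eq_intros)
  from has_derivative_compose[OF this assms] show ?thesis
    using linear_cmul[OF has_derivative_linear[OF assms]] by (simp add: has_vector_derivative_def)
qed

context finite_basis
begin

text \<open>Two mean value inequalities on the segment from \<open>p\<close> to \<open>b\<close>:
  for the derivatives in the directions \<open>w i\<close>, and then for the function minus its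
  linear part. The families \<open>D\<close> and \<open>D'\<close> are left free so that the lemma
  applies to one translate as well as to the difference of two. The factor \<open>d\<close> is
  Cauchy-Schwarz for the sum of the absolute coordinates.\<close>

lemma second_order_bound:
  fixes \<Phi> :: "'e \<Rightarrow> 'b::real_normed_vector"
  assumes D: "\<And>b. sqn (b - p) < r \<Longrightarrow> (\<Phi> has_derivative D b) (at b)"
    and D': "\<And>b i. sqn (b - p) < r \<Longrightarrow> i < d \<Longrightarrow> ((\<lambda>b. D b (w i)) has_derivative D' i b) (at b)"
    and B: "\<And>b i j. sqn (b - p) < r \<Longrightarrow> i < d \<Longrightarrow> j < d \<Longrightarrow> norm (D' i b (w j)) \<le> B"
    and b: "sqn (b - p) < r" and "0 \<le> B"
  shows "norm (\<Phi> b - \<Phi> p - (\<Sum>i<d. crd i (b - p) *\<^sub>R D p (w i))) \<le> real d * B * sqn (b - p)"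
proof -
  define \<xi> where "\<xi> = b - p"
  define s1 where "s1 = (\<Sum>i<d. \<bar>crd i \<xi>\<bar>)"
  have s1: "0 \<le> s1" by (simp add: s1_def sum_nonneg)
  have in_ball: "sqn (p + t *\<^sub>R \<xi> - p) < r" if "0 \<le> t" "t \<le> 1" for t
  proof -
    have "t\<^sup>2 * sqn \<xi> \<le> 1 * sqn \<xi>" using that by (intro mult_right_mono) (auto simp: power_le_one)
    then show ?thesis using b by (simp add: \<xi>_def)
  qed
  have expand: "norm (L \<xi>) \<le> B * s1" if "linear L" "\<And>j. j < d \<Longrightarrow> norm (L (w j)) \<le> B" for L :: "'e \<Rightarrow> 'b"
  proof -
    have "L \<xi> = (\<Sum>j<d. crd j \<xi> *\<^sub>R L (w j))" by (rule linear_expand[OF that(1)])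
    then have "norm (L \<xi>) \<le> (\<Sum>j<d. norm (crd j \<xi> *\<^sub>R L (w j)))" by (metis norm_sum)
    also have "\<dots> \<le> (\<Sum>j<d. \<bar>crd j \<xi>\<bar> * B)" using that(2) by (intro sum_mono) (auto intro: mult_left_mono)
    finally show ?thesis by (simp add: s1_def sum_distrib_left mult.commute)
  qed
  have first: "norm (D (p + t *\<^sub>R \<xi>) (w i) - D p (w i)) \<le> B * s1"
    if t: "0 \<le> t" "t \<le> 1" and i: "i < d" for t i
  proof -
    have "norm (D (p + t *\<^sub>R \<xi>) (w i) - D (p + 0 *\<^sub>R \<xi>) (w i)) \<le> B * s1 * t"
    proof (rule norm_increment_le[OF t(1), where f' = "\<lambda>u. D' i (p + u *\<^sub>R \<xi>) \<xi>"])
      fix u assume u: "0 \<le> u" "u \<le> t"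
      then have ib: "sqn (p + u *\<^sub>R \<xi> - p) < r" using in_ball t by auto
      show "((\<lambda>u. D (p + u *\<^sub>R \<xi>) (w i)) has_vector_derivative D' i (p + u *\<^sub>R \<xi>) \<xi>) (at u)"
        by (rule has_vector_derivative_along_line[OF D'[OF ib i]])
      show "norm (D' i (p + u *\<^sub>R \<xi>) \<xi>) \<le> B * s1"
        by (rule expand[OF has_derivative_linear[OF D'[OF ib i]] B[OF ib i]])
    qed
    also have "B * s1 * t \<le> B * s1 * 1" using t s1 \<open>0 \<le> B\<close> by (intro mult_left_mono) auto
    finally show ?thesis by simp
  qed
  define L where "L = (\<Sum>i<d. crd i \<xi> *\<^sub>R D p (w i))"
  have "norm ((\<Phi> (p + 1 *\<^sub>R \<xi>) - 1 *\<^sub>R L) - (\<Phi> (p + 0 *\<^sub>R \<xi>) - 0 *\<^sub>R L)) \<le> (s1 * (B * s1)) * 1"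
  proof (rule norm_increment_le[where f' = "\<lambda>t. D (p + t *\<^sub>R \<xi>) \<xi> - L"])
    fix t :: real assume t: "0 \<le> t" "t \<le> 1"
    note Dt = D[OF in_ball[OF t]]
    show "((\<lambda>t. \<Phi> (p + t *\<^sub>R \<xi>) - t *\<^sub>R L) has_vector_derivative D (p + t *\<^sub>R \<xi>) \<xi> - L) (at t)"
      by (intro has_vector_derivative_diff has_vector_derivative_along_line Dt)
        (auto intro!: derivative_eq_intros simp: has_vector_derivative_def)
    have "D (p + t *\<^sub>R \<xi>) \<xi> - L = (\<Sum>i<d. crd i \<xi> *\<^sub>R (D (p + t *\<^sub>R \<xi>) (w i) - D p (w i)))"
      unfolding L_def using linear_expand[OF has_derivative_linear[OF Dt], of \<xi>]
      by (simp add: scaleR_diff_right sum_subtractf)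
    then have "norm (D (p + t *\<^sub>R \<xi>) \<xi> - L) \<le> (\<Sum>i<d. norm (crd i \<xi> *\<^sub>R (D (p + t *\<^sub>R \<xi>) (w i) - D p (w i))))"
      by (metis norm_sum)
    also have "\<dots> \<le> (\<Sum>i<d. \<bar>crd i \<xi>\<bar> * (B * s1))"
      using first[OF t] by (intro sum_mono) (auto intro: mult_left_mono)
    finally show "norm (D (p + t *\<^sub>R \<xi>) \<xi> - L) \<le> s1 * (B * s1)"
      by (simp add: s1_def sum_distrib_right)
  qed simp
  then have "norm (\<Phi> b - \<Phi> p - L) \<le> s1 * (B * s1)"
    by (simp add: \<xi>_def algebra_simps)
  also have "\<dots> = B * s1\<^sup>2" by (simp add: power2_eq_square)
  also have "\<dots> \<le> B * (real d * sqn \<xi>)"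
  proof (rule mult_left_mono[OF _ \<open>0 \<le> B\<close>])
    have "s1\<^sup>2 = (\<Sum>i<d. \<bar>crd i \<xi>\<bar> * 1)\<^sup>2" by (simp add: s1_def)
    also have "\<dots> \<le> (\<Sum>i<d. \<bar>crd i \<xi>\<bar>\<^sup>2) * (\<Sum>i<d. 1\<^sup>2)"
      by (rule Cauchy_Schwarz_ineq_sum)
    finally show "s1\<^sup>2 \<le> real d * sqn \<xi>" by (simp add: sqn_def mult.commute)
  qed
  finally show ?thesis by (simp add: L_def \<xi>_def mult_ac)
qed

end

context lie_chart
begin

definition r0 :: real where "r0 = (SOME r. r > 0 \<and> {z. sqn (z - p0) \<le> r} \<subseteq> C0)"

lemma r0: "r0 > 0" "{z. sqn (z - p0) \<le> r0} \<subseteq> C0"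
proof -
  have "\<exists>r. r > 0 \<and> {z. sqn (z - p0) \<le> r} \<subseteq> C0"
    using sqn_ball_in_open[OF open_C0 p0_in] by blast
  from someI_ex[OF this] show "r0 > 0" "{z. sqn (z - p0) \<le> r0} \<subseteq> C0"
    unfolding r0_def by blast+
qed

text \<open>
  \<open>B1\<close> is a coordinate ball at the identity. The functions \<open>zeta i\<close> and \<open>kappa\<close>, with support in \<open>K1\<close>,
  extend the coordinates and the constant \<open>1\<close> from \<open>B1\<close>.
\<close>

definition B1 :: "'g set" where "B1 = {x \<in> U0. sqn (\<phi>0 x - p0) < r0 / 2}"
definition K1 :: "'g set" where "K1 = inv0 ` {z. sqn (z - p0) \<le> r0}"

definition zeta :: "nat \<Rightarrow> 'g \<Rightarrow> real" where
  "zeta i x = (if x \<in> U0 then bump p0 (r0 / 2) (\<phi>0 x) * crd i (\<phi>0 x - p0) else 0)"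
definition kappa :: "'g \<Rightarrow> real" where
  "kappa x = (if x \<in> U0 then bump p0 (r0 / 2) (\<phi>0 x) else 0)"
definition zeta_sq :: "'g \<Rightarrow> real" where "zeta_sq x = (\<Sum>i<d. (zeta i x)\<^sup>2)"

lemma open_sqn_ball: "open {z. sqn (z - p) < r}"
  by (intro open_Collect_less continuous_intros)

lemma open_B1: "open B1"
proof -
  have "B1 = U0 \<inter> (\<lambda>y. sqn (\<phi>0 y - p0)) -` {..<r0 / 2}" by (auto simp: B1_def)
  moreover have "continuous_on U0 (\<lambda>y. sqn (\<phi>0 y - p0))"
    by (intro continuous_intros chart_continuous chart0)
  ultimately show ?thesis
    using chart_open[OF chart0] by (metis continuous_open_preimage open_lessThan)
qed

lemma zero_in_B1: "0 \<in> B1"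
  using zero_in_U0 r0 by (simp add: B1_def)

lemma compact_K1: "compact K1"
  unfolding K1_def
  by (rule compact_continuous_image[OF continuous_on_subset[OF chart_inv_continuous[OF chart0] r0(2)] compact_sqn_ball])

lemma bump_outside: "z \<notin> {z. sqn (z - p0) \<le> r0} \<Longrightarrow> bump p0 (r0 / 2) z = 0"
  using r0(1) by (intro bump_eq_0) auto

lemma smooth_zeta: "smooth (zeta i)"
  unfolding smooth_def zeta_def
  by (intro allI Ck_fun_extend(1)[OF chart0 compact_sqn_ball r0(2)] Ck_on_mult Ck_on_bump Ck_on_crd)
    (use bump_outside in auto)

lemma zeta_outside: "x \<notin> K1 \<Longrightarrow> zeta i x = 0"
  unfolding zeta_def K1_def
  by (rule Ck_fun_extend(4)[OF chart0 compact_sqn_ball r0(2), of 0])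
    (use bump_outside Ck_on_mult[OF open_UNIV Ck_on_bump Ck_on_crd] in auto)

lemma smooth_kappa: "smooth kappa"
  unfolding smooth_def kappa_def
  by (intro allI Ck_fun_extend(1)[OF chart0 compact_sqn_ball r0(2)] Ck_on_bump)
    (use bump_outside in auto)

lemma kappa_outside: "x \<notin> K1 \<Longrightarrow> kappa x = 0"
  unfolding kappa_def K1_def
  by (rule Ck_fun_extend(4)[OF chart0 compact_sqn_ball r0(2) Ck_on_bump[of 0]])
    (use bump_outside in auto)

lemma zeta_B1: "x \<in> B1 \<Longrightarrow> zeta i x = crd i (\<phi>0 x - p0)"
  using r0(1) by (simp add: B1_def zeta_def bump_eq_1)

lemma kappa_B1: "x \<in> B1 \<Longrightarrow> kappa x = 1"
  using r0(1) by (simp add: B1_def kappa_def bump_eq_1)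

lemma zeta_sq_B1: "x \<in> B1 \<Longrightarrow> zeta_sq x = sqn (\<phi>0 x - p0)"
  by (simp add: zeta_sq_def zeta_B1 sqn_def)

lemma zeta_0 [simp]: "zeta i 0 = 0"
  using zeta_B1[OF zero_in_B1] by simp

lemma zeta_sq_nonneg [simp]: "0 \<le> zeta_sq x"
  by (simp add: zeta_sq_def sum_nonneg)

lemma smooth_zeta_sq: "smooth zeta_sq"
  unfolding zeta_sq_def power2_eq_square by (intro smooth_sum smooth_mult smooth_zeta)

lemma bounded_of_compact_support:
  fixes f :: "'g \<Rightarrow> 'b::real_normed_vector"
  assumes "continuous_on UNIV f" "compact K" "\<And>x. x \<notin> K \<Longrightarrow> f x = 0"
  shows "\<exists>C\<ge>0. \<forall>x. norm (f x) \<le> C"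
proof -
  have "bounded (f ` K)"
    using assms by (intro compact_imp_bounded compact_continuous_image continuous_on_subset[OF assms(1)]) auto
  then obtain C where C: "\<And>x. x \<in> K \<Longrightarrow> norm (f x) \<le> C" by (auto simp: bounded_iff)
  have "norm (f x) \<le> max C 0" for x
    using C[of x] assms(3)[of x] by (cases "x \<in> K") auto
  then show ?thesis by (intro exI[of _ "max C 0"]) auto
qed

lemma zeta_bounded: "\<exists>C\<ge>0. \<forall>i x. \<bar>zeta i x\<bar> \<le> C \<or> \<not> i < d"
proof -
  have "\<exists>C. C \<ge> 0 \<and> (\<forall>x. norm (zeta i x) \<le> C)" for i
    using bounded_of_compact_support[OF smooth_continuous_on[OF smooth_zeta] compact_K1 zeta_outside] by blast
  then obtain C where C: "\<And>i. C i \<ge> 0" "\<And>i x. norm (zeta i x) \<le> C i" by metis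
  have "\<bar>zeta i x\<bar> \<le> (\<Sum>i<d. C i)" if "i < d" for i x
    using C(2)[of i x] member_le_sum[of i "{..<d}" C] that C(1) by auto
  then show ?thesis using C(1) by (intro exI[of _ "\<Sum>i<d. C i"]) (auto simp: sum_nonneg)
qed

definition tran :: "('g \<Rightarrow> 'b) \<Rightarrow> 'g \<Rightarrow> 'e \<Rightarrow> 'b" where
  "tran f x b = f (x + inv0 b)"
definition tran_d1 :: "('g \<Rightarrow> 'b::real_normed_vector) \<Rightarrow> nat \<Rightarrow> 'g \<Rightarrow> 'e \<Rightarrow> 'b" where
  "tran_d1 f i x b = frechet_derivative (tran f x) (at b) (w i)"
definition tran_d2 :: "('g \<Rightarrow> 'b::real_normed_vector) \<Rightarrow> nat \<Rightarrow> nat \<Rightarrow> 'g \<Rightarrow> 'e \<Rightarrow> 'b" where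
  "tran_d2 f i j x b = frechet_derivative (tran_d1 f i x) (at b) (w j)"

lemma tran_derivatives:
  assumes "Ck_fun A 2 f" "b \<in> C0"
  shows "(tran f x has_derivative frechet_derivative (tran f x) (at b)) (at b)"
    and "(tran_d1 f i x has_derivative frechet_derivative (tran_d1 f i x) (at b)) (at b)"
    and "continuous_on (UNIV \<times> C0) (\<lambda>(x, b). tran_d2 f i j x b)"
proof -
  have 0: "joint (Suc (Suc 0)) (tran f)"
    using joint_translate[OF assms(1)] by (simp add: tran_def[abs_def] numeral_2_eq_2)
  have 1: "joint (Suc 0) (tran_d1 f i)"
    using joint_derivative(2)[OF 0, of "w i"] by (simp add: tran_d1_def[abs_def])
  have 2: "joint 0 (tran_d2 f i j)"
    using joint_derivative(2)[OF 1, of "w j"] by (simp add: tran_d2_def[abs_def])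
  show "(tran f x has_derivative frechet_derivative (tran f x) (at b)) (at b)"
    by (rule joint_derivative(1)[OF 0 assms(2)])
  show "(tran_d1 f i x has_derivative frechet_derivative (tran_d1 f i x) (at b)) (at b)"
    by (rule joint_derivative(1)[OF 1 assms(2)])
  show "continuous_on (UNIV \<times> C0) (\<lambda>(x, b). tran_d2 f i j x b)"
    by (rule joint_continuous_on[OF 2])
qed

lemma tran_d1_p0: "tran_d1 f i x p0 = lfield i f x"
  by (simp add: tran_d1_def left_invariant_field_def tran_def[abs_def])

lemma tran_p0: "tran f x p0 = f x"
  by (simp add: tran_def inv0_p0)

lemma tran_phi: "y \<in> U0 \<Longrightarrow> tran f x (\<phi>0 y) = f (x + y)"
  by (simp add: tran_def chart_inv[OF chart0])

lemma ball_C0: "sqn (b - p0) < r0 / 2 \<Longrightarrow> b \<in> C0"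
  using r0 by force

text \<open>Compactness in both variables: \<open>b\<close> is in a compact ball, and for
  \<open>x\<close> outside the compact set \<open>L\<close> of differences of elements of
  \<open>K\<close> and \<open>K1\<close> the translate vanishes around every such
  \<open>b\<close>.\<close>

lemma tran_d2_bounded:
  fixes f :: "'g \<Rightarrow> 'b::real_normed_vector"
  assumes f: "Ck_fun A 2 f" and K: "compact K" "\<And>x. x \<notin> K \<Longrightarrow> f x = 0"
  shows "\<exists>C\<ge>0. \<forall>i<d. \<forall>j<d. \<forall>x b. sqn (b - p0) < r0 / 2 \<longrightarrow> norm (tran_d2 f i j x b) \<le> C"
proof -
  define L where "L = (\<lambda>(a, b). a - b) ` (K \<times> K1)"
  have "continuous_on (K \<times> K1) (\<lambda>(a, b). a - b)"
    unfolding split_beta diff_conv_add_uminus by (intro continuous_intros)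
  then have L: "compact L"
    unfolding L_def by (intro compact_continuous_image compact_Times K compact_K1)
  define Z where "Z = {z. sqn (z - p0) \<le> r0}"
  have Z: "compact Z" "Z \<subseteq> C0" by (auto simp: Z_def compact_sqn_ball r0(2)[THEN subsetD])
  have "\<exists>C. \<forall>x b. x \<in> L \<longrightarrow> b \<in> Z \<longrightarrow> norm (tran_d2 f i j x b) \<le> C" for i j
  proof -
    have "continuous_on (L \<times> Z) (\<lambda>(x, b). tran_d2 f i j x b)"
      by (rule continuous_on_subset[OF tran_derivatives(3)[OF f p0_in]]) (use Z in auto)
    from compact_imp_bounded[OF compact_continuous_image[OF this compact_Times[OF L Z(1)]]]
    obtain C where "\<forall>y\<in>(\<lambda>(x, b). tran_d2 f i j x b) ` (L \<times> Z). norm y \<le> C" by (auto simp: bounded_iff)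
    then show ?thesis by (intro exI[of _ C]) auto
  qed
  then obtain C where C: "\<And>i j x b. x \<in> L \<Longrightarrow> b \<in> Z \<Longrightarrow> norm (tran_d2 f i j x b) \<le> C i j" by metis
  have zero: "tran_d2 f i j x b = 0" if x: "x \<notin> L" and b: "sqn (b - p0) < r0 / 2" for i j x b
  proof -
    define S where "S = {z. sqn (z - p0) < r0}"
    have S: "open S" "b \<in> S" using b r0(1) by (auto simp: S_def open_sqn_ball)
    have t0: "tran f x z = 0" if "z \<in> S" for z
    proof -
      have "inv0 z \<in> K1" using that by (auto simp: S_def K1_def)
      moreover have "x = (x + inv0 z) - inv0 z" by simp
      ultimately have "x + inv0 z \<notin> K" using x unfolding L_def by force
      then show ?thesis using K(2) by (simp add: tran_def)
    qed
    have t1: "tran_d1 f i x z = 0" if "z \<in> S" for z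
    proof -
      have "(tran f x has_derivative (\<lambda>_. 0)) (at z)"
        by (rule has_derivative_transform_within_open[OF has_derivative_const[of 0] S(1) that]) (simp add: t0)
      from frechet_derivative_at[OF this] show ?thesis by (simp add: tran_d1_def fun_eq_iff)
    qed
    have "(tran_d1 f i x has_derivative (\<lambda>_. 0)) (at b)"
      by (rule has_derivative_transform_within_open[OF has_derivative_const[of 0] S]) (simp add: t1)
    from frechet_derivative_at[OF this] show ?thesis by (simp add: tran_d2_def fun_eq_iff)
  qed
  define C' where "C' = (\<Sum>i<d. \<Sum>j<d. \<bar>C i j\<bar>)"
  have C': "0 \<le> C'" by (simp add: C'_def sum_nonneg)
  have "norm (tran_d2 f i j x b) \<le> C'" if "i < d" "j < d" "sqn (b - p0) < r0 / 2" for i j x b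
  proof (cases "x \<in> L")
    case True
    then have "norm (tran_d2 f i j x b) \<le> \<bar>C i j\<bar>"
      using C[of x b i j] that(3) r0(1) by (auto simp: Z_def)
    also have "\<dots> \<le> (\<Sum>j<d. \<bar>C i j\<bar>)" using that by (intro member_le_sum) auto
    also have "\<dots> \<le> C'" unfolding C'_def using that
      by (intro member_le_sum[of i "{..<d}" "\<lambda>i. \<Sum>j<d. \<bar>C i j\<bar>"]) (auto simp: sum_nonneg)
    finally show ?thesis .
  next
    case False
    then show ?thesis using zero that C' by simp
  qed
  then show ?thesis using C' by blast
qed

text \<open>The compensated increment of the Levy-Khintchine formula. With the compactly supported
  \<open>zeta i\<close> in place of the coordinates it makes sense for every jump \<open>y\<close>,
  also outside the chart.\<close>

definition taylor_rem :: "('g \<Rightarrow> 'b::real_normed_vector) \<Rightarrow> 'g \<Rightarrow> 'g \<Rightarrow> 'b" where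
  "taylor_rem f x y = f (x + y) - f x - (\<Sum>i<d. zeta i y *\<^sub>R lfield i f x)"

lemma smooth_lfield: "smooth f \<Longrightarrow> smooth (lfield j f)"
  by (auto simp: smooth_def intro: Ck_fun_lfield)

lemma taylor_bound:
  fixes f :: "'g \<Rightarrow> 'b::real_normed_vector"
  assumes f: "smooth f" and K: "compact K" "\<And>x. x \<notin> K \<Longrightarrow> f x = 0"
  shows "\<exists>C\<ge>0. (\<forall>x y. norm (taylor_rem f x y) \<le> C * (zeta_sq y + indicator (- B1) y)) \<and>
    (\<forall>x. norm (f x) \<le> C) \<and> (\<forall>i<d. \<forall>x. norm (lfield i f x) \<le> C)"
proof -
  have f2: "Ck_fun A 2 f" using f by (simp add: smooth_def)
  obtain B where B: "B \<ge> 0" "\<And>i j x b. i < d \<Longrightarrow> j < d \<Longrightarrow> sqn (b - p0) < r0 / 2 \<Longrightarrow> norm (tran_d2 f i j x b) \<le> B"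
    using tran_d2_bounded[OF f2 K] by blast
  obtain C where C: "C \<ge> 0" "\<And>x. norm (f x) \<le> C"
    using bounded_of_compact_support[OF smooth_continuous_on[OF f] K] by blast
  obtain Z where Z: "Z \<ge> 0" "\<And>i x. i < d \<Longrightarrow> \<bar>zeta i x\<bar> \<le> Z" using zeta_bounded by metis
  have "\<exists>D. D \<ge> 0 \<and> (\<forall>x. norm (lfield i f x) \<le> D)" for i
  proof -
    have "lfield i f x = 0" if "x \<notin> K" for x
      by (rule lfield_zero_outside[OF compact_imp_closed[OF K(1)] K(2) that])
    then show ?thesis
      using bounded_of_compact_support[OF smooth_continuous_on[OF smooth_lfield[OF f]] K(1)] by blast
  qed
  then obtain D where D: "\<And>i. D i \<ge> 0" "\<And>i x. norm (lfield i f x) \<le> D i" by metis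
  define D' where "D' = (\<Sum>i<d. D i)"
  have D'0: "D' \<ge> 0" using D by (simp add: D'_def sum_nonneg)
  have D': "norm (lfield i f x) \<le> D'" if "i < d" for i x
    using order_trans[OF D(2) member_le_sum[of i "{..<d}" D]] that D(1) by (auto simp: D'_def)
  \<comment> \<open>The first summand serves on \<open>B1\<close>, the next two off
    \<open>B1\<close>, where the three parts of the remainder are estimated separately; the last one
    lets \<open>M\<close> dominate the derivatives too.\<close>
  define M where "M = real d * B + 2 * C + real d * Z * D' + D'"
  have M0: "0 \<le> real d * B" "0 \<le> real d * Z * D'" using B(1) Z(1) D'0 by simp_all
  have "norm (taylor_rem f x y) \<le> M * (zeta_sq y + indicator (- B1) y)" for x y
  proof (cases "y \<in> B1")
    case True
    then have y: "y \<in> U0" "sqn (\<phi>0 y - p0) < r0 / 2" by (auto simp: B1_def)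
    have "norm (tran f x (\<phi>0 y) - tran f x p0 -
        (\<Sum>i<d. crd i (\<phi>0 y - p0) *\<^sub>R frechet_derivative (tran f x) (at p0) (w i))) \<le> real d * B * sqn (\<phi>0 y - p0)"
    proof (rule second_order_bound[where r = "r0 / 2" and D' = "\<lambda>i b. frechet_derivative (tran_d1 f i x) (at b)"])
      fix b assume b: "sqn (b - p0) < r0 / 2"
      show "(tran f x has_derivative frechet_derivative (tran f x) (at b)) (at b)"
        by (rule tran_derivatives(1)[OF f2 ball_C0[OF b]])
      show "((\<lambda>b. frechet_derivative (tran f x) (at b) (w i)) has_derivative frechet_derivative (tran_d1 f i x) (at b)) (at b)" for i
        using tran_derivatives(2)[OF f2 ball_C0[OF b]] by (simp add: tran_d1_def[abs_def])
      show "norm (frechet_derivative (tran_d1 f i x) (at b) (w j)) \<le> B" if "i < d" "j < d" for i j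
        using B(2)[OF that b] by (simp add: tran_d2_def)
    qed (use y B in auto)
    then have "norm (taylor_rem f x y) \<le> real d * B * zeta_sq y"
      using y True by (simp add: taylor_rem_def tran_phi tran_p0 tran_d1_p0[unfolded tran_d1_def] zeta_B1 zeta_sq_B1)
    also have "\<dots> \<le> M * zeta_sq y"
      using M0 C(1) D'0 by (intro mult_right_mono) (auto simp: M_def)
    finally show ?thesis using True by simp
  next
    case False
    have "norm (\<Sum>i<d. zeta i y *\<^sub>R lfield i f x) \<le> (\<Sum>i<d. Z * D')"
      by (rule order_trans[OF norm_sum], rule sum_mono) (use Z D' in \<open>auto intro!: mult_mono\<close>)
    then have "norm (taylor_rem f x y) \<le> C + C + real d * Z * D'"
      unfolding taylor_rem_def using C(2)[of "x + y"] C(2)[of x]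
      by (intro order_trans[OF norm_triangle_ineq4] add_mono) (auto simp: mult.assoc)
    also have "\<dots> \<le> M" using M0 D'0 by (simp add: M_def)
    also have "\<dots> \<le> M * (zeta_sq y + indicator (- B1) y)"
      using False M0 C(1) D'0 by (simp add: M_def mult_le_cancel_left1)
    finally show ?thesis .
  qed
  moreover have "norm (f x) \<le> M" for x using C(1) C(2)[of x] M0 D'0 by (simp add: M_def)
  moreover have "norm (lfield i f x) \<le> M" if "i < d" for i x
    using C(1) D'[OF that, of x] M0 by (simp add: M_def)
  moreover have "M \<ge> 0" using C(1) M0 D'0 by (simp add: M_def)
  ultimately show ?thesis by blast
qed

text \<open>For \<open>x\<close> in the compact neighbourhood \<open>N\<close> of the identity, both
  values of \<open>f\<close> vanish unless \<open>y\<close> is in the compact set \<open>C\<close>;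
  over \<open>C\<close>, joint continuity is uniform.\<close>

lemma uniform_translation:
  fixes f :: "'g \<Rightarrow> 'b::real_normed_vector"
  assumes f: "continuous_on UNIV f" and K: "compact K" "\<And>x. x \<notin> K \<Longrightarrow> f x = 0" and "\<epsilon> > 0"
  shows "\<exists>U. open U \<and> 0 \<in> U \<and> (\<forall>x\<in>U. \<forall>y. norm (f (x + y) - f y) \<le> \<epsilon>)"
proof -
  obtain \<eta> V N where "smooth \<eta>" "\<And>x. 0 \<le> \<eta> x" "\<And>x. \<eta> x \<le> (1::real)"
    and V: "open V" "{0} \<subseteq> V" "\<And>x. x \<in> V \<Longrightarrow> \<eta> x = 1"
    and N: "compact N" "N \<subseteq> UNIV" "\<And>x. x \<notin> N \<Longrightarrow> \<eta> x = 0"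
    by (rule cutoff[OF open_UNIV compact_sing[of 0] subset_UNIV]) (rule that)
  have VN: "V \<subseteq> N" using V(3) N(3) by fastforce
  define C where "C = (\<lambda>(a, b). - a + b) ` (N \<times> K) \<union> K"
  have "continuous_on (N \<times> K) (\<lambda>(a, b). - a + b)"
    unfolding split_beta by (intro continuous_intros)
  then have C: "compact C"
    unfolding C_def by (intro compact_Un compact_continuous_image compact_Times K N)
  have "continuous_on (UNIV \<times> C) (\<lambda>(x, y). f (x + y))"
    unfolding split_beta by (intro continuous_intros continuous_on_compose2[OF f]) auto
  then obtain X0 where X0: "0 \<in> X0" "open X0"
    "\<forall>x\<in>X0 \<inter> UNIV. \<forall>y\<in>C. dist ((\<lambda>(x, y). f (x + y)) (x, y)) ((\<lambda>(x, y). f (x + y)) (0, y)) \<le> \<epsilon>"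
    by (rule continuous_on_prod_compactE[OF _ C UNIV_I \<open>\<epsilon> > 0\<close>])
  have "norm (f (x + y) - f y) \<le> \<epsilon>" if x: "x \<in> X0 \<inter> V" for x y
  proof (cases "y \<in> C")
    case True
    then show ?thesis using X0(3) x by (auto simp: dist_norm)
  next
    case False
    have "x + y \<notin> K"
    proof
      assume "x + y \<in> K"
      then have "- x + (x + y) \<in> C"
        unfolding C_def using x VN by (intro UnI1 image_eqI[of _ _ "(x, x + y)"]) auto
      then show False using False by (simp add: add.assoc[symmetric])
    qed
    moreover have "y \<notin> K" using False by (simp add: C_def)
    ultimately show ?thesis using K(2) \<open>\<epsilon> > 0\<close> by simp
  qed
  then show ?thesis using X0 V by (intro exI[of _ "X0 \<inter> V"]) auto
qed

text \<open>The source of the small factor in \<open>difference_quotient_step\<close>: for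
  \<open>x\<close> near the identity the coefficients and the remainder are almost those at the
  identity. On \<open>B1\<close>, \<open>second_order_bound\<close> is applied to the difference of
  the two translates, whose second derivatives are uniformly small; off \<open>B1\<close> the parts
  are estimated one by one.\<close>

lemma taylor_equicontinuous:
  fixes f :: "'g \<Rightarrow> 'b::real_normed_vector"
  assumes f: "smooth f" and K: "compact K" "\<And>x. x \<notin> K \<Longrightarrow> f x = 0" and "\<epsilon> > 0"
  shows "\<exists>U. open U \<and> 0 \<in> U \<and> (\<forall>x\<in>U.
    (\<forall>y. norm (taylor_rem f x y - taylor_rem f 0 y) \<le> \<epsilon> * (zeta_sq y + indicator (- B1) y)) \<and>
    norm (f x - f 0) \<le> \<epsilon> \<and> (\<forall>i<d. norm (lfield i f x - lfield i f 0) \<le> \<epsilon>))"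
proof -
  have f2: "Ck_fun A 2 f" using f by (simp add: smooth_def)
  obtain Z where Z: "Z \<ge> 0" "\<And>i x. i < d \<Longrightarrow> \<bar>zeta i x\<bar> \<le> Z" using zeta_bounded by metis
  \<comment> \<open>One \<epsilon> has to cover \<open>d * \<delta>\<close> on \<open>B1\<close> and
    \<open>2 * \<delta> + d * Z * \<delta>\<close> off \<open>B1\<close>.\<close>
  define \<delta> where "\<delta> = \<epsilon> / (3 + real d * Z + real d)"
  have den: "3 + real d * Z + real d > 0" using Z(1) by (simp add: add_pos_nonneg)
  have \<delta>: "\<delta> > 0" using den \<open>\<epsilon> > 0\<close> by (simp add: \<delta>_def)
  have \<delta>\<epsilon>: "\<delta> * (3 + real d * Z + real d) = \<epsilon>" using den by (simp add: \<delta>_def)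
  have nn: "0 \<le> real d * Z * \<delta>" "0 \<le> real d * \<delta>" using Z(1) \<delta> by simp_all
  have \<epsilon>eq: "\<epsilon> = 3 * \<delta> + real d * Z * \<delta> + real d * \<delta>"
    using \<delta>\<epsilon> by (simp add: algebra_simps)
  obtain W where W: "open W" "0 \<in> W" "\<And>x y. x \<in> W \<Longrightarrow> norm (f (x + y) - f y) \<le> \<delta>"
    using uniform_translation[OF smooth_continuous_on[OF f] K \<delta>] by blast
  have "\<exists>U. open U \<and> 0 \<in> U \<and> (\<forall>x\<in>U. norm (lfield i f x - lfield i f 0) \<le> \<delta>)" for i
  proof -
    have "lfield i f x = 0" if "x \<notin> K" for x
      by (rule lfield_zero_outside[OF compact_imp_closed[OF K(1)] K(2) that])
    from uniform_translation[OF smooth_continuous_on[OF smooth_lfield[OF f]] K(1) this \<delta>]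
    obtain U where U: "open U" "0 \<in> U" "\<And>x y. x \<in> U \<Longrightarrow> norm (lfield i f (x + y) - lfield i f y) \<le> \<delta>" by blast
    then show ?thesis using U(3)[of _ 0] by (intro exI[of _ U]) auto
  qed
  then obtain V where V: "\<And>i. open (V i)" "\<And>i. 0 \<in> V i" "\<And>i x. x \<in> V i \<Longrightarrow> norm (lfield i f x - lfield i f 0) \<le> \<delta>"
    by metis
  define Q where "Q = {z. sqn (z - p0) \<le> r0}"
  have Q: "compact Q" "Q \<subseteq> C0" by (auto simp: Q_def compact_sqn_ball r0(2)[THEN subsetD])
  have "\<exists>U. open U \<and> 0 \<in> U \<and> (\<forall>x\<in>U. \<forall>b\<in>Q. norm (tran_d2 f i j x b - tran_d2 f i j 0 b) \<le> \<delta>)" for i j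
  proof -
    have "continuous_on (UNIV \<times> Q) (\<lambda>(x, b). tran_d2 f i j x b)"
      by (rule continuous_on_subset[OF tran_derivatives(3)[OF f2 p0_in]]) (use Q in auto)
    then obtain X0 where X0: "0 \<in> X0" "open X0" "\<forall>x\<in>X0 \<inter> UNIV. \<forall>b\<in>Q.
        dist ((\<lambda>(x, b). tran_d2 f i j x b) (x, b)) ((\<lambda>(x, b). tran_d2 f i j x b) (0, b)) \<le> \<delta>"
      by (rule continuous_on_prod_compactE[OF _ Q(1) UNIV_I \<delta>])
    then show ?thesis by (intro exI[of _ X0]) (auto simp: dist_norm)
  qed
  then obtain T where T: "\<And>i j. open (T i j)" "\<And>i j. 0 \<in> T i j"
    "\<And>i j x b. x \<in> T i j \<Longrightarrow> b \<in> Q \<Longrightarrow> norm (tran_d2 f i j x b - tran_d2 f i j 0 b) \<le> \<delta>"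
    by metis
  define U where "U = W \<inter> (\<Inter>i<d. V i) \<inter> (\<Inter>i<d. \<Inter>j<d. T i j)"
  have "open U" unfolding U_def by (intro open_Int open_INT W V T ballI) auto
  moreover have "0 \<in> U" using W V T by (auto simp: U_def)
  moreover have XV: "norm (lfield i f x - lfield i f 0) \<le> \<delta>" if "x \<in> U" "i < d" for x i
    using that V(3) by (auto simp: U_def)
  moreover have f0: "norm (f x - f 0) \<le> \<delta>" if "x \<in> U" for x
    using W(3)[of x 0] that by (auto simp: U_def)
  moreover have "norm (taylor_rem f x y - taylor_rem f 0 y) \<le> \<epsilon> * (zeta_sq y + indicator (- B1) y)" if x: "x \<in> U" for x y
  proof (cases "y \<in> B1")
    case True
    then have y: "y \<in> U0" "sqn (\<phi>0 y - p0) < r0 / 2" by (auto simp: B1_def)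
    let ?D = "\<lambda>b v. frechet_derivative (tran f x) (at b) v - frechet_derivative (tran f 0) (at b) v"
    have *: "norm ((tran f x (\<phi>0 y) - tran f 0 (\<phi>0 y)) - (tran f x p0 - tran f 0 p0) -
        (\<Sum>i<d. crd i (\<phi>0 y - p0) *\<^sub>R ?D p0 (w i))) \<le> real d * \<delta> * sqn (\<phi>0 y - p0)"
    proof (rule second_order_bound[where r = "r0 / 2" and \<Phi> = "\<lambda>b. tran f x b - tran f 0 b" and D = ?D and
          D' = "\<lambda>i b v. frechet_derivative (tran_d1 f i x) (at b) v - frechet_derivative (tran_d1 f i 0) (at b) v"])
      fix b assume b: "sqn (b - p0) < r0 / 2"
      show "((\<lambda>b. tran f x b - tran f 0 b) has_derivative ?D b) (at b)"
        by (intro has_derivative_diff tran_derivatives(1)[OF f2 ball_C0[OF b]])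
      show "((\<lambda>b. ?D b (w i)) has_derivative
          (\<lambda>v. frechet_derivative (tran_d1 f i x) (at b) v - frechet_derivative (tran_d1 f i 0) (at b) v)) (at b)" for i
        using has_derivative_diff[OF tran_derivatives(2)[OF f2 ball_C0[OF b], of i x]
            tran_derivatives(2)[OF f2 ball_C0[OF b], of i 0]]
        by (simp add: tran_d1_def[abs_def])
      show "norm (frechet_derivative (tran_d1 f i x) (at b) (w j) - frechet_derivative (tran_d1 f i 0) (at b) (w j)) \<le> \<delta>"
        if "i < d" "j < d" for i j
        using T(3)[of x i j b] that x b r0(1) by (auto simp: tran_d2_def U_def Q_def)
    qed (use y \<delta> in auto)
    have "norm (taylor_rem f x y - taylor_rem f 0 y) \<le> real d * \<delta> * zeta_sq y"
    proof -
      define S where "S z = (\<Sum>i<d. crd i (\<phi>0 y - p0) *\<^sub>R lfield i f z)" for z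
      have e1: "(\<Sum>i<d. crd i (\<phi>0 y - p0) *\<^sub>R ?D p0 (w i)) = S x - S 0"
        by (simp add: S_def tran_d1_p0[unfolded tran_d1_def] scaleR_diff_right sum_subtractf del: crd_simps)
      have e2: "taylor_rem f z y = f (z + y) - f z - S z" for z
        using True by (simp add: taylor_rem_def S_def zeta_B1)
      have "taylor_rem f x y - taylor_rem f 0 y = (tran f x (\<phi>0 y) - tran f 0 (\<phi>0 y)) - (tran f x p0 - tran f 0 p0) -
          (\<Sum>i<d. crd i (\<phi>0 y - p0) *\<^sub>R ?D p0 (w i))"
        unfolding e1 e2 tran_phi[OF y(1)] tran_p0 by (simp add: algebra_simps)
      then show ?thesis using * by (simp only: zeta_sq_B1[OF True])
    qed
    also have "\<dots> \<le> \<epsilon> * zeta_sq y"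
      using nn \<delta> by (intro mult_right_mono) (auto simp: \<epsilon>eq)
    finally show ?thesis using True by simp
  next
    case False
    have "norm (\<Sum>i<d. zeta i y *\<^sub>R (lfield i f x - lfield i f 0)) \<le> (\<Sum>i<d. Z * \<delta>)"
      by (rule order_trans[OF norm_sum], rule sum_mono) (use Z XV[OF x] in \<open>auto intro!: mult_mono\<close>)
    moreover have "taylor_rem f x y - taylor_rem f 0 y = (f (x + y) - f y) - (f x - f 0) -
        (\<Sum>i<d. zeta i y *\<^sub>R (lfield i f x - lfield i f 0))"
      by (simp add: taylor_rem_def algebra_simps sum_subtractf)
    moreover have "norm (f (x + y) - f y) \<le> \<delta>" using W(3) x by (auto simp: U_def)
    ultimately have "norm (taylor_rem f x y - taylor_rem f 0 y) \<le> \<delta> + \<delta> + real d * Z * \<delta>"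
      using f0[OF x] by (auto intro!: order_trans[OF norm_triangle_ineq4] add_mono simp: mult.assoc)
    also have "\<dots> \<le> \<epsilon>" using nn \<delta> by (simp add: \<epsilon>eq)
    also have "\<dots> \<le> \<epsilon> * (zeta_sq y + indicator (- B1) y)"
      using False \<open>\<epsilon> > 0\<close> by (simp add: mult_le_cancel_left1)
    finally show ?thesis .
  qed
  moreover have "\<delta> \<le> \<epsilon>" using nn \<delta> by (simp add: \<epsilon>eq)
  ultimately show ?thesis by (intro exI[of _ U]) (auto intro: order_trans)
qed

end

section \<open>Symmetry of second derivatives and 2-jets at the identity\<close>

lemma mixed_difference_quotient:
  fixes H :: "'e::real_normed_vector \<Rightarrow> 'b::real_normed_vector"
  assumes "open S" "p \<in> S" and H: "Ck_on 2 S H" and "\<epsilon> > 0"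
  defines "L \<equiv> \<lambda>u v. frechet_derivative (\<lambda>b. frechet_derivative H (at b) u) (at p) v"
  shows "\<exists>s0>0. \<forall>s. 0 < s \<and> s \<le> s0 \<longrightarrow>
    norm (H (p + s *\<^sub>R u + s *\<^sub>R v) - H (p + s *\<^sub>R u) - H (p + s *\<^sub>R v) + H p - s\<^sup>2 *\<^sub>R L u v) \<le> \<epsilon> * s\<^sup>2"
proof -
  have C2: "Ck_on (Suc (Suc 0)) S H" using H by (simp add: numeral_2_eq_2)
  define Hu where "Hu b = frechet_derivative H (at b) u" for b
  have C1: "Ck_on (Suc 0) S Hu" using Ck_on_Suc_derivative[OF C2] by (simp add: Hu_def[abs_def])
  define M where "M b = frechet_derivative Hu (at b) v" for b
  have Mp: "M p = L u v" by (simp add: M_def L_def Hu_def[abs_def])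
  have "continuous_on S M" using Ck_on_Suc_derivative[OF C1] by (simp add: M_def[abs_def])
  then have "isCont M p" using \<open>open S\<close> \<open>p \<in> S\<close> continuous_on_eq_continuous_at by blast
  then obtain \<delta>1 where \<delta>1: "\<delta>1 > 0" "\<And>b. dist b p < \<delta>1 \<Longrightarrow> dist (M b) (M p) < \<epsilon>"
    using \<open>\<epsilon> > 0\<close> by (metis continuous_at_eps_delta)
  obtain \<delta>2 where \<delta>2: "\<delta>2 > 0" "ball p \<delta>2 \<subseteq> S" using assms(1,2) open_contains_ball by blast
  define \<delta> where "\<delta> = min \<delta>1 \<delta>2"
  define s0 where "s0 = \<delta> / (norm u + norm v + 1)"
  have s0: "s0 > 0" using \<delta>1 \<delta>2 by (simp add: s0_def \<delta>_def add_nonneg_pos)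
  have near: "p + t *\<^sub>R u + \<tau> *\<^sub>R v \<in> S" "norm (M (p + t *\<^sub>R u + \<tau> *\<^sub>R v) - L u v) \<le> \<epsilon>"
    if "0 \<le> t" "t \<le> s" "0 \<le> \<tau>" "\<tau> \<le> s" "0 < s" "s \<le> s0" for t \<tau> s
  proof -
    have "norm (t *\<^sub>R u + \<tau> *\<^sub>R v) \<le> t * norm u + \<tau> * norm v"
      using that by (intro order_trans[OF norm_triangle_ineq]) auto
    also have "\<dots> \<le> s0 * norm u + s0 * norm v" using that by (intro add_mono mult_right_mono) auto
    also have "\<dots> < s0 * (norm u + norm v + 1)" using s0 by (simp add: algebra_simps)
    also have "\<dots> = \<delta>" using add_nonneg_pos[of "norm u + norm v" 1] by (simp add: s0_def)
    finally have "dist (p + t *\<^sub>R u + \<tau> *\<^sub>R v) p < \<delta>" by (simp add: dist_norm add.assoc)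
    then have "dist (p + t *\<^sub>R u + \<tau> *\<^sub>R v) p < \<delta>1" "p + t *\<^sub>R u + \<tau> *\<^sub>R v \<in> ball p \<delta>2"
      unfolding mem_ball dist_commute[of p] by (auto simp only: \<delta>_def min_less_iff_conj)
    then show "p + t *\<^sub>R u + \<tau> *\<^sub>R v \<in> S" "norm (M (p + t *\<^sub>R u + \<tau> *\<^sub>R v) - L u v) \<le> \<epsilon>"
      using \<delta>1(2)[of "p + t *\<^sub>R u + \<tau> *\<^sub>R v"] \<delta>2(2) by (auto simp: Mp dist_norm)
  qed
  have "norm (H (p + s *\<^sub>R u + s *\<^sub>R v) - H (p + s *\<^sub>R u) - H (p + s *\<^sub>R v) + H p - s\<^sup>2 *\<^sub>R L u v) \<le> \<epsilon> * s\<^sup>2"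
    if s: "0 < s" "s \<le> s0" for s
  proof -
    \<comment> \<open>The mean value inequality is used twice: here along \<open>v\<close> for the
      derivative \<open>Hu\<close>, and below along \<open>u\<close> for the difference of
      \<open>H\<close> at two points that are \<open>s *\<^sub>R v\<close> apart.\<close>
    have inner: "norm (Hu (p + t *\<^sub>R u + s *\<^sub>R v) - Hu (p + t *\<^sub>R u) - s *\<^sub>R L u v) \<le> \<epsilon> * s"
      if t: "0 \<le> t" "t \<le> s" for t
    proof -
      have "norm ((Hu (p + t *\<^sub>R u + s *\<^sub>R v) - s *\<^sub>R L u v) - (Hu (p + t *\<^sub>R u + 0 *\<^sub>R v) - 0 *\<^sub>R L u v)) \<le> \<epsilon> * s"
      proof (rule norm_increment_le[where f = "\<lambda>\<tau>. Hu (p + t *\<^sub>R u + \<tau> *\<^sub>R v) - \<tau> *\<^sub>R L u v"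
            and f' = "\<lambda>\<tau>. M (p + t *\<^sub>R u + \<tau> *\<^sub>R v) - L u v"])
        fix \<tau> assume \<tau>: "0 \<le> \<tau>" "\<tau> \<le> s"
        show "((\<lambda>\<tau>. Hu (p + t *\<^sub>R u + \<tau> *\<^sub>R v) - \<tau> *\<^sub>R L u v) has_vector_derivative
            M (p + t *\<^sub>R u + \<tau> *\<^sub>R v) - L u v) (at \<tau>)"
          unfolding M_def
          by (intro has_vector_derivative_diff has_vector_derivative_along_line
              Ck_on_Suc_has_derivative[OF C1] near(1)[OF t \<tau> s])
            (auto intro!: derivative_eq_intros simp: has_vector_derivative_def)
        show "norm (M (p + t *\<^sub>R u + \<tau> *\<^sub>R v) - L u v) \<le> \<epsilon>" by (rule near(2)[OF t \<tau> s])
      qed (use s in simp)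
      then show ?thesis by (simp add: algebra_simps)
    qed
    let ?f = "\<lambda>t. H (p + s *\<^sub>R v + t *\<^sub>R u) - H (p + t *\<^sub>R u) - t *\<^sub>R (s *\<^sub>R L u v)"
    have *: "norm (?f s - ?f 0) \<le> (\<epsilon> * s) * s"
    proof (rule norm_increment_le[where f = ?f and
          f' = "\<lambda>t. Hu (p + s *\<^sub>R v + t *\<^sub>R u) - Hu (p + t *\<^sub>R u) - s *\<^sub>R L u v"])
      fix t assume t: "0 \<le> t" "t \<le> s"
      have "p + s *\<^sub>R v + t *\<^sub>R u \<in> S" using near(1)[OF t _ _ s, of s] s by (simp add: add_ac)
      moreover have "p + t *\<^sub>R u \<in> S" using near(1)[OF t _ _ s, of 0] s by simp
      ultimately show "(?f has_vector_derivative
          Hu (p + s *\<^sub>R v + t *\<^sub>R u) - Hu (p + t *\<^sub>R u) - s *\<^sub>R L u v) (at t)"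
        unfolding Hu_def
        by (intro has_vector_derivative_diff has_vector_derivative_along_line Ck_on_Suc_has_derivative[OF C2])
          (auto intro!: derivative_eq_intros simp: has_vector_derivative_def)
      show "norm (Hu (p + s *\<^sub>R v + t *\<^sub>R u) - Hu (p + t *\<^sub>R u) - s *\<^sub>R L u v) \<le> \<epsilon> * s"
        using inner[OF t] by (simp add: add_ac)
    qed (use s in simp)
    have eq: "?f s - ?f 0 =
        H (p + s *\<^sub>R u + s *\<^sub>R v) - H (p + s *\<^sub>R u) - H (p + s *\<^sub>R v) + H p - s\<^sup>2 *\<^sub>R L u v"
      by (simp add: power2_eq_square algebra_simps)
    show ?thesis unfolding eq[symmetric] using * by (simp only: power2_eq_square mult.assoc)
  qed
  then show ?thesis using s0 by blast
qed

text \<open>The second difference of \<open>H\<close> over the parallelogram is symmetric in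
  \<open>u\<close> and \<open>v\<close>, and divided by \<open>s\<^sup>2\<close> it tends to either
  of the two mixed derivatives.\<close>

lemma second_derivative_symmetric:
  fixes H :: "'e::real_normed_vector \<Rightarrow> 'b::real_normed_vector"
  assumes S: "open S" "p \<in> S" and H: "Ck_on 2 S H"
  shows "frechet_derivative (\<lambda>b. frechet_derivative H (at b) u) (at p) v =
    frechet_derivative (\<lambda>b. frechet_derivative H (at b) v) (at p) u" (is "?L u v = ?L v u")
proof -
  have "norm (?L u v - ?L v u) \<le> 0 + e" if "e > 0" for e
  proof -
    have e2: "e / 2 > 0" using that by simp
    obtain s1 where s1: "s1 > 0" "\<And>s. 0 < s \<Longrightarrow> s \<le> s1 \<Longrightarrow>
      norm (H (p + s *\<^sub>R u + s *\<^sub>R v) - H (p + s *\<^sub>R u) - H (p + s *\<^sub>R v) + H p - s\<^sup>2 *\<^sub>R ?L u v) \<le> e / 2 * s\<^sup>2"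
      using mixed_difference_quotient[OF S H e2, of u v] by blast
    obtain s2 where s2: "s2 > 0" "\<And>s. 0 < s \<Longrightarrow> s \<le> s2 \<Longrightarrow>
      norm (H (p + s *\<^sub>R v + s *\<^sub>R u) - H (p + s *\<^sub>R v) - H (p + s *\<^sub>R u) + H p - s\<^sup>2 *\<^sub>R ?L v u) \<le> e / 2 * s\<^sup>2"
      using mixed_difference_quotient[OF S H e2, of v u] by blast
    define s where "s = min s1 s2"
    have s: "s > 0" using s1 s2 by (simp add: s_def)
    have *: "norm (a - b) \<le> x + y" if "norm (c - b) \<le> x" "norm (c - a) \<le> y" for a b c :: 'b and x y :: real
    proof -
      have "norm ((c - b) - (c - a)) \<le> x + y"
        by (rule order_trans[OF norm_triangle_ineq4 add_mono[OF that]])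
      then show ?thesis by simp
    qed
    have comm: "H (p + s *\<^sub>R v + s *\<^sub>R u) - H (p + s *\<^sub>R v) - H (p + s *\<^sub>R u) + H p =
       H (p + s *\<^sub>R u + s *\<^sub>R v) - H (p + s *\<^sub>R u) - H (p + s *\<^sub>R v) + H p" (is "_ = ?\<Delta>")
      by (simp add: algebra_simps)
    have "norm (s\<^sup>2 *\<^sub>R ?L u v - s\<^sup>2 *\<^sub>R ?L v u) \<le> e / 2 * s\<^sup>2 + e / 2 * s\<^sup>2"
    proof (rule *)
      show "norm (?\<Delta> - s\<^sup>2 *\<^sub>R ?L v u) \<le> e / 2 * s\<^sup>2"
        using s2(2)[of s] s by (simp only: comm) (simp add: s_def)
      show "norm (?\<Delta> - s\<^sup>2 *\<^sub>R ?L u v) \<le> e / 2 * s\<^sup>2"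
        using s1(2)[of s] s by (simp add: s_def)
    qed
    then have "norm (s\<^sup>2 *\<^sub>R (?L u v - ?L v u)) \<le> e * s\<^sup>2"
      by (simp add: scaleR_diff_right)
    then show ?thesis using s by simp
  qed
  then have "norm (?L u v - ?L v u) \<le> 0" by (rule field_le_epsilon)
  then show ?thesis by simp
qed

context finite_basis
begin

lemma crd_has_derivative: "((\<lambda>b. crd i (b - p)) has_derivative crd i) (at b)"
  using bounded_linear.has_derivative[OF bounded_linear_crd[of i] has_derivative_diff[OF has_derivative_ident has_derivative_const], of p "at b"]
  by (simp del: crd_simps)

lemma sum_crd_basis:
  fixes F :: "nat \<Rightarrow> 'b::real_normed_vector"
  assumes "k < d" shows "(\<Sum>i<d. crd i (w k) *\<^sub>R F i) = F k"
proof -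
  have "(\<Sum>i<d. crd i (w k) *\<^sub>R F i) = (\<Sum>i<d. if i = k then F i else 0)"
    using assms by (intro sum.cong) (auto simp: crd_basis)
  then show ?thesis using assms by simp
qed

end

text \<open>A product rule in which one factor is merely continuous; it works because the other
  vanishes at \<open>p\<close> together with its derivative.\<close>

lemma has_derivative_zero_mult:
  fixes c :: "'e::real_normed_vector \<Rightarrow> real"
  assumes g: "(g has_derivative (\<lambda>_. 0)) (at p)" "g p = 0" and c: "isCont c p"
  shows "((\<lambda>b. c b *\<^sub>R g b) has_derivative (\<lambda>_. 0)) (at p)"
proof -
  have "((\<lambda>y. norm (g y - g p - 0) / norm (y - p)) \<longlongrightarrow> 0) (at p)"
    using g(1) unfolding has_derivative_iff_norm by simp
  moreover have "((\<lambda>y. \<bar>c y\<bar>) \<longlongrightarrow> \<bar>c p\<bar>) (at p)"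
    using c by (intro tendsto_rabs) (simp add: isCont_def)
  ultimately have "((\<lambda>y. \<bar>c y\<bar> * (norm (g y - g p - 0) / norm (y - p))) \<longlongrightarrow> \<bar>c p\<bar> * 0) (at p)"
    by (intro tendsto_mult)
  then show ?thesis unfolding has_derivative_iff_norm using g(2) by simp
qed

context lie_chart
begin

text \<open>The 2-jet of \<open>h\<close> at the identity vanishes, expressed in the chart there.\<close>
definition jet_zero :: "('g \<Rightarrow> 'b::real_normed_vector) \<Rightarrow> bool" where
  "jet_zero h \<longleftrightarrow> h 0 = 0 \<and> (\<forall>i<d. tran_d1 h i 0 p0 = 0) \<and> (\<forall>i<d. \<forall>j<d. tran_d2 h i j 0 p0 = 0)"

text \<open>Continuity keeps the second derivatives below \<delta> on a small ball, and there
  \<open>second_order_bound\<close> applies with a vanishing linear part.\<close>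

lemma jet_zero_small:
  fixes h :: "'g \<Rightarrow> 'b::real_normed_vector"
  assumes h: "Ck_fun A 2 h" and j: "jet_zero h" and "\<epsilon> > 0"
  shows "\<exists>U. open U \<and> 0 \<in> U \<and> U \<subseteq> B1 \<and> (\<forall>y\<in>U. norm (h y) \<le> \<epsilon> * zeta_sq y)"
proof -
  \<comment> \<open>The summand 1 covers dimension zero.\<close>
  define \<delta> where "\<delta> = \<epsilon> / (real d + 1)"
  have \<delta>: "\<delta> > 0" "real d * \<delta> \<le> \<epsilon>" using \<open>\<epsilon> > 0\<close> by (simp_all add: \<delta>_def field_simps)
  define S where "S = (\<Inter>i<d. \<Inter>k<d. C0 \<inter> (\<lambda>b. norm (tran_d2 h i k 0 b)) -` {..<\<delta>}) \<inter> {b. sqn (b - p0) < r0 / 2}"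
  have op: "open (C0 \<inter> (\<lambda>b. norm (tran_d2 h i k 0 b)) -` {..<\<delta>})" for i k
  proof (rule continuous_open_preimage[OF _ open_C0])
    have "continuous_on C0 (\<lambda>b. (\<lambda>(x, b). tran_d2 h i k x b) (0, b))"
      by (rule continuous_on_compose2[OF tran_derivatives(3)[OF h p0_in]])
        (auto intro!: continuous_intros)
    then show "continuous_on C0 (\<lambda>b. norm (tran_d2 h i k 0 b))"
      by (simp add: continuous_on_norm)
  qed simp
  have "open S" unfolding S_def
    by (intro open_Int[OF open_INT open_sqn_ball] ballI open_INT op finite_lessThan)
  moreover have "p0 \<in> S" using j \<delta> p0_in r0(1) by (auto simp: S_def jet_zero_def)
  ultimately obtain r where r: "r > 0" "{z. sqn (z - p0) \<le> r} \<subseteq> S"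
    using sqn_ball_in_open by blast
  define U where "U = {x \<in> U0. sqn (\<phi>0 x - p0) < r}"
  have rS: "b \<in> S" "sqn (b - p0) < r0 / 2" "b \<in> C0" if "sqn (b - p0) < r" for b
  proof -
    show "b \<in> S" using r(2) that by auto
    then show "sqn (b - p0) < r0 / 2" by (simp add: S_def)
    then show "b \<in> C0" by (rule ball_C0)
  qed
  have "open U"
  proof -
    have "U = U0 \<inter> (\<lambda>y. sqn (\<phi>0 y - p0)) -` {..<r}" by (auto simp: U_def)
    moreover have "continuous_on U0 (\<lambda>y. sqn (\<phi>0 y - p0))"
      by (intro continuous_intros chart_continuous chart0)
    ultimately show ?thesis
      using chart_open[OF chart0] by (metis continuous_open_preimage open_lessThan)
  qed
  moreover have "0 \<in> U" using zero_in_U0 r by (simp add: U_def)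
  moreover have UB: "U \<subseteq> B1" using rS(2) by (auto simp: U_def B1_def)
  moreover have "norm (h y) \<le> \<epsilon> * zeta_sq y" if y: "y \<in> U" for y
  proof -
    have y': "y \<in> U0" "sqn (\<phi>0 y - p0) < r" using y by (auto simp: U_def)
    have "norm (tran h 0 (\<phi>0 y) - tran h 0 p0 -
        (\<Sum>i<d. crd i (\<phi>0 y - p0) *\<^sub>R frechet_derivative (tran h 0) (at p0) (w i))) \<le> real d * \<delta> * sqn (\<phi>0 y - p0)"
    proof (rule second_order_bound[where r = r and D' = "\<lambda>i b. frechet_derivative (tran_d1 h i 0) (at b)"])
      fix b assume b: "sqn (b - p0) < r"
      show "(tran h 0 has_derivative frechet_derivative (tran h 0) (at b)) (at b)"
        by (rule tran_derivatives(1)[OF h rS(3)[OF b]])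
      show "((\<lambda>b. frechet_derivative (tran h 0) (at b) (w i)) has_derivative frechet_derivative (tran_d1 h i 0) (at b)) (at b)" for i
        using tran_derivatives(2)[OF h rS(3)[OF b]] by (simp add: tran_d1_def[abs_def])
      show "norm (frechet_derivative (tran_d1 h i 0) (at b) (w k)) \<le> \<delta>" if "i < d" "k < d" for i k
      proof -
        have "b \<in> C0 \<inter> (\<lambda>b. norm (tran_d2 h i k 0 b)) -` {..<\<delta>}"
          using rS(1)[OF b] that unfolding S_def by blast
        then show ?thesis by (simp add: tran_d2_def)
      qed
    qed (use y' \<delta> in auto)
    then have "norm (h y) \<le> real d * \<delta> * zeta_sq y"
      using j y' UB y
      by (simp add: tran_phi tran_p0 jet_zero_def tran_d1_def zeta_sq_B1 subset_iff)
    also have "\<dots> \<le> \<epsilon> * zeta_sq y" using \<delta>(2) by (intro mult_right_mono) auto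
    finally show ?thesis .
  qed
  ultimately show ?thesis by blast
qed

text \<open>\<open>Cb2_extension\<close> asks for iterated fields to vanish, whereas
  \<open>jet_zero\<close> is about derivatives in the chart. There \<open>lfield k h\<close> is a
  combination, with continuous coefficients, of first derivatives of \<open>h\<close>; these vanish
  at the identity together with their own derivatives, so one more differentiation gives
  zero.\<close>

lemma jet_zero_lfield:
  fixes h :: "'g \<Rightarrow> 'b::real_normed_vector"
  assumes h: "Ck_fun A 2 h" and jz: "jet_zero h" and "j < d" "k < d"
  shows "lfield j h 0 = 0" "lfield j (lfield k h) 0 = 0"
proof -
  show "lfield j h 0 = 0" using jz \<open>j < d\<close> tran_d1_p0[of h j 0] by (simp add: jet_zero_def)
  define S where "S = {(a, b). a \<in> C0 \<and> b \<in> C0 \<and> inv0 a + inv0 b \<in> U0}"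
  define m where "m = (\<lambda>(a, b). \<phi>0 (inv0 a + inv0 b))"
  have "smooth_on S m"
    using lie chart0 unfolding lie_group_def S_def m_def by blast
  then have m: "Ck_on (Suc 0) S m" unfolding smooth_on_def by blast
  have "S = (C0 \<times> C0) \<inter> (\<lambda>(a, b). inv0 a + inv0 b) -` U0" by (auto simp: S_def)
  moreover have "continuous_on (C0 \<times> C0) (\<lambda>(a, b). inv0 a + inv0 b)"
    unfolding split_beta
    by (intro continuous_intros continuous_on_compose2[OF chart_inv_continuous[OF chart0]]) auto
  ultimately have S: "open S"
    using continuous_open_preimage open_Times[OF open_C0 open_C0] chart_open[OF chart0] by metis
  have inS: "(z, p0) \<in> S" if "z \<in> C0" for z
    using that p0_in inv0_p0 chart_inv_mem[of z] by (simp add: S_def)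
  have m_p0: "m (z, p0) = z" if "z \<in> C0" for z
    using that inv0_p0 by (auto simp: m_def chart_inv[OF chart0])
  \<comment> \<open>\<open>c z\<close> is the \<open>k\<close>-th field at the point with
    coordinates \<open>z\<close>, written in the chart at the identity.\<close>
  define c where "c z = frechet_derivative m (at (z, p0)) (0, w k)" for z
  have ex: "lfield k h (inv0 z) = (\<Sum>i<d. crd i (c z) *\<^sub>R tran_d1 h i 0 z)" if z: "z \<in> C0" for z
  proof -
    have "((\<lambda>b. (z, b)) has_derivative (\<lambda>v. (0, v))) (at p0)"
      by (intro derivative_intros)
    from has_derivative_compose[OF this Ck_on_Suc_has_derivative[OF m inS[OF z]]]
    have 1: "((\<lambda>b. m (z, b)) has_derivative (\<lambda>v. frechet_derivative m (at (z, p0)) (0, v))) (at p0)" .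
    have D: "(tran h 0 has_derivative frechet_derivative (tran h 0) (at z)) (at z)"
      by (rule tran_derivatives(1)[OF h z])
    then have "(tran h 0 has_derivative frechet_derivative (tran h 0) (at z)) (at (m (z, p0)))"
      using m_p0[OF z] by simp
    from has_derivative_compose[OF 1 this]
    have 2: "((\<lambda>b. tran h 0 (m (z, b))) has_derivative
        (\<lambda>v. frechet_derivative (tran h 0) (at z) (frechet_derivative m (at (z, p0)) (0, v)))) (at p0)" .
    define T where "T = {b. (z, b) \<in> S}"
    have "open T"
      using open_vimage[OF S, of "\<lambda>b. (z, b)"] by (simp add: T_def vimage_def continuous_on_Pair)
    moreover have "p0 \<in> T" using inS[OF z] by (simp add: T_def)
    moreover have "tran h 0 (m (z, b)) = h (inv0 z + inv0 b)" if "b \<in> T" for b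
      using that by (simp add: T_def S_def m_def tran_phi)
    ultimately have "((\<lambda>b. h (inv0 z + inv0 b)) has_derivative
        (\<lambda>v. frechet_derivative (tran h 0) (at z) (frechet_derivative m (at (z, p0)) (0, v)))) (at p0)"
      by (intro has_derivative_transform_within_open[OF 2])
    from frechet_derivative_at[OF this]
    have "lfield k h (inv0 z) = frechet_derivative (tran h 0) (at z) (c z)"
      by (simp add: left_invariant_field_def c_def fun_eq_iff)
    also have "\<dots> = (\<Sum>i<d. crd i (c z) *\<^sub>R tran_d1 h i 0 z)"
      unfolding tran_d1_def by (rule linear_expand[OF has_derivative_linear[OF D]])
    finally show ?thesis .
  qed
  have "((\<lambda>z. \<Sum>i<d. crd i (c z) *\<^sub>R tran_d1 h i 0 z) has_derivative (\<lambda>_. \<Sum>i<d. 0)) (at p0)"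
  proof (intro has_derivative_sum has_derivative_zero_mult)
    fix i assume "i \<in> {..<d}"
    then have i: "i < d" by simp
    show "tran_d1 h i 0 p0 = 0" using jz i by (simp add: jet_zero_def)
    have D: "(tran_d1 h i 0 has_derivative frechet_derivative (tran_d1 h i 0) (at p0)) (at p0)"
      by (rule tran_derivatives(2)[OF h p0_in])
    have "frechet_derivative (tran_d1 h i 0) (at p0) v = 0" for v
      using jz i by (subst linear_expand[OF has_derivative_linear[OF D]]) (simp add: jet_zero_def tran_d2_def)
    then have "frechet_derivative (tran_d1 h i 0) (at p0) = (\<lambda>_. 0)" by (simp add: fun_eq_iff)
    then show "(tran_d1 h i 0 has_derivative (\<lambda>_. 0)) (at p0)" using D by simp
    have "continuous_on S (\<lambda>x. frechet_derivative m (at x) (0, w k))"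
      using Ck_on_Suc_derivative[OF m] by simp
    then have "continuous_on C0 c" unfolding c_def
      by (rule continuous_on_compose2) (use inS in \<open>auto intro!: continuous_intros\<close>)
    then have "continuous_on C0 (\<lambda>z. crd i (c z))" by (rule continuous_on_crd)
    then show "isCont (\<lambda>z. crd i (c z)) p0"
      using open_C0 p0_in continuous_on_eq_continuous_at by blast
  qed
  then have "((\<lambda>z. lfield k h (inv0 z)) has_derivative (\<lambda>_. \<Sum>i<d. 0)) (at p0)"
    by (rule has_derivative_transform_within_open[OF _ open_C0 p0_in]) (rule ex[symmetric])
  from frechet_derivative_at[OF this] show "lfield j (lfield k h) 0 = 0"
    unfolding left_invariant_field_def[of U0 \<phi>0 "w j"] by (simp add: fun_eq_iff)
qed

text \<open>The second-order Taylor polynomial in the cut-off coordinates; \<open>kappa\<close> cuts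
  off its constant term.\<close>

lemma jet_matching:
  fixes f :: "'g \<Rightarrow> 'b::real_normed_vector"
  assumes f: "Ck_fun A 2 f"
  shows "\<exists>g. smooth g \<and> (\<forall>x. x \<notin> K1 \<longrightarrow> g x = 0) \<and> jet_zero (\<lambda>x. f x - g x)"
proof -
  define g1 where "g1 i = tran_d1 f i 0 p0" for i
  define g2 where "g2 i j = tran_d2 f i j 0 p0" for i j
  \<comment> \<open>The quadratic form in \<open>g\<close> sees only the symmetric part of
    \<open>g2\<close>; its second derivatives return \<open>g2\<close> because of this
    symmetry.\<close>
  have sym: "g2 i j = g2 j i" for i j
  proof -
    have "Ck_on 2 C0 (tran f 0)"
      using f chart0 by (auto simp: Ck_fun_def tran_def[abs_def] o_def)
    from second_derivative_symmetric[OF open_C0 p0_in this] show ?thesis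
      by (simp add: g2_def tran_d2_def tran_d1_def[abs_def])
  qed
  define g where "g x = kappa x *\<^sub>R f 0 + ((\<Sum>i<d. zeta i x *\<^sub>R g1 i) +
     (1/2) *\<^sub>R (\<Sum>i<d. \<Sum>j<d. (zeta i x * zeta j x) *\<^sub>R g2 i j))" for x
  have g: "smooth g"
    unfolding g_def
    by (intro smooth_add smooth_sum smooth_scaleR smooth_mult smooth_const smooth_kappa smooth_zeta)
  have out: "g x = 0" if "x \<notin> K1" for x
    using that by (simp add: g_def kappa_outside zeta_outside)
  define S where "S = {b. sqn (b - p0) < r0 / 2}"
  have S: "open S" "p0 \<in> S" unfolding S_def using r0(1) by (simp_all only: open_sqn_ball) simp
  have SC: "b \<in> C0" if "b \<in> S" for b using that ball_C0 by (simp add: S_def)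
  define q where "q b = f 0 + ((\<Sum>i<d. crd i (b - p0) *\<^sub>R g1 i) +
     (1/2) *\<^sub>R (\<Sum>i<d. \<Sum>j<d. (crd i (b - p0) * crd j (b - p0)) *\<^sub>R g2 i j))" for b
  have trq: "tran g 0 b = q b" if b: "b \<in> S" for b
  proof -
    obtain x where x: "x \<in> U0" "b = \<phi>0 x" using SC[OF b] by auto
    then have "x \<in> B1" using b by (simp add: B1_def S_def)
    then show ?thesis
      using x by (simp add: tran_phi g_def q_def kappa_B1 zeta_B1)
  qed
  have dq: "(q has_derivative (\<lambda>v. 0 + ((\<Sum>i<d. crd i v *\<^sub>R g1 i) + (1/2) *\<^sub>R (\<Sum>i<d. \<Sum>j<d.
      (crd i (b - p0) * crd j v + crd i v * crd j (b - p0)) *\<^sub>R g2 i j)))) (at b)" for b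
    unfolding q_def
    by (intro has_derivative_add has_derivative_const has_derivative_sum has_derivative_scaleR_left
        has_derivative_scaleR_right has_derivative_mult crd_has_derivative)
  have tr1g: "tran_d1 g k 0 b = g1 k + (\<Sum>j<d. crd j (b - p0) *\<^sub>R g2 k j)" if "b \<in> S" "k < d" for b k
  proof -
    have "(tran g 0 has_derivative (\<lambda>v. 0 + ((\<Sum>i<d. crd i v *\<^sub>R g1 i) + (1/2) *\<^sub>R (\<Sum>i<d. \<Sum>j<d.
      (crd i (b - p0) * crd j v + crd i v * crd j (b - p0)) *\<^sub>R g2 i j)))) (at b)"
      by (rule has_derivative_transform_within_open[OF dq S(1) that(1)]) (simp add: trq)
    from frechet_derivative_at[OF this, symmetric]
    have "tran_d1 g k 0 b = (\<Sum>i<d. crd i (w k) *\<^sub>R g1 i) + (1/2) *\<^sub>R (\<Sum>i<d. \<Sum>j<d.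
      (crd i (b - p0) * crd j (w k) + crd i (w k) * crd j (b - p0)) *\<^sub>R g2 i j)"
      by (simp add: tran_d1_def del: crd_simps)
    also have "(\<Sum>i<d. crd i (w k) *\<^sub>R g1 i) = g1 k" by (rule sum_crd_basis[OF that(2)])
    also have "(\<Sum>i<d. \<Sum>j<d. (crd i (b - p0) * crd j (w k) + crd i (w k) * crd j (b - p0)) *\<^sub>R g2 i j)
       = (\<Sum>i<d. crd i (b - p0) *\<^sub>R (\<Sum>j<d. crd j (w k) *\<^sub>R g2 i j)) +
         (\<Sum>i<d. crd i (w k) *\<^sub>R (\<Sum>j<d. crd j (b - p0) *\<^sub>R g2 i j))"
      by (simp add: scaleR_add_left sum.distrib scaleR_sum_right del: crd_simps)
    also have "\<dots> = 2 *\<^sub>R (\<Sum>j<d. crd j (b - p0) *\<^sub>R g2 k j)"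
      unfolding sum_crd_basis[OF that(2)] by (simp add: sym[of _ k] scaleR_2 del: crd_simps)
    finally show ?thesis by simp
  qed
  have tr2g: "tran_d2 g k l 0 p0 = g2 k l" if "k < d" "l < d" for k l
  proof -
    have "((\<lambda>b. g1 k + (\<Sum>j<d. crd j (b - p0) *\<^sub>R g2 k j)) has_derivative (\<lambda>v. 0 + (\<Sum>j<d. crd j v *\<^sub>R g2 k j))) (at p0)"
      by (intro has_derivative_add has_derivative_const has_derivative_sum has_derivative_scaleR_left crd_has_derivative)
    then have "(tran_d1 g k 0 has_derivative (\<lambda>v. 0 + (\<Sum>j<d. crd j v *\<^sub>R g2 k j))) (at p0)"
      by (rule has_derivative_transform_within_open[OF _ S]) (simp add: tr1g that)
    from frechet_derivative_at[OF this, symmetric] show ?thesis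
      using sum_crd_basis[OF that(2)] by (simp add: tran_d2_def)
  qed
  let ?h = "\<lambda>x. f x - g x"
  have g': "Ck_fun A 2 g" using g by (simp add: smooth_def)
  have tr1h: "tran_d1 ?h k 0 b = tran_d1 f k 0 b - tran_d1 g k 0 b" if "b \<in> C0" for k b
  proof -
    have "tran ?h 0 = (\<lambda>b. tran f 0 b - tran g 0 b)" by (simp add: tran_def fun_eq_iff)
    then show ?thesis
      using frechet_derivative_at[OF has_derivative_diff[OF tran_derivatives(1)[OF f that, of 0] tran_derivatives(1)[OF g' that, of 0]], symmetric]
      by (simp add: tran_d1_def)
  qed
  have tr2h: "tran_d2 ?h k l 0 p0 = tran_d2 f k l 0 p0 - tran_d2 g k l 0 p0" for k l
  proof -
    note D = has_derivative_diff[OF tran_derivatives(2)[OF f p0_in, of k 0] tran_derivatives(2)[OF g' p0_in, of k 0]]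
    have "(tran_d1 ?h k 0 has_derivative (\<lambda>v. frechet_derivative (tran_d1 f k 0) (at p0) v - frechet_derivative (tran_d1 g k 0) (at p0) v)) (at p0)"
      by (rule has_derivative_transform_within_open[OF D open_C0 p0_in]) (simp add: tr1h)
    from frechet_derivative_at[OF this, symmetric] show ?thesis by (simp add: tran_d2_def)
  qed
  have "g 0 = f 0"
    using kappa_B1[OF zero_in_B1] by (simp add: g_def)
  then have "jet_zero ?h"
    using tr1h[OF p0_in] tr2h tr2g tr1g[OF S(2)]
    by (simp add: jet_zero_def g1_def g2_def)
  then show ?thesis using g out by blast
qed

end

section \<open>Test functions, \<open>C\<^sub>b\<^sup>2\<close> and approximation\<close>

context lie_chart
begin

text \<open>The set \<open>S\<close> is there for the case \<open>- {0}\<close>: on test functions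
  supported away from the identity \<open>P\<close> is integration against the Levy measure.\<close>

definition csupp_in :: "'g set \<Rightarrow> ('g \<Rightarrow> 'b::real_normed_vector) \<Rightarrow> bool" where
  "csupp_in S f \<longleftrightarrow> smooth f \<and> (\<exists>K. compact K \<and> K \<subseteq> S \<and> (\<forall>x. x \<notin> K \<longrightarrow> f x = 0))"

lemma test_functions_eq: "test_functions A = {f. csupp_in UNIV f}"
  by (auto simp: test_functions_def csupp_in_def smooth_def supported_in_def)

lemma csupp_in_mono: "csupp_in S f \<Longrightarrow> S \<subseteq> T \<Longrightarrow> csupp_in T f"
  unfolding csupp_in_def by blast

lemma csupp_in_zeta: "csupp_in UNIV (zeta i)"
  using smooth_zeta compact_K1 zeta_outside by (auto simp: csupp_in_def)

lemma csupp_in_zeta_sq: "csupp_in UNIV (\<lambda>x. (zeta i x)\<^sup>2)"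
  unfolding csupp_in_def power2_eq_square using compact_K1
  by (auto intro!: smooth_mult smooth_zeta exI[of _ K1] simp: zeta_outside)

lemma csupp_in_scaleR: "csupp_in S r \<Longrightarrow> smooth f \<Longrightarrow> csupp_in S (\<lambda>x. r x *\<^sub>R f x)"
  unfolding csupp_in_def by (auto intro: smooth_scaleR)

lemma csupp_in_bounded_linear:
  assumes "bounded_linear L" "csupp_in S f" shows "csupp_in S (\<lambda>x. L (f x))"
proof -
  have "L 0 = 0" by (rule linear_0[OF bounded_linear.linear[OF assms(1)]])
  then show ?thesis using assms(2) unfolding csupp_in_def
    by (auto intro: smooth_bounded_linear[OF assms(1)])
qed

lemma csupp_in_continuous: "csupp_in S f \<Longrightarrow> continuous_on UNIV f"
  by (auto simp: csupp_in_def intro: smooth_continuous_on)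

lemma csupp_in_bounded:
  assumes "csupp_in S f" shows "\<exists>C\<ge>0. \<forall>x. norm (f x) \<le> C"
proof -
  obtain K where "compact K" "\<And>x. x \<notin> K \<Longrightarrow> f x = 0" using assms by (auto simp: csupp_in_def)
  from bounded_of_compact_support[OF csupp_in_continuous[OF assms] this] show ?thesis .
qed

lemma csupp_in_lfield: "csupp_in S f \<Longrightarrow> csupp_in S (lfield j f)"
  unfolding csupp_in_def
proof (elim conjE exE, intro conjI exI)
  fix K assume "smooth f" and K: "compact K" "K \<subseteq> S" "\<forall>x. x \<notin> K \<longrightarrow> f x = 0"
  then show "smooth (lfield j f)" by (intro smooth_lfield)
  show "compact K" "K \<subseteq> S" by fact+
  show "\<forall>x. x \<notin> K \<longrightarrow> lfield j f x = 0"
    using lfield_zero_outside[OF compact_imp_closed[OF K(1)], of f] K(3) by blast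
qed

lemma csupp_in_foldr_lfield:
  "csupp_in S f \<Longrightarrow> csupp_in S (foldr (\<lambda>j. lfield j ^^ \<alpha> j) xs f)"
proof (induction xs)
  case (Cons j xs)
  have "csupp_in S ((lfield j ^^ n) g)" if "csupp_in S g" for n g
    by (induction n) (use that csupp_in_lfield in auto)
  then show ?case using Cons by simp
qed simp

text \<open>\<open>lfield\<close> is additive only where the derivatives exist,
  \<open>frechet_derivative\<close> being arbitrary elsewhere; so the order of differentiability
  that is left has to be carried along the iteration.\<close>

lemma funpow_lfield_diff:
  assumes "n \<le> k" "Ck_fun A k f" "Ck_fun A k g"
  shows "(lfield j ^^ n) (\<lambda>x. f x - g x) = (\<lambda>x. (lfield j ^^ n) f x - (lfield j ^^ n) g x) \<and>
    Ck_fun A (k - n) ((lfield j ^^ n) f) \<and> Ck_fun A (k - n) ((lfield j ^^ n) g)"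
  using assms(1)
proof (induction n)
  case 0
  then show ?case using assms by simp
next
  case (Suc n)
  define F where "F = (lfield j ^^ n) f"
  define G where "G = (lfield j ^^ n) g"
  have FG: "(lfield j ^^ n) (\<lambda>x. f x - g x) = (\<lambda>x. F x - G x)" "Ck_fun A (k - n) F" "Ck_fun A (k - n) G"
    using Suc by (auto simp: F_def G_def)
  have kn: "k - n = Suc (k - Suc n)" using Suc.prems by simp
  have FG': "Ck_fun A (Suc (k - Suc n)) F" "Ck_fun A (Suc (k - Suc n)) G"
    using FG(2,3) by (simp_all only: kn)
  have "Ck_fun A (Suc 0) F" "Ck_fun A (Suc 0) G"
    using FG' Ck_fun_mono by (metis Suc_le_mono zero_le)+
  from lfield_diff[OF this] Ck_fun_lfield[OF FG'(1)] Ck_fun_lfield[OF FG'(2)]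
  show ?case by (simp add: FG(1) flip: F_def G_def)
qed

lemma foldr_lfield_diff:
  assumes "sum_list (map \<alpha> xs) \<le> k" "Ck_fun A k f" "Ck_fun A k g"
  shows "foldr (\<lambda>j. lfield j ^^ \<alpha> j) xs (\<lambda>x. f x - g x) =
      (\<lambda>x. foldr (\<lambda>j. lfield j ^^ \<alpha> j) xs f x - foldr (\<lambda>j. lfield j ^^ \<alpha> j) xs g x) \<and>
    Ck_fun A (k - sum_list (map \<alpha> xs)) (foldr (\<lambda>j. lfield j ^^ \<alpha> j) xs f) \<and>
    Ck_fun A (k - sum_list (map \<alpha> xs)) (foldr (\<lambda>j. lfield j ^^ \<alpha> j) xs g)"
  using assms(1)
proof (induction xs)
  case Nil
  then show ?case using assms by simp
next
  case (Cons j xs)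
  then have IH: "foldr (\<lambda>j. lfield j ^^ \<alpha> j) xs (\<lambda>x. f x - g x) =
      (\<lambda>x. foldr (\<lambda>j. lfield j ^^ \<alpha> j) xs f x - foldr (\<lambda>j. lfield j ^^ \<alpha> j) xs g x)"
    "Ck_fun A (k - sum_list (map \<alpha> xs)) (foldr (\<lambda>j. lfield j ^^ \<alpha> j) xs f)"
    "Ck_fun A (k - sum_list (map \<alpha> xs)) (foldr (\<lambda>j. lfield j ^^ \<alpha> j) xs g)"
    by auto
  have "\<alpha> j \<le> k - sum_list (map \<alpha> xs)" using Cons.prems by simp
  from funpow_lfield_diff[OF this IH(2,3), of j] show ?case
    by (simp add: IH(1) diff_diff_eq add.commute)
qed

lemma Xpow_lfield:
  assumes "\<And>j. j < d \<Longrightarrow> X j = lfield j"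
  shows "Xpow d X \<alpha> f = foldr (\<lambda>j. lfield j ^^ \<alpha> j) [0..<d] f"
  unfolding Xpow_def using assms by (intro foldr_cong) auto

lemma csupp_in_Cb2:
  fixes f :: "'g \<Rightarrow> 'b::real_normed_vector"
  assumes X: "\<And>j. j < d \<Longrightarrow> X j = lfield j" and f: "csupp_in UNIV f"
  shows "f \<in> Cb2 A d X"
proof -
  have "bounded (range (Xpow d X \<alpha> f))" for \<alpha>
    using csupp_in_bounded[OF csupp_in_foldr_lfield[OF f, of \<alpha> "[0..<d]"]]
    by (auto simp: Xpow_lfield[OF X] bounded_iff)
  moreover have "Ck_fun A 2 f" using f by (simp add: csupp_in_def smooth_def)
  ultimately show ?thesis by (simp add: Cb2_def)
qed

lemma Cb2_diff:
  fixes f g :: "'g \<Rightarrow> 'b::real_normed_vector"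
  assumes X: "\<And>j. j < d \<Longrightarrow> X j = lfield j" and f: "f \<in> Cb2 A d X" and g: "g \<in> Cb2 A d X"
  shows "(\<lambda>x. f x - g x) \<in> Cb2 A d X"
proof -
  have fg: "Ck_fun A 2 f" "Ck_fun A 2 g" using f g by (auto simp: Cb2_def)
  have "bounded (range (Xpow d X \<alpha> (\<lambda>x. f x - g x)))" if \<alpha>: "\<alpha> \<in> multi_indices d 2" for \<alpha>
  proof -
    have "sum_list (map \<alpha> [0..<d]) \<le> 2"
      using \<alpha> by (simp add: multi_indices_def interv_sum_list_conv_sum_set_nat atLeast0LessThan)
    from foldr_lfield_diff[OF this fg] have
      "Xpow d X \<alpha> (\<lambda>x. f x - g x) = (\<lambda>x. Xpow d X \<alpha> f x - Xpow d X \<alpha> g x)"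
      by (simp add: Xpow_lfield[OF X])
    moreover have "bounded (range (Xpow d X \<alpha> f))" "bounded (range (Xpow d X \<alpha> g))"
      using f g \<alpha> by (auto simp: Cb2_def)
    ultimately show ?thesis using bounded_minus_comp by auto
  qed
  then show ?thesis using Ck_fun_diff[OF fg] by (simp add: Cb2_def)
qed

lemma Cb2_continuous: "f \<in> Cb2 A d X \<Longrightarrow> continuous_on UNIV f"
  by (auto simp: Cb2_def intro: Ck_fun_continuous_on)

lemma Cb2_bounded:
  assumes "f \<in> Cb2 A d X" shows "bounded (range f)"
proof -
  have "Xpow d X (\<lambda>_. 0) f = f"
  proof -
    have "foldr (\<lambda>j. X j ^^ 0) xs f = f" for xs by (induction xs) auto
    then show ?thesis by (simp add: Xpow_def)
  qed
  moreover have "(\<lambda>_. 0) \<in> multi_indices d 2" by (simp add: multi_indices_def)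
  ultimately show ?thesis using assms by (force simp: Cb2_def)
qed

section \<open>Uniform approximation by test functions\<close>

lemma smooth_uniform_approx:
  fixes F :: "'g \<Rightarrow> real"
  assumes F: "continuous_on UNIV F" and K: "compact K" and "\<epsilon> > 0"
  shows "\<exists>p. smooth p \<and> (\<forall>x\<in>K. \<bar>F x - p x\<bar> < \<epsilon>)"
proof -
  interpret function_ring_on "{p. smooth p}" K
  proof
    show "\<exists>f\<in>{p. smooth p}. f x \<noteq> (f y :: real)" if "x \<noteq> y" for x y
    proof -
      have "open (- {y})" "x \<in> - {y}" using that by auto
      from cutoff_point[OF this] obtain \<eta> V L where \<eta>: "smooth \<eta>" "x \<in> V" "\<forall>x\<in>V. \<eta> x = (1::real)"
        "L \<subseteq> - {y}" "\<forall>x. x \<notin> L \<longrightarrow> \<eta> x = 0" by blast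
      then have "\<eta> x = 1" "\<eta> y = 0" by auto
      then show ?thesis using \<eta>(1) by (intro bexI[of _ \<eta>]) auto
    qed
  qed (auto intro: K smooth_add smooth_mult smooth_const continuous_on_subset[OF smooth_continuous_on])
  show ?thesis
    using Stone_Weierstrass_basic[OF continuous_on_subset[OF F] \<open>\<epsilon> > 0\<close>] by auto
qed

text \<open>The order of the quantifiers matters: one compact \<open>K'\<close> serves every
  \<epsilon>, so that \<open>flat_approx\<close> can bound the masses of \<open>K'\<close> before it
  fixes the precision. Approximants are multiplied by the cutoff \<eta>, which leaves
  \<open>F\<close> unchanged.\<close>

lemma csupp_uniform_approx:
  fixes F :: "'g \<Rightarrow> 'b::euclidean_space"
  assumes F: "continuous_on UNIV F" and K: "compact K" "K \<subseteq> O'" "\<And>x. x \<notin> K \<Longrightarrow> F x = 0" and "open O'"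
  shows "\<exists>K'. compact K' \<and> K' \<subseteq> O' \<and> (\<forall>\<epsilon>>0. \<exists>p. smooth p \<and>
    (\<forall>x. x \<notin> K' \<longrightarrow> F x = 0 \<and> p x = 0) \<and> (\<forall>x. norm (F x - p x) \<le> \<epsilon>))"
proof -
  obtain \<eta> V K' where \<eta>: "smooth \<eta>" "\<And>x. 0 \<le> \<eta> x" "\<And>x. \<eta> x \<le> (1::real)"
    and V: "open V" "K \<subseteq> V" "\<And>x. x \<in> V \<Longrightarrow> \<eta> x = 1"
    and K': "compact K'" "K' \<subseteq> O'" "\<And>x. x \<notin> K' \<Longrightarrow> \<eta> x = 0"
    by (rule cutoff[OF \<open>open O'\<close> K(1,2)]) (rule that)
  have F\<eta>: "F x = \<eta> x *\<^sub>R F x" for x using K(3) V(2,3) by (cases "x \<in> K") auto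
  have "\<exists>p. smooth p \<and> (\<forall>x. x \<notin> K' \<longrightarrow> F x = 0 \<and> p x = 0) \<and> (\<forall>x. norm (F x - p x) \<le> \<epsilon>)"
    if "\<epsilon> > 0" for \<epsilon> :: real
  proof -
    define \<delta> where "\<delta> = \<epsilon> / real DIM('b)"
    have \<delta>: "\<delta> > 0" using that by (simp add: \<delta>_def)
    have "\<exists>q. smooth q \<and> (\<forall>x\<in>K'. \<bar>F x \<bullet> b - q x\<bar> < \<delta>)" for b
      by (rule smooth_uniform_approx[OF _ K'(1) \<delta>]) (intro continuous_intros F)
    then obtain q where q: "\<And>b. smooth (q b)" "\<And>b x. x \<in> K' \<Longrightarrow> \<bar>F x \<bullet> b - q b x\<bar> < \<delta>" by metis
    define p where "p x = \<eta> x *\<^sub>R (\<Sum>b\<in>Basis. q b x *\<^sub>R b)" for x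
    have "smooth p" unfolding p_def by (intro smooth_scaleR smooth_sum smooth_const q \<eta>)
    moreover have zero: "F x = 0" "p x = 0" if "x \<notin> K'" for x
      using F\<eta>[of x] K'(3)[OF that] by (simp_all add: p_def)
    moreover have "norm (F x - p x) \<le> \<epsilon>" for x
    proof (cases "x \<in> K'")
      case True
      have e: "F x = \<eta> x *\<^sub>R (\<Sum>b\<in>Basis. (F x \<bullet> b) *\<^sub>R b)"
        by (simp add: euclidean_representation F\<eta>[symmetric])
      have "F x - p x = \<eta> x *\<^sub>R (\<Sum>b\<in>Basis. (F x \<bullet> b - q b x) *\<^sub>R b)"
        by (subst e) (simp add: p_def scaleR_diff_right scaleR_diff_left sum_subtractf)
      then have "norm (F x - p x) \<le> norm (\<Sum>b\<in>Basis. (F x \<bullet> b - q b x) *\<^sub>R b)"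
        using \<eta>(2,3)[of x] by (simp add: mult_left_le_one_le)
      also have "\<dots> \<le> (\<Sum>b\<in>(Basis :: 'b set). \<delta>)"
        by (rule order_trans[OF norm_sum], rule sum_mono) (use q(2)[OF True] in \<open>auto dest: less_imp_le\<close>)
      also have "\<dots> = \<epsilon>" by (simp add: \<delta>_def)
      finally show ?thesis .
    next
      case False
      then show ?thesis using zero[OF False] that by simp
    qed
    ultimately show ?thesis by blast
  qed
  then show ?thesis using K'(1,2) by blast
qed

text \<open>Second countability enters here: by Lindelof, countably many open sets with compact
  neighbours in \<open>O'\<close> cover it, and \<open>L n\<close> is the union of the compact sets
  that belong to those with number at most \<open>n\<close>.\<close>

lemma exhausting_cutoffs:
  fixes O' :: "'g set"
  assumes "open O'"
  shows "\<exists>\<eta> L. (\<forall>n::nat. csupp_in O' (\<eta> n) \<and> (\<forall>x. 0 \<le> \<eta> n x \<and> \<eta> n x \<le> (1::real)) \<and>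
      compact (L n) \<and> L n \<subseteq> O' \<and> (\<forall>x\<in>L n. \<eta> n x = 1)) \<and>
    incseq L \<and> (\<Union>n. L n) = O'"
proof -
  have "\<forall>x\<in>O'. \<exists>V K. open V \<and> x \<in> V \<and> V \<subseteq> K \<and> compact K \<and> K \<subseteq> O'"
  proof
    fix x assume "x \<in> O'"
    from cutoff_point[OF assms this] obtain \<eta> V K where
      *: "open V" "x \<in> V" "\<forall>x\<in>V. \<eta> x = (1::real)" "compact K" "K \<subseteq> O'" "\<forall>x. x \<notin> K \<longrightarrow> \<eta> x = 0" by blast
    have "V \<subseteq> K"
    proof
      fix y assume "y \<in> V"
      then show "y \<in> K" using *(3,6) by (cases "y \<in> K") auto
    qed
    then show "\<exists>V K. open V \<and> x \<in> V \<and> V \<subseteq> K \<and> compact K \<and> K \<subseteq> O'" using * by blast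
  qed
  then obtain V K where VK: "\<And>x. x \<in> O' \<Longrightarrow> open (V x) \<and> x \<in> V x \<and> V x \<subseteq> K x \<and> compact (K x) \<and> K x \<subseteq> O'"
    by metis
  obtain F where F: "F \<subseteq> V ` O'" "countable F" "\<Union>F = \<Union>(V ` O')"
    by (rule Lindelof_openin[of "V ` O'" UNIV]) (use VK in auto)
  obtain D where D: "D \<subseteq> O'" "countable D" "F = V ` D"
    using F(1,2) by (metis countable_subset_image)
  have cov: "O' \<subseteq> (\<Union>x\<in>D. V x)"
  proof
    fix y assume "y \<in> O'"
    then have "y \<in> \<Union>(V ` O')" using VK by (intro UnionI[of "V y"]) auto
    then show "y \<in> (\<Union>x\<in>D. V x)" unfolding F(3)[symmetric] D(3) .
  qed
  define L where "L n = (\<Union>x\<in>{x\<in>D. to_nat_on D x \<le> n}. K x)" for n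
  have fin: "finite {x\<in>D. to_nat_on D x \<le> n}" for n
  proof (rule finite_imageD)
    show "finite (to_nat_on D ` {x\<in>D. to_nat_on D x \<le> n})"
      by (rule finite_subset[of _ "{..n}"]) auto
    show "inj_on (to_nat_on D) {x\<in>D. to_nat_on D x \<le> n}"
      by (rule inj_on_subset[OF inj_on_to_nat_on[OF D(2)]]) auto
  qed
  have L: "compact (L n)" "L n \<subseteq> O'" for n
    using fin D VK unfolding L_def by (auto intro!: compact_UN)
  have "incseq L" unfolding incseq_def L_def by force
  moreover have "(\<Union>n. L n) = O'"
  proof
    show "(\<Union>n. L n) \<subseteq> O'" using L by blast
    show "O' \<subseteq> (\<Union>n. L n)"
    proof
      fix y assume "y \<in> O'"
      then obtain x where "x \<in> D" "y \<in> V x" using cov by blast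
      moreover have "V x \<subseteq> K x" using VK D(1) \<open>x \<in> D\<close> by blast
      ultimately have "y \<in> L (to_nat_on D x)" by (auto simp: L_def)
      then show "y \<in> (\<Union>n. L n)" by blast
    qed
  qed
  moreover have "\<exists>\<eta>. csupp_in O' \<eta> \<and> (\<forall>x. 0 \<le> \<eta> x \<and> \<eta> x \<le> (1::real)) \<and> (\<forall>x\<in>L n. \<eta> x = 1)" for n
  proof -
    obtain \<eta> V K' where \<eta>: "smooth \<eta>" "\<And>x. 0 \<le> \<eta> x" "\<And>x. \<eta> x \<le> (1::real)"
      and V: "open V" "L n \<subseteq> V" "\<And>x. x \<in> V \<Longrightarrow> \<eta> x = 1"
      and K': "compact K'" "K' \<subseteq> O'" "\<And>x. x \<notin> K' \<Longrightarrow> \<eta> x = 0"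
      by (rule cutoff[OF assms L]) (rule that)
    then show ?thesis by (intro exI[of _ \<eta>]) (auto simp: csupp_in_def)
  qed
  then obtain \<eta> where "\<And>n. csupp_in O' (\<eta> n) \<and> (\<forall>x. 0 \<le> \<eta> n x \<and> \<eta> n x \<le> (1::real)) \<and> (\<forall>x\<in>L n. \<eta> n x = 1)"
    by metis
  ultimately show ?thesis using L by (intro exI[of _ \<eta>] exI[of _ L]) simp
qed

end

section \<open>Convolution semigroups\<close>

text \<open>Such functions are integrable against every measure of a semigroup, and the class is
  closed under translations and under the averages
  \<open>E t (\<lambda>y. f (x + y))\<close>.\<close>

definition bmeas :: "('g::topological_space \<Rightarrow> 'b::{banach, second_countable_topology}) \<Rightarrow> bool" where
  "bmeas f \<longleftrightarrow> f \<in> borel_measurable borel \<and> bounded (range f)"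

lemma bmeasI: "f \<in> borel_measurable borel \<Longrightarrow> (\<And>x. norm (f x) \<le> C) \<Longrightarrow> bmeas f"
  by (auto simp: bmeas_def bounded_iff)

lemma bmeas_bound: "bmeas f \<Longrightarrow> \<exists>C\<ge>0. \<forall>x. norm (f x) \<le> C"
  unfolding bmeas_def bounded_iff by (metis norm_ge_zero order_trans rangeI)

lemma bmeas_const [simp]: "bmeas (\<lambda>_. c)"
  by (rule bmeasI) auto

lemma bmeas_indicator [simp]: "B \<in> sets borel \<Longrightarrow> bmeas (indicator B :: _ \<Rightarrow> real)"
  by (rule bmeasI[where C = 1]) (auto simp: indicator_def)

lemma bmeas_add: "bmeas f \<Longrightarrow> bmeas g \<Longrightarrow> bmeas (\<lambda>x. f x + g x)"
  by (auto simp: bmeas_def intro: bounded_plus_comp)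

lemma bmeas_diff: "bmeas f \<Longrightarrow> bmeas g \<Longrightarrow> bmeas (\<lambda>x. f x - g x)"
  by (auto simp: bmeas_def intro: bounded_minus_comp)

lemma bmeas_bounded_linear:
  assumes L: "bounded_linear L" and "bmeas f" shows "bmeas (\<lambda>x. L (f x))"
proof -
  have "bounded (L ` range f)"
    using assms(2) by (intro bounded_linear_image L) (simp add: bmeas_def)
  moreover have "L \<in> borel_measurable borel"
    by (intro borel_measurable_continuous_onI linear_continuous_on L)
  ultimately show ?thesis using assms(2) by (auto simp: bmeas_def image_image)
qed

lemma bmeas_scaleR_right: "bmeas f \<Longrightarrow> bmeas (\<lambda>x. c *\<^sub>R f x)"
  by (rule bmeas_bounded_linear[OF bounded_linear_scaleR_right])

lemma bmeas_scaleR: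
  fixes r :: "'g::topological_space \<Rightarrow> real"
  assumes "bmeas r" "bmeas f" shows "bmeas (\<lambda>x. r x *\<^sub>R f x)"
proof -
  obtain C D where "C \<ge> 0" "\<And>x. norm (r x) \<le> C" "\<And>x. norm (f x) \<le> D"
    using bmeas_bound[OF assms(1)] bmeas_bound[OF assms(2)] by metis
  then show ?thesis
    using assms by (intro bmeasI[of _ "C * D"]) (auto simp: bmeas_def intro!: mult_mono)
qed

lemma bmeas_norm: "bmeas f \<Longrightarrow> bmeas (\<lambda>x. norm (f x))"
  by (auto simp: bmeas_def bounded_norm_comp)

lemma bmeas_sum: "(\<And>i. i \<in> I \<Longrightarrow> bmeas (f i)) \<Longrightarrow> bmeas (\<lambda>x. \<Sum>i\<in>I. f i x)"
  by (induction I rule: infinite_finite_induct) (auto intro: bmeas_add)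

lemma bmeas_continuous:
  "continuous_on UNIV f \<Longrightarrow> bounded (range f) \<Longrightarrow> bmeas f"
  by (simp add: bmeas_def borel_measurable_continuous_onI)

lemma bmeas_translate:
  fixes f :: "'g::{topological_group_add, second_countable_topology} \<Rightarrow> _"
  assumes "bmeas f" shows "bmeas (\<lambda>y. f (x + y))"
proof -
  have "(\<lambda>y. x + y) \<in> borel_measurable borel"
    by (intro borel_measurable_continuous_onI continuous_intros)
  then show ?thesis using assms by (auto simp: bmeas_def intro: measurable_compose bounded_subset)
qed

locale conv_semigroup =
  fixes \<mu> :: "real \<Rightarrow> 'g::{topological_group_add, t2_space, second_countable_topology} measure"
  assumes sets_mu: "\<And>t. t > 0 \<Longrightarrow> sets (\<mu> t) = sets borel"
    and subprob_mu: "\<And>t. t > 0 \<Longrightarrow> subprob_space (\<mu> t)"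
    and conv_mu: "\<And>s t. s > 0 \<Longrightarrow> t > 0 \<Longrightarrow> distr (\<mu> s \<Otimes>\<^sub>M \<mu> t) borel (\<lambda>(x, y). x + y) = \<mu> (s + t)"
    and continuous_mu: "\<And>f::'g \<Rightarrow> real. continuous_on UNIV f \<Longrightarrow> bounded (range f) \<Longrightarrow>
      ((\<lambda>t. \<integral>x. f x \<partial>\<mu> t) \<longlongrightarrow> f 0) (at_right 0)"
begin

text \<open>\<open>\<mu> 0\<close> is arbitrary, hence the case distinction.\<close>
definition M :: "real \<Rightarrow> 'g measure" where "M t = (if t > 0 then \<mu> t else return borel 0)"

abbreviation E :: "real \<Rightarrow> ('g \<Rightarrow> 'b::{banach, second_countable_topology}) \<Rightarrow> 'b" where
  "E t f \<equiv> \<integral>x. f x \<partial>M t"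

lemma sets_M [measurable_cong, simp]: "sets (M t) = sets borel"
  by (simp add: M_def sets_mu)

lemma space_M [simp]: "space (M t) = UNIV"
  using sets_eq_imp_space_eq[OF sets_M] by simp

lemma subprob_M: "subprob_space (M t)"
  using subprob_mu[of t] prob_space_return[of 0 "borel :: 'g measure"]
  by (auto simp: M_def intro: prob_space_imp_subprob_space)

sublocale subprob_space "M t" for t by (rule subprob_M)

lemma borel_measurable_M: "bmeas f \<Longrightarrow> f \<in> borel_measurable (M t)"
  unfolding bmeas_def using measurable_cong_sets[OF sets_M refl] by blast

lemma integrable_M:
  assumes "bmeas f" shows "integrable (M t) f"
proof -
  obtain C where "\<And>x. norm (f x) \<le> C" using bmeas_bound[OF assms] by blast
  then show ?thesis by (intro integrable_const_bound[where B = C] borel_measurable_M assms) auto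
qed

lemma E_0: "bmeas f \<Longrightarrow> E 0 f = f 0"
  by (simp add: M_def integral_return bmeas_def)

lemma measure_le_1: "measure (M t) B \<le> 1"
  by (rule subprob_measure_le_1)

lemma E_mono:
  fixes f g :: "'g \<Rightarrow> real"
  shows "bmeas f \<Longrightarrow> bmeas g \<Longrightarrow> (\<And>x. f x \<le> g x) \<Longrightarrow> E t f \<le> E t g"
  by (intro integral_mono integrable_M)

lemma E_norm_le:
  assumes "bmeas g" "\<And>x. norm (f x) \<le> g x" shows "norm (E t f) \<le> E t g"
proof (cases "f \<in> borel_measurable borel")
  case True
  obtain C where "\<And>x. norm (g x) \<le> C" using bmeas_bound[OF assms(1)] by blast
  then have "norm (f x) \<le> C" for x using assms(2)[of x] by (smt (verit) real_norm_def)
  then have "bmeas f" by (intro bmeasI True)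
  then have "norm (E t f) \<le> E t (\<lambda>x. norm (f x))"
    by (intro integral_norm_bound)
  also have "\<dots> \<le> E t g"
    using \<open>bmeas f\<close> assms by (intro E_mono bmeas_norm)
  finally show ?thesis .
next
  \<comment> \<open>A non-measurable \<open>f\<close> has the integral \<open>0\<close> by
    convention, so the bound holds trivially and callers need not show measurability of
    \<open>f\<close>.\<close>
  case False
  then have "\<not> integrable (M t) f" using borel_measurable_integrable by fastforce
  then have "E t f = 0" by (rule not_integrable_integral_eq)
  moreover have "0 \<le> E t g" using assms(2) by (intro Bochner_Integration.integral_nonneg) (meson norm_ge_zero order_trans)
  ultimately show ?thesis by simp
qed

lemma E_norm_const:
  assumes "\<And>x. norm (f x) \<le> C" shows "norm (E t f) \<le> C"
proof -
  have "0 \<le> C" using assms[of 0] norm_ge_zero order_trans by blast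
  have "norm (E t f) \<le> E t (\<lambda>_. C)" by (rule E_norm_le) (auto simp: assms)
  also have "\<dots> \<le> 1 * C" using \<open>0 \<le> C\<close> using mult_right_mono[OF measure_le_1 \<open>0 \<le> C\<close>, of t UNIV] by simp
  finally show ?thesis by simp
qed

lemma measurable_translate_pair:
  assumes "bmeas f" shows "(\<lambda>(x, y). f (x + y)) \<in> borel_measurable (borel \<Otimes>\<^sub>M borel :: ('g \<times> 'g) measure)"
proof -
  have "(\<lambda>(x, y). x + y :: 'g) \<in> borel_measurable (borel \<Otimes>\<^sub>M borel)" by measurable
  then show ?thesis using assms
    by (auto simp: bmeas_def split_beta intro: measurable_compose)
qed

lemma bmeas_E_translate:
  assumes "bmeas f" shows "bmeas (\<lambda>x. E t (\<lambda>y. f (x + y)))"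
proof -
  obtain C where "\<And>x. norm (f x) \<le> C" using bmeas_bound[OF assms] by blast
  moreover have "(\<lambda>x. E t (\<lambda>y. f (x + y))) \<in> borel_measurable borel"
    by (rule borel_measurable_lebesgue_integral) (use measurable_translate_pair[OF assms] in simp)
  ultimately show ?thesis by (intro bmeasI E_norm_const) auto
qed

text \<open>Here \<open>x\<close> is the position after time \<open>s\<close> and \<open>y\<close>
  the increment after that. The order matters in a noncommutative group, and it fits the
  left-invariant fields, which differentiate in the right-hand summand.\<close>

lemma E_conv:
  assumes f: "bmeas f" and "s \<ge> 0" "t \<ge> 0"
  shows "E (s + t) f = E s (\<lambda>x. E t (\<lambda>y. f (x + y)))"
proof -
  consider "s = 0" | "t = 0" | "s > 0" "t > 0" using assms by linarith
  then show ?thesis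
  proof cases
    case 1
    then show ?thesis using E_0[OF bmeas_E_translate[OF f, of t]] by simp
  next
    case 2
    then show ?thesis using E_0[OF bmeas_translate[OF f]] by simp
  next
    case 3
    have M: "M s = \<mu> s" "M t = \<mu> t" "M (s + t) = \<mu> (s + t)" using 3 by (auto simp: M_def)
    interpret pair_sigma_finite "M s" "M t" ..
    interpret P: finite_measure "M s \<Otimes>\<^sub>M M t"
      by (rule finite_measure_pair_measure) unfold_locales
    have meas: "(\<lambda>(x, y). f (x + y)) \<in> borel_measurable (M s \<Otimes>\<^sub>M M t)"
      using measurable_translate_pair[OF f] by simp
    obtain C where C: "\<And>x. norm (f x) \<le> C" using bmeas_bound[OF f] by blast
    have int: "integrable (M s \<Otimes>\<^sub>M M t) (\<lambda>(x, y). f (x + y))"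
      by (rule P.integrable_const_bound[where B = C]) (auto simp: C meas)
    have "E (s + t) f = integral\<^sup>L (distr (M s \<Otimes>\<^sub>M M t) borel (\<lambda>(x, y). x + y)) f"
      using conv_mu[OF 3] by (simp add: M)
    also have "\<dots> = (\<integral>z. f ((\<lambda>(x, y). x + y) z) \<partial>(M s \<Otimes>\<^sub>M M t))"
      using f by (intro integral_distr) (auto simp: bmeas_def)
    also have "\<dots> = (\<integral>(x, y). f (x + y) \<partial>(M s \<Otimes>\<^sub>M M t))"
      by (rule Bochner_Integration.integral_cong) auto
    also have "\<dots> = E s (\<lambda>x. E t (\<lambda>y. f (x + y)))"
      using integral_fst[OF int] by simp
    finally show ?thesis .
  qed
qed

lemma E_indicator: "B \<in> sets borel \<Longrightarrow> E t (indicator B :: _ \<Rightarrow> real) = measure (M t) B"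
  by simp

lemma mass_add: "s \<ge> 0 \<Longrightarrow> t \<ge> 0 \<Longrightarrow> measure (M (s + t)) UNIV = measure (M s) UNIV * measure (M t) UNIV"
  using E_conv[of "\<lambda>_. 1 :: real" s t] by simp

lemma mass_mult: "s \<ge> 0 \<Longrightarrow> measure (M (real N * s)) UNIV = measure (M s) UNIV ^ N"
proof (induction N)
  case 0
  then show ?case using E_0[of "\<lambda>_. 1 :: real"] by simp
next
  case (Suc N)
  have "measure (M (s + real N * s)) UNIV = measure (M s) UNIV * measure (M (real N * s)) UNIV"
    using Suc by (intro mass_add) auto
  then show ?case using Suc by (simp add: algebra_simps)
qed

lemma E_tendsto_0:
  fixes f :: "'g \<Rightarrow> real"
  assumes "continuous_on UNIV f" "bounded (range f)"
  shows "((\<lambda>t. E t f) \<longlongrightarrow> f 0) (at_right 0)"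
  by (rule Lim_transform_eventually[OF continuous_mu[OF assms]])
    (auto simp: eventually_at_right_less M_def intro!: eventually_mono[OF eventually_at_right_less[of 0]])

text \<open>The extra time is put last: the inner integral then converges pointwise by continuity at
  time zero, and dominated convergence under \<open>M r\<close> does the rest.\<close>

lemma E_right_continuous:
  fixes f :: "'g \<Rightarrow> real"
  assumes f: "continuous_on UNIV f" "bounded (range f)" and r: "r \<ge> 0"
    and s: "\<And>n::nat. s n > 0" "s \<longlonglongrightarrow> 0"
  shows "(\<lambda>n. E (r + s n) f) \<longlonglongrightarrow> E r f"
proof -
  have bf: "bmeas f" by (rule bmeas_continuous[OF f])
  obtain C where C: "\<And>x. norm (f x) \<le> C" using bmeas_bound[OF bf] by blast
  have s0: "filterlim s (at_right 0) sequentially"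
    using s by (auto simp: filterlim_at order_less_imp_not_eq2 intro!: always_eventually)
  have "(\<lambda>n. E r (\<lambda>x. E (s n) (\<lambda>y. f (x + y)))) \<longlonglongrightarrow> E r f"
  proof (rule integral_dominated_convergence[where w = "\<lambda>_. C"])
    show "f \<in> borel_measurable (M r)" using bf by (rule borel_measurable_M)
    show "(\<lambda>x. E (s n) (\<lambda>y. f (x + y))) \<in> borel_measurable (M r)" for n
      by (rule borel_measurable_M[OF bmeas_E_translate[OF bf]])
    show "AE x in M r. (\<lambda>n. E (s n) (\<lambda>y. f (x + y))) \<longlonglongrightarrow> f x"
    proof (rule AE_I2)
      fix x
      have "((\<lambda>t. E t (\<lambda>y. f (x + y))) \<longlongrightarrow> f (x + 0)) (at_right 0)"
      proof (rule E_tendsto_0)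
        show "continuous_on UNIV (\<lambda>y. f (x + y))"
          by (intro continuous_on_compose2[OF f(1)] continuous_intros) auto
        show "bounded (range (\<lambda>y. f (x + y)))" using C by (auto simp: bounded_iff)
      qed
      from filterlim_compose[OF this s0] show "(\<lambda>n. E (s n) (\<lambda>y. f (x + y))) \<longlonglongrightarrow> f x" by simp
    qed
    show "AE x in M r. norm (E (s n) (\<lambda>y. f (x + y))) \<le> C" for n
      using C by (intro AE_I2 E_norm_const)
  qed simp
  moreover have "E (r + s n) f = E r (\<lambda>x. E (s n) (\<lambda>y. f (x + y)))" for n
    using r s(1)[of n] by (intro E_conv bf) auto
  ultimately show ?thesis by simp
qed

text \<open>Needed for averages over time. Right continuity suffices, since it makes the function a
  pointwise limit of functions that are constant on grid intervals; \<open>max 0\<close> keeps the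
  times in the range where the semigroup law holds.\<close>

lemma E_measurable_time:
  fixes f :: "'g \<Rightarrow> real"
  assumes f: "continuous_on UNIV f" "bounded (range f)"
  shows "(\<lambda>t. E (max 0 t) f) \<in> borel_measurable borel"
proof (rule borel_measurable_LIMSEQ_real)
  \<comment> \<open>The first point of the grid of mesh \<open>1 / Suc n\<close> strictly to the
    right of \<open>t\<close>, because right continuity only speaks about approach from that
    side.\<close>
  define a where "a n t = (real_of_int \<lfloor>real (Suc n) * t\<rfloor> + 1) / real (Suc n)" for n t
  have a: "0 < a n t - t" "a n t - t \<le> 1 / real (Suc n)" for n t
  proof -
    have "real (Suc n) * t < real_of_int \<lfloor>real (Suc n) * t\<rfloor> + 1" by linarith
    then have "t < a n t" unfolding a_def by (simp add: pos_less_divide_eq mult.commute del: of_nat_Suc)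
    then show "0 < a n t - t" by simp
    have "real_of_int \<lfloor>real (Suc n) * t\<rfloor> \<le> real (Suc n) * t" by linarith
    then have "a n t \<le> (real (Suc n) * t + 1) / real (Suc n)"
      unfolding a_def by (intro divide_right_mono) auto
    also have "\<dots> = t + 1 / real (Suc n)" by (simp add: add_divide_distrib del: of_nat_Suc)
    finally show "a n t - t \<le> 1 / real (Suc n)" by simp
  qed
  let ?G = "\<lambda>t. E (max 0 t) f"
  show "(\<lambda>t. ?G (a n t)) \<in> borel_measurable borel" for n
  proof -
    have "(\<lambda>k::int. ?G ((real_of_int k + 1) / real (Suc n))) \<in> measurable (count_space UNIV) borel" by simp
    moreover have "(\<lambda>t. \<lfloor>real (Suc n) * t\<rfloor>) \<in> measurable borel (count_space UNIV)" by measurable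
    ultimately show ?thesis unfolding a_def by (rule measurable_compose[rotated])
  qed
  show "(\<lambda>n. ?G (a n t)) \<longlonglongrightarrow> ?G t" for t
  proof -
    have lim: "(\<lambda>n. a n t - t) \<longlonglongrightarrow> 0"
    proof (rule Lim_null_comparison[OF _ LIMSEQ_inverse_real_of_nat])
      show "\<forall>\<^sub>F n in sequentially. norm (a n t - t) \<le> inverse (real (Suc n))"
        using a(1,2)[of _ t] by (intro always_eventually) (auto simp: inverse_eq_divide abs_of_pos less_imp_le simp del: of_nat_Suc)
    qed
    show ?thesis
    proof (cases "t \<ge> 0")
      case True
      have "max 0 (a n t) = t + (a n t - t)" for n using a(1)[of n t] True by simp
      then show ?thesis using E_right_continuous[OF f True a(1) lim] True by simp
    next
      case False
      have "(\<lambda>n. (a n t - t) + t) \<longlonglongrightarrow> 0 + t" by (intro tendsto_add lim tendsto_const)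
      then have "\<forall>\<^sub>F n in sequentially. a n t < 0"
        using False by (intro order_tendstoD(2)) auto
      then show ?thesis using False
        by (intro tendsto_eventually) (auto elim!: eventually_mono simp: max_def)
    qed
  qed
qed

lemma E_add: "bmeas f \<Longrightarrow> bmeas g \<Longrightarrow> E t (\<lambda>x. f x + g x) = E t f + E t g"
  by (intro Bochner_Integration.integral_add integrable_M)

lemma E_diff: "bmeas f \<Longrightarrow> bmeas g \<Longrightarrow> E t (\<lambda>x. f x - g x) = E t f - E t g"
  by (intro Bochner_Integration.integral_diff integrable_M)

lemma E_sum: "(\<And>i. i \<in> I \<Longrightarrow> bmeas (f i)) \<Longrightarrow> E t (\<lambda>x. \<Sum>i\<in>I. f i x) = (\<Sum>i\<in>I. E t (f i))"
  by (intro Bochner_Integration.integral_sum integrable_M)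

lemma E_bounded_linear: "bounded_linear L \<Longrightarrow> bmeas f \<Longrightarrow> E t (\<lambda>x. L (f x)) = L (E t f)"
  by (intro integral_bounded_linear integrable_M)

lemma measure_complement: "B \<in> sets borel \<Longrightarrow> measure (M t) (- B) = measure (M t) UNIV - measure (M t) B"
  using finite_measure_compl[of B t] by (simp add: Compl_eq_Diff_UNIV)

lemma conv_lower:
  assumes B: "A \<in> sets borel" "B \<in> sets borel" "V \<in> sets borel"
    and xy: "\<And>x y. x \<in> B \<Longrightarrow> y \<in> V \<Longrightarrow> x + y \<in> A" and st: "s \<ge> 0" "t \<ge> 0"
  shows "measure (M s) B * measure (M t) V \<le> measure (M (s + t)) A"
proof -
  have "measure (M (s + t)) A = E s (\<lambda>x. E t (\<lambda>y. indicator A (x + y)))"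
    using E_conv[OF bmeas_indicator[OF B(1)] st] by (simp add: E_indicator B)
  also have "\<dots> \<ge> E s (\<lambda>x. measure (M t) V *\<^sub>R indicator B x)"
  proof (rule E_mono)
    show "bmeas (\<lambda>x. measure (M t) V *\<^sub>R indicator B x :: real)" by (intro bmeas_scaleR_right bmeas_indicator B)
    show "bmeas (\<lambda>x. E t (\<lambda>y. indicator A (x + y) :: real))" by (intro bmeas_E_translate bmeas_indicator B)
    show "measure (M t) V *\<^sub>R indicator B x \<le> E t (\<lambda>y. indicator A (x + y) :: real)" for x
    proof (cases "x \<in> B")
      case True
      have "E t (indicator V :: _ \<Rightarrow> real) \<le> E t (\<lambda>y. indicator A (x + y) :: real)"
        using xy[OF True] by (intro E_mono bmeas_translate bmeas_indicator B) (auto simp: indicator_def)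
      then show ?thesis using True B by simp
    qed simp
  qed
  finally show ?thesis using B by (simp add: mult.commute)
qed

text \<open>
  One big jump: consider a random walk whose steps have the law \<open>M s\<close>. If it is in \<open>K\<close> just before a step
  outside \<open>W\<close> and the later steps add up to an element of \<open>K\<close>, then it ends outside \<open>K\<close>. The quadratic
  term accounts for paths with two such steps, which are counted twice.
\<close>

lemma big_jump_aux:
  assumes K: "K \<in> sets borel" "W \<in> sets borel" "0 \<in> K" "s \<ge> 0" "c \<ge> 0"
    and W: "\<And>x y z. x \<in> K \<Longrightarrow> z \<in> K \<Longrightarrow> x + y + z \<in> K \<Longrightarrow> y \<in> W"
    and c: "\<And>k. k < N \<Longrightarrow> c \<le> measure (M (real k * s)) K"
  defines "q \<equiv> measure (M s) (- W)"
  shows "q * c * (real N * c) - q\<^sup>2 * c * (real N)\<^sup>2 / 2 \<le> measure (M (real N * s)) (- K)"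
proof -
  \<comment> \<open>Probabilities for the walk started at \<open>x\<close>: to be outside
    \<open>K\<close>, or inside \<open>K\<close>, after \<open>k\<close> steps.\<close>
  define u where "u k x = E (real k * s) (\<lambda>y. indicator (- K) (x + y) :: real)" for k x
  define p where "p k x = E (real k * s) (\<lambda>y. indicator K (x + y) :: real)" for k x
  note meas = K(1,2) borel_comp[OF K(1)] borel_comp[OF K(2)]
  have bu: "bmeas (u k)" and bp: "bmeas (p k)" for k
    unfolding u_def[abs_def] p_def[abs_def] using meas by (intro bmeas_E_translate bmeas_indicator; simp)+
  have rec: "E (real (Suc k) * s) (\<lambda>y. f (x + y)) = E s (\<lambda>y. E (real k * s) (\<lambda>z. f (x + y + z)))"
    if "bmeas f" for f :: "'g \<Rightarrow> real" and k x
    using E_conv[OF bmeas_translate[OF that, of x] \<open>s \<ge> 0\<close>, of "real k * s"] \<open>s \<ge> 0\<close>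
    by (simp add: algebra_simps)
  have urec: "u (Suc k) x = E s (\<lambda>y. u k (x + y))" and prec: "p (Suc k) x = E s (\<lambda>y. p k (x + y))" for k x
    unfolding u_def p_def using meas by (intro rec bmeas_indicator; simp)+
  have p0: "p 0 x = indicator K x" for x
    unfolding p_def using E_0[OF bmeas_translate[OF bmeas_indicator[OF K(1)], of x]] by simp
  have p01: "0 \<le> p k x" "p k x \<le> 1" for k x
  proof -
    show "0 \<le> p k x" unfolding p_def by (intro Bochner_Integration.integral_nonneg) simp
    have "norm (p k x) \<le> 1" unfolding p_def by (intro E_norm_const) (simp add: indicator_def)
    then show "p k x \<le> 1" by simp
  qed
  have u0: "0 \<le> u k x" for k x unfolding u_def by (intro Bochner_Integration.integral_nonneg) simp
  have q: "0 \<le> q" by (simp add: q_def)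
  have jump: "c \<le> u k (x + y)" if "x \<in> K" "y \<notin> W" "k < N" for k x y
  proof -
    have "c \<le> measure (M (real k * s)) K" using c that by blast
    also have "\<dots> = E (real k * s) (indicator K :: _ \<Rightarrow> real)" by (simp add: E_indicator K)
    also have "\<dots> \<le> u k (x + y)" unfolding u_def
      using W[OF \<open>x \<in> K\<close>, of _ y] \<open>y \<notin> W\<close> meas
      by (intro E_mono bmeas_translate bmeas_indicator) (auto simp: indicator_def)
    finally show ?thesis .
  qed
  have main: "q * c * (\<Sum>j<k. p j x) - q\<^sup>2 * c * (real k)\<^sup>2 / 2 \<le> u k x" if "k \<le> N" for k x
    using that
  proof (induction k arbitrary: x)
    case 0
    then show ?case using u0 by simp
  next
    case (Suc k)
    define S where "S y = q * c * (\<Sum>j<k. p j (x + y))" for y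
    define B where "B = q\<^sup>2 * c * (real k)\<^sup>2 / 2"
    \<comment> \<open>A lower bound for \<open>u k (x + y)\<close>. After a small first step
      \<open>y\<close> it is the inductive bound. After a big one that bound is given up,
      \<open>S y\<close> being removed through its maximum \<open>q * c * real k\<close>, and
      \<open>c\<close> is gained if the walk started in \<open>K\<close>.\<close>
    define R where "R y = (S y - B) + (c * indicator K x - q * c * real k) *\<^sub>R (indicator (- W) y :: real)" for y
    have bS: "bmeas S"
      unfolding S_def using bp by (intro bmeas_bounded_linear[OF bounded_linear_mult_right] bmeas_sum bmeas_translate)
    have bR: "bmeas R" unfolding R_def using bS meas
      by (intro bmeas_add bmeas_diff bmeas_const bmeas_scaleR_right bmeas_indicator)
    have S0: "0 \<le> S y" for y unfolding S_def using p01 q \<open>c \<ge> 0\<close> by (intro mult_nonneg_nonneg sum_nonneg) auto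
    have S1: "S y \<le> q * c * real k" for y
    proof -
      have "(\<Sum>j<k. p j (x + y)) \<le> (\<Sum>j<k. 1)" by (intro sum_mono p01)
      then show ?thesis unfolding S_def using q \<open>c \<ge> 0\<close> by (intro mult_left_mono) auto
    qed
    have B0: "0 \<le> B" using \<open>c \<ge> 0\<close> by (simp add: B_def)
    have le: "R y \<le> u k (x + y)" for y
    proof (cases "y \<in> W")
      case True
      then show ?thesis using Suc.IH[of "x + y"] Suc.prems by (simp add: R_def S_def B_def)
    next
      case False
      then have "R y \<le> c * indicator K x" using S1[of y] B0 by (simp add: R_def)
      also have "\<dots> \<le> u k (x + y)"
        using jump[OF _ False, of x k] Suc.prems u0[of k "x + y"] by (cases "x \<in> K") auto
      finally show ?thesis .
    qed
    have "E s R \<le> u (Suc k) x"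
      unfolding urec by (rule E_mono[OF bR bmeas_translate[OF bu] le])
    moreover have "E s R = E s S - measure (M s) UNIV * B + (c * indicator K x - q * c * real k) * q"
    proof -
      have "E s R = E s (\<lambda>y. S y - B) + E s (\<lambda>y. (c * indicator K x - q * c * real k) *\<^sub>R indicator (- W) y)"
        unfolding R_def using bS meas by (intro E_add bmeas_diff bmeas_const bmeas_scaleR_right bmeas_indicator)
      then show ?thesis using meas by (simp add: E_diff[OF bS] q_def)
    qed
    moreover have "E s S = q * c * (\<Sum>j<k. p (Suc j) x)"
    proof -
      have "E s S = q * c * E s (\<lambda>y. \<Sum>j<k. p j (x + y))" unfolding S_def by simp
      also have "E s (\<lambda>y. \<Sum>j<k. p j (x + y)) = (\<Sum>j<k. E s (\<lambda>y. p j (x + y)))"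
        using bp by (intro E_sum bmeas_translate)
      finally show ?thesis by (simp add: prec)
    qed
    moreover have "measure (M s) UNIV * B \<le> B"
      using B0 measure_le_1[of s UNIV] by (simp add: mult_left_le_one_le)
    ultimately have "q * c * (\<Sum>j<k. p (Suc j) x) - B + (c * indicator K x - q * c * real k) * q \<le> u (Suc k) x"
      by linarith
    moreover have "(\<Sum>j<Suc k. p j x) = indicator K x + (\<Sum>j<k. p (Suc j) x)"
      by (subst sum.lessThan_Suc_shift) (simp add: p0)
    \<comment> \<open>Giving up the inductive bound costs \<open>q\<^sup>2 * c * real k\<close> in
      this step; half the difference of consecutive squares is at least \<open>real k\<close>, so
      the quadratic term pays for it.\<close>
    moreover have "q\<^sup>2 * c * (real (Suc k))\<^sup>2 / 2 \<ge> B + q * c * real k * q"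
    proof -
      have "q\<^sup>2 * c * (real (Suc k))\<^sup>2 / 2 = B + q * c * real k * q + q\<^sup>2 * c / 2"
        by (simp add: B_def power2_eq_square field_simps)
      then show ?thesis using \<open>c \<ge> 0\<close> by simp
    qed
    ultimately show ?case by (simp add: algebra_simps)
  qed
  have "q * c * (real N * c) \<le> q * c * (\<Sum>j<N. p j 0)"
  proof (rule mult_left_mono)
    have "(\<Sum>j<N. c) \<le> (\<Sum>j<N. p j 0)"
      unfolding p_def using c K by (intro sum_mono) (simp add: E_indicator)
    then show "real N * c \<le> (\<Sum>j<N. p j 0)" by simp
  qed (use q \<open>c \<ge> 0\<close> in simp)
  then have "q * c * (real N * c) - q\<^sup>2 * c * (real N)\<^sup>2 / 2 \<le> u N 0" using main[of N 0] by simp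
  also have "u N 0 = measure (M (real N * s)) (- K)" unfolding u_def using meas by (simp add: E_indicator)
  finally show ?thesis .
qed

text \<open>The bound of \<open>big_jump_aux\<close> is useful only while \<open>N * q\<close> stays
  below 1/2, where the quadratic term is harmless. Larger values cannot occur: the last
  \<open>n\<close> with \<open>n * q \<le> 1 / 2\<close> would have \<open>n * q > 9 / 20\<close>,
  as \<open>q \<le> 1 / 20\<close>, against
  \<open>n * q \<le> 5 / 2 * \<epsilon> \<le> 1 / 8\<close>.\<close>

lemma big_jump:
  assumes K: "K \<in> sets borel" "W \<in> sets borel" "0 \<in> K" "s \<ge> 0"
    and W: "\<And>x y z. x \<in> K \<Longrightarrow> z \<in> K \<Longrightarrow> x + y + z \<in> K \<Longrightarrow> y \<in> W"
    and c: "\<And>k. k \<le> N \<Longrightarrow> 4 / 5 \<le> measure (M (real k * s)) K"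
    and \<epsilon>: "\<And>k. k \<le> N \<Longrightarrow> measure (M (real k * s)) (- K) \<le> \<epsilon>" "\<epsilon> \<le> 1 / 20"
  shows "real N * measure (M s) (- W) \<le> 4 * \<epsilon>"
proof -
  define q where "q = measure (M s) (- W)"
  have q0: "0 \<le> q" by (simp add: q_def)
  have e0: "0 \<le> \<epsilon>" using \<epsilon>(1)[of 0] measure_nonneg order_trans by blast
  have step: "real n * q \<le> 5 / 2 * \<epsilon>" if "n \<le> N" "real n * q \<le> 1 / 2" for n
  proof -
    define a where "a = real n * q"
    have "q * (4/5) * (real n * (4/5)) - q\<^sup>2 * (4/5) * (real n)\<^sup>2 / 2 \<le> measure (M (real n * s)) (- K)"
      unfolding q_def by (rule big_jump_aux[OF K _ W]) (use c that in auto)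
    also have "\<dots> \<le> \<epsilon>" using \<epsilon>(1) that by blast
    \<comment> \<open>The case \<open>c = 4 / 5\<close>. As \<open>a \<le> 1 / 2\<close>, the
      left-hand side is at least \<open>11/25 * a\<close>, hence at least
      \<open>2/5 * a\<close>.\<close>
    finally have "16/25 * a - 2/5 * (a * a) \<le> \<epsilon>" by (simp add: a_def power2_eq_square mult_ac)
    moreover have "a * a \<le> 1/2 * a" using that(2) q0 by (intro mult_right_mono) (auto simp: a_def)
    ultimately show ?thesis using e0 unfolding a_def by linarith
  qed
  show ?thesis
  proof (cases "real N * q \<le> 1 / 2")
    case True
    then show ?thesis using step[OF order_refl True] e0 by (simp add: q_def)
  next
    case False
    have "N \<ge> 1" using False by (cases N) auto
    have "q > 0" using False q0 by (cases "q = 0") auto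
    have "K \<subseteq> W" using W[OF K(3) K(3)] by auto
    then have "q \<le> measure (M s) (- K)"
      unfolding q_def using borel_comp[OF K(1)] by (intro finite_measure_mono) auto
    also have "\<dots> = measure (M (real 1 * s)) (- K)" by simp
    also have "\<dots> \<le> 1 / 20" using \<epsilon>(1)[of 1] \<epsilon>(2) \<open>N \<ge> 1\<close> by simp
    finally have q20: "q \<le> 1 / 20" .
    define n where "n = nat \<lfloor>1 / (2 * q)\<rfloor>"
    have n: "real n \<le> 1 / (2 * q)" "1 / (2 * q) < real n + 1"
      using \<open>q > 0\<close> unfolding n_def by (simp_all add: of_nat_nat)
    have "1 / (2 * q) < real N" using False \<open>q > 0\<close> by (simp add: field_simps)
    then have "n \<le> N" using n by linarith
    moreover have n1: "real n * q \<le> 1 / 2" using n(1) \<open>q > 0\<close> by (simp add: field_simps)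
    ultimately have "real n * q \<le> 5 / 2 * \<epsilon>" by (rule step)
    moreover have "1 / 2 < real n * q + q" using n(2) \<open>q > 0\<close> by (simp add: field_simps)
    ultimately show ?thesis using q20 \<epsilon>(2) by linarith
  qed
qed

end

section \<open>Averages over time and uniformity for small times\<close>

lemma integrable_indicator_Icc: "integrable lborel (indicator {a..b::real} :: real \<Rightarrow> real)"
  by (cases "a \<le> b") (auto intro!: integrable_real_indicator)

context conv_semigroup
begin

text \<open>The two expectations share the increment \<open>y\<close> over the time
  \<open>r\<close>, with and without the preceding \<open>x\<close>. Both can be large only if
  \<open>x\<close> is likely to be in \<open>U\<close>; the time \<open>r\<close> remains free to be
  averaged over.\<close>

lemma E_doubling:
  fixes \<phi> :: "'g \<Rightarrow> real"
  assumes \<phi>: "continuous_on UNIV \<phi>" "\<And>x. 0 \<le> \<phi> x" "\<And>x. \<phi> x \<le> 1" and U: "U \<in> sets borel"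
    and U\<phi>: "\<And>x y. \<phi> (x + y) > 0 \<Longrightarrow> \<phi> y > 0 \<Longrightarrow> x \<in> U" and "t \<ge> 0" "r \<ge> 0"
  shows "E (t + r) \<phi> + E r \<phi> \<le> 1 + measure (M t) U"
proof -
  have b\<phi>: "bmeas \<phi>" using \<phi> by (intro bmeasI[where C = 1] borel_measurable_continuous_onI) auto
  have "E (t + r) \<phi> = E t (\<lambda>x. E r (\<lambda>y. \<phi> (x + y)))" by (rule E_conv) fact+
  also have "\<dots> \<le> E t (\<lambda>x. indicator U x + (1 - E r \<phi>))"
  proof (rule E_mono)
    show "bmeas (\<lambda>x. E r (\<lambda>y. \<phi> (x + y)))" by (rule bmeas_E_translate[OF b\<phi>])
    show "bmeas (\<lambda>x. indicator U x + (1 - E r \<phi>))" using U by (intro bmeas_add bmeas_indicator bmeas_const)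
    show "E r (\<lambda>y. \<phi> (x + y)) \<le> indicator U x + (1 - E r \<phi>)" for x
    proof -
      have "E r (\<lambda>y. \<phi> (x + y)) \<le> E r (\<lambda>y. (indicator U x + 1) - \<phi> y)"
      proof (rule E_mono[OF bmeas_translate[OF b\<phi>] bmeas_diff[OF bmeas_const b\<phi>]])
        fix y
        show "\<phi> (x + y) \<le> indicator U x + 1 - \<phi> y"
          using \<phi>(2)[of "x + y"] \<phi>(2)[of y] \<phi>(3)[of "x + y"] \<phi>(3)[of y] U\<phi>[of x y]
          by (cases "\<phi> (x + y) = 0"; cases "\<phi> y = 0"; cases "x \<in> U") auto
      qed
      also have "\<dots> = measure (M r) UNIV * (indicator U x + 1) - E r \<phi>"
        by (subst E_diff[OF bmeas_const b\<phi>]) simp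
      also have "\<dots> \<le> 1 * (indicator U x + 1) - E r \<phi>"
        using measure_le_1[of r UNIV] by (intro diff_right_mono mult_right_mono) auto
      finally show ?thesis by simp
    qed
  qed
  also have "\<dots> = measure (M t) U + measure (M t) UNIV * (1 - E r \<phi>)"
    using U by (subst E_add) auto
  also have "\<dots> \<le> measure (M t) U + 1 * (1 - E r \<phi>)"
  proof -
    have "norm (E r \<phi>) \<le> 1" using \<phi> by (intro E_norm_const) auto
    then show ?thesis using measure_le_1[of t UNIV] by (intro add_left_mono mult_right_mono) auto
  qed
  finally show ?thesis by simp
qed

text \<open>The average of \<open>E (t + r) \<phi>\<close> over \<open>r\<close> is the average of
  \<open>E r \<phi>\<close> over a shifted interval and so differs little from \<open>I\<close>.
  Thus \<open>I\<close> alone bounds the mass of \<open>U\<close> at every small \<open>t\<close>,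
  and \<open>I\<close> is accessible to convergence at fixed times.\<close>

lemma E_average:
  fixes \<phi> :: "'g \<Rightarrow> real"
  assumes \<phi>: "continuous_on UNIV \<phi>" "\<And>x. 0 \<le> \<phi> x" "\<And>x. \<phi> x \<le> 1" and U: "U \<in> sets borel"
    and U\<phi>: "\<And>x y. \<phi> (x + y) > 0 \<Longrightarrow> \<phi> y > 0 \<Longrightarrow> x \<in> U" and t: "t \<ge> 0" and h: "h > 0"
  defines "I \<equiv> \<integral>r. indicator {0..h} r * E (max 0 r) \<phi> \<partial>lborel"
  shows "2 * I \<le> t + h * (1 + measure (M t) U)"
proof -
  define m where "m r = E (max 0 r) \<phi>" for r
  have "bounded (range \<phi>)" using \<phi> by (auto simp: bounded_iff intro!: exI[of _ 1])
  then have m[measurable]: "m \<in> borel_measurable borel"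
    unfolding m_def by (rule E_measurable_time[OF \<phi>(1)])
  have m01: "0 \<le> m r" "m r \<le> 1" for r
  proof -
    show "0 \<le> m r" unfolding m_def using \<phi> by (intro Bochner_Integration.integral_nonneg) auto
    have "norm (m r) \<le> 1" unfolding m_def using \<phi> by (intro E_norm_const) auto
    then show "m r \<le> 1" by simp
  qed
  have int: "integrable lborel (\<lambda>r. indicator {a..b} r * f r)"
    if "f \<in> borel_measurable borel" "\<And>r. \<bar>f r\<bar> \<le> C" for a b C and f :: "real \<Rightarrow> real"
  proof (rule Bochner_Integration.integrable_bound[of lborel "\<lambda>r. indicator {a..b} r * C"])
    show "integrable lborel (\<lambda>r. indicator {a..b} r * C)"
      by (rule integrable_mult_left[OF integrable_indicator_Icc])
    show "(\<lambda>r. indicator {a..b} r * f r) \<in> borel_measurable lborel" using that(1) by measurable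
    show "AE r in lborel. norm (indicator {a..b} r * f r) \<le> norm (indicator {a..b} r * C)"
      using order_trans[OF that(2) abs_ge_self] by (intro AE_I2) (auto simp: indicator_def abs_mult)
  qed
  have int1: "integrable lborel (\<lambda>r. indicator {a..b} r * m r)" for a b
    by (rule int[OF m, of 1]) (simp add: abs_of_nonneg m01)
  have int2: "integrable lborel (\<lambda>r. indicator {0..h} r * m (t + r))"
    by (rule int[of "\<lambda>r. m (t + r)" 1]) (simp_all add: abs_of_nonneg m01)
  have shift: "(\<integral>r. indicator {0..h} r * m (t + r) \<partial>lborel) = (\<integral>r. indicator {t..t + h} r * m r \<partial>lborel)"
    using lborel_integral_real_affine[of 1 "\<lambda>r. indicator {t..t + h} r * m r" t]
    by (simp add: indicator_def)
  \<comment> \<open>The shift by \<open>t\<close> loses only the part of \<open>{0..h}\<close>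
    before \<open>t\<close>, which contributes at most \<open>t\<close>.\<close>
  have "I - t = (\<integral>r. indicator {0..h} r * m r - indicator {0..t} r * 1 \<partial>lborel)"
    using t int1[of 0 h] by (subst Bochner_Integration.integral_diff) (auto simp: I_def m_def)
  also have "\<dots> \<le> (\<integral>r. indicator {t..t + h} r * m r \<partial>lborel)"
    using t m01 by (intro integral_mono Bochner_Integration.integrable_diff int1 int[of _ 1])
      (auto simp: indicator_def intro: order_trans[of "- 1" 0])
  finally have "I + (I - t) \<le> (\<integral>r. indicator {0..h} r * m r \<partial>lborel) + (\<integral>r. indicator {0..h} r * m (t + r) \<partial>lborel)"
    by (simp add: shift) (simp add: I_def m_def)
  also have "\<dots> = (\<integral>r. indicator {0..h} r * m r + indicator {0..h} r * m (t + r) \<partial>lborel)"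
    by (rule Bochner_Integration.integral_add[symmetric, OF int1 int2])
  also have "\<dots> \<le> (\<integral>r. indicator {0..h} r * (1 + measure (M t) U) \<partial>lborel)"
  proof (rule integral_mono[OF Bochner_Integration.integrable_add[OF int1 int2]])
    show "integrable lborel (\<lambda>r. indicator {0..h} r * (1 + measure (M t) U))"
      by (rule integrable_mult_left[OF integrable_indicator_Icc])
    fix r
    have "m r + m (t + r) \<le> 1 + measure (M t) U" if "r \<ge> 0"
    proof -
      have "E (t + r) \<phi> + E r \<phi> \<le> 1 + measure (M t) U"
        by (rule E_doubling[OF \<phi> U _ t that]) (rule U\<phi>)
      then show ?thesis using that t by (simp add: m_def add.commute)
    qed
    then show "indicator {0..h} r * m r + indicator {0..h} r * m (t + r) \<le> indicator {0..h} r * (1 + measure (M t) U)"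
      by (auto simp: indicator_def)
  qed
  also have "\<dots> = h * (1 + measure (M t) U)" using h by simp
  finally show ?thesis by simp
qed

end

locale conv_family =
  fixes \<mu> :: "nat \<Rightarrow> real \<Rightarrow> 'g::{topological_group_add, t2_space, second_countable_topology} measure"
  assumes semigroup: "\<And>n. conv_semigroup (\<mu> n)"
    and weak_conv: "\<And>(f :: 'g \<Rightarrow> real) t. continuous_on UNIV f \<Longrightarrow> bounded (range f) \<Longrightarrow> t > 0 \<Longrightarrow>
      (\<lambda>n. \<integral>x. f x \<partial>\<mu> n t) \<longlonglongrightarrow> (\<integral>x. f x \<partial>\<mu> 0 t)"
begin

sublocale S: conv_semigroup "\<mu> n" for n by (rule semigroup)

abbreviation MM :: "nat \<Rightarrow> real \<Rightarrow> 'g measure" where "MM n \<equiv> conv_semigroup.M (\<mu> n)"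
abbreviation EE :: "nat \<Rightarrow> real \<Rightarrow> ('g \<Rightarrow> 'b::{banach, second_countable_topology}) \<Rightarrow> 'b" where
  "EE n t f \<equiv> \<integral>x. f x \<partial>MM n t"

lemma EE_tendsto:
  fixes f :: "'g \<Rightarrow> real"
  assumes f: "continuous_on UNIV f" "bounded (range f)" and "t \<ge> 0"
  shows "(\<lambda>n. EE n t f) \<longlonglongrightarrow> EE 0 t f"
proof (cases "t = 0")
  case True
  then show ?thesis using S.E_0[OF bmeas_continuous[OF f]] by simp
next
  case False
  then show ?thesis using weak_conv[OF f, of t] \<open>t \<ge> 0\<close> by (simp add: S.M_def)
qed

text \<open>
  Weak convergence is only assumed for each fixed time. The average over \<open>r\<close> of
  \<open>\<phi> (x + y) \<le> indicator U x + 1 - \<phi> y\<close>, with \<open>x\<close> and \<open>y\<close> distributed according to \<open>MM n t\<close> and \<open>MM n r\<close>,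
  turns it into an estimate that is uniform for small times \<open>t\<close>.
\<close>

lemma uniform_small:
  fixes \<phi> :: "'g \<Rightarrow> real"
  assumes \<phi>: "continuous_on UNIV \<phi>" "\<And>x. 0 \<le> \<phi> x" "\<And>x. \<phi> x \<le> 1" "\<phi> 0 = 1" and U: "U \<in> sets borel"
    and U\<phi>: "\<And>x y. \<phi> (x + y) > 0 \<Longrightarrow> \<phi> y > 0 \<Longrightarrow> x \<in> U" and "\<epsilon> > 0"
  shows "\<exists>t0>0. \<forall>n t. 0 \<le> t \<longrightarrow> t \<le> t0 \<longrightarrow> 1 - \<epsilon> \<le> measure (MM n t) U"
proof -
  have bd: "bounded (range \<phi>)" using \<phi> by (auto simp: bounded_iff intro!: exI[of _ 1])
  have b\<phi>: "bmeas \<phi>" by (rule bmeas_continuous[OF \<phi>(1) bd])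
  have ind: "EE n t \<phi> \<le> measure (MM n t) U" for n t
  proof -
    have "EE n t \<phi> \<le> EE n t (indicator U)"
    proof (rule S.E_mono[OF b\<phi> bmeas_indicator[OF U]])
      fix x show "\<phi> x \<le> indicator U x"
        using U\<phi>[of x 0] \<phi>(2)[of x] \<phi>(3)[of x] \<phi>(4) by (cases "\<phi> x = 0") (auto simp: indicator_def)
    qed
    then show ?thesis using U by simp
  qed
  have single: "\<exists>t0>0. \<forall>t. 0 \<le> t \<longrightarrow> t \<le> t0 \<longrightarrow> 1 - e < EE n t \<phi>" if "e > 0" for e n
  proof -
    have "\<forall>\<^sub>F t in at_right 0. 1 - e < EE n t \<phi>"
      by (rule order_tendstoD(1)[OF S.E_tendsto_0[OF \<phi>(1) bd]]) (simp add: \<phi> that)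
    then obtain b where b: "b > 0" "\<And>t. 0 < t \<Longrightarrow> t < b \<Longrightarrow> 1 - e < EE n t \<phi>"
      by (auto simp: eventually_at_right_field)
    show ?thesis
    proof (intro exI[of _ "b / 2"] conjI allI impI)
      fix t assume "0 \<le> t" "t \<le> b / 2"
      then show "1 - e < EE n t \<phi>"
        using b S.E_0[OF b\<phi>] \<phi>(4) that by (cases "t = 0") auto
    qed (use b in simp)
  qed
  \<comment> \<open>With \<open>\<epsilon> / 8\<close> here, \<open>\<epsilon> / 4\<close> for the
    averages at large \<open>n\<close> and times up to \<open>h * \<epsilon> / 4\<close>, the mass
    of \<open>U\<close> is at least \<open>2 * (1 - \<epsilon> / 4) - 1 - \<epsilon> / 4 = 1 - 3 *
    \<epsilon> / 4\<close>.\<close>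
  have "\<epsilon> / 8 > 0" using \<open>\<epsilon> > 0\<close> by simp
  from single[OF this, of 0] obtain h where h: "h > 0" "\<And>t. 0 \<le> t \<Longrightarrow> t \<le> h \<Longrightarrow> 1 - \<epsilon> / 8 < EE 0 t \<phi>" by blast
  define I where "I n = (\<integral>r. indicator {0..h} r * EE n (max 0 r) \<phi> \<partial>lborel)" for n
  have meas[measurable]: "(\<lambda>r. EE n (max 0 r) \<phi>) \<in> borel_measurable borel" for n
    by (rule S.E_measurable_time[OF \<phi>(1) bd])
  have le1: "norm (EE n r \<phi>) \<le> 1" for n r using \<phi> by (intro S.E_norm_const) auto
  have "I \<longlonglongrightarrow> I 0" unfolding I_def
  proof (rule integral_dominated_convergence[where w = "indicator {0..h}"])
    show "AE r in lborel. (\<lambda>n. indicator {0..h} r * EE n (max 0 r) \<phi>) \<longlonglongrightarrow> indicator {0..h} r * EE 0 (max 0 r) \<phi>"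
      by (intro AE_I2 tendsto_intros EE_tendsto[OF \<phi>(1) bd]) simp
    show "AE r in lborel. norm (indicator {0..h} r * EE n (max 0 r) \<phi>) \<le> indicator {0..h} r" for n
      using le1 by (intro AE_I2) (auto simp: indicator_def)
  qed (use h in auto)
  moreover have "h * (1 - \<epsilon> / 8) \<le> I 0"
  proof -
    have "(\<integral>r. indicator {0..h} r * (1 - \<epsilon> / 8) \<partial>lborel) \<le> I 0" unfolding I_def
    proof (rule integral_mono)
      show "integrable lborel (\<lambda>r. indicator {0..h} r * EE 0 (max 0 r) \<phi>)"
        by (rule Bochner_Integration.integrable_bound[of lborel "indicator {0..h} :: _ \<Rightarrow> real"])
          (use le1 h in \<open>auto simp: indicator_def\<close>)
      show "indicator {0..h} r * (1 - \<epsilon> / 8) \<le> indicator {0..h} r * EE 0 (max 0 r) \<phi>" for r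
        using h(2)[of r] by (auto simp: indicator_def max_def)
    qed (rule integrable_mult_left[OF integrable_indicator_Icc])
    then show ?thesis using h by simp
  qed
  moreover have "h * (1 - \<epsilon> / 4) < h * (1 - \<epsilon> / 8)" using h(1) \<open>\<epsilon> > 0\<close> by simp
  ultimately have "\<forall>\<^sub>F n in sequentially. h * (1 - \<epsilon> / 4) < I n"
    by (intro order_tendstoD(1)[of I "I 0"]) simp_all
  then obtain N where N: "\<And>n. n \<ge> N \<Longrightarrow> h * (1 - \<epsilon> / 4) < I n" by (auto simp: eventually_sequentially)
  have large: "1 - \<epsilon> \<le> measure (MM n t) U" if "n \<ge> N" "0 \<le> t" "t \<le> h * \<epsilon> / 4" for n t
  proof -
    have "2 * I n \<le> t + h * (1 + measure (MM n t) U)"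
      unfolding I_def by (rule S.E_average[OF \<phi>(1-3) U U\<phi> that(2) h(1)])
    with N[OF that(1)] that(3) have "h * (2 * (1 - \<epsilon> / 4)) \<le> h * (\<epsilon> / 4 + (1 + measure (MM n t) U))"
      by (simp add: algebra_simps)
    then show ?thesis using h(1) \<open>\<epsilon> > 0\<close> by simp
  qed
  \<comment> \<open>The finitely many remaining semigroups are treated one by one through their own
    continuity at time zero.\<close>
  have "\<exists>t1>0. \<forall>n<N. \<forall>t. 0 \<le> t \<longrightarrow> t \<le> t1 \<longrightarrow> 1 - \<epsilon> < EE n t \<phi>"
  proof (induction N)
    case (Suc N)
    then obtain t1 where t1: "t1 > 0" "\<And>n t. n < N \<Longrightarrow> 0 \<le> t \<Longrightarrow> t \<le> t1 \<Longrightarrow> 1 - \<epsilon> < EE n t \<phi>" by blast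
    obtain t2 where t2: "t2 > 0" "\<And>t. 0 \<le> t \<Longrightarrow> t \<le> t2 \<Longrightarrow> 1 - \<epsilon> < EE N t \<phi>"
      using single[OF \<open>\<epsilon> > 0\<close>, of N] by blast
    show ?case using t1 t2 by (intro exI[of _ "min t1 t2"]) (auto simp: less_Suc_eq)
  qed (auto intro: exI[of _ 1])
  then obtain t1 where t1: "t1 > 0" "\<And>n t. n < N \<Longrightarrow> 0 \<le> t \<Longrightarrow> t \<le> t1 \<Longrightarrow> 1 - \<epsilon> < EE n t \<phi>" by blast
  have "1 - \<epsilon> \<le> measure (MM n t) U" if "0 \<le> t" "t \<le> min (h * \<epsilon> / 4) t1" for n t
    using large[of n t] t1(2)[of n t] ind[of n t] that by (cases "n < N") auto
  then show ?thesis using t1(1) h(1) \<open>\<epsilon> > 0\<close> by (intro exI[of _ "min (h * \<epsilon> / 4) t1"]) auto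
qed

end

section \<open>Uniform bounds on tails and on the loss of mass\<close>

lemma open_diff_nbhd:
  fixes U :: "'g::topological_group_add set"
  assumes "open U" "0 \<in> U"
  shows "\<exists>V. open V \<and> 0 \<in> V \<and> (\<forall>x\<in>V. \<forall>y\<in>V. x - y \<in> U)"
proof -
  have "open ((\<lambda>p::'g \<times> 'g. fst p - snd p) -` U)"
    unfolding diff_conv_add_uminus by (intro open_vimage assms continuous_intros)
  moreover have "(0, 0) \<in> (\<lambda>p::'g \<times> 'g. fst p - snd p) -` U" using assms by simp
  ultimately obtain V W where "open V" "open W" "(0, 0) \<in> V \<times> W" "V \<times> W \<subseteq> (\<lambda>p. fst p - snd p) -` U"
    by (rule open_prod_elim)
  then show ?thesis by (intro exI[of _ "V \<inter> W"]) auto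
qed

text \<open>\<open>- x + k - z\<close> is the solution \<open>y\<close> of
  \<open>x + y + z = k\<close>, so this supplies the hypothesis on \<open>W\<close> in
  \<open>big_jump\<close>.\<close>

lemma open_triple_nbhd:
  fixes U :: "'g::topological_group_add set"
  assumes "open U" "0 \<in> U"
  shows "\<exists>V. open V \<and> 0 \<in> V \<and> (\<forall>x\<in>V. \<forall>k\<in>V. \<forall>z\<in>V. - x + k - z \<in> U)"
proof -
  obtain V where V: "open V" "0 \<in> V" "\<And>x y. x \<in> V \<Longrightarrow> y \<in> V \<Longrightarrow> x - y \<in> U"
    using open_diff_nbhd[OF assms] by blast
  have "open ((\<lambda>p::'g \<times> 'g. - fst p + snd p) -` V)"
    by (intro open_vimage V continuous_intros)
  moreover have "(0, 0) \<in> (\<lambda>p::'g \<times> 'g. - fst p + snd p) -` V" using V by simp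
  ultimately obtain W Y where W: "open W" "open Y" "(0, 0) \<in> W \<times> Y" "W \<times> Y \<subseteq> (\<lambda>p. - fst p + snd p) -` V"
    by (rule open_prod_elim)
  have "- x + k - z \<in> U" if "x \<in> W \<inter> Y \<inter> V" "k \<in> W \<inter> Y \<inter> V" "z \<in> W \<inter> Y \<inter> V" for x k z
  proof -
    have "(x, k) \<in> W \<times> Y" using that by blast
    then have "- x + k \<in> V" using W(4) by auto
    then show ?thesis using V(3) that by blast
  qed
  then show ?thesis using W V by (intro exI[of _ "W \<inter> Y \<inter> V"]) auto
qed

locale lie_family = lie_chart d w crd A U0 \<phi>0 + conv_family \<mu>
  for d w crd and A :: "('g::{topological_group_add, t2_space, second_countable_topology}, 'e::real_normed_vector) atlas"
    and U0 \<phi>0 and \<mu> :: "nat \<Rightarrow> real \<Rightarrow> 'g measure"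
begin

text \<open>The cutoff is supported in a neighbourhood whose differences lie in \<open>U\<close>, as
  \<open>uniform_small\<close> requires.\<close>

lemma small_times:
  assumes "open U" "0 \<in> U" "\<epsilon> > 0"
  shows "\<exists>t0>0. \<forall>n t. 0 \<le> t \<longrightarrow> t \<le> t0 \<longrightarrow> 1 - \<epsilon> \<le> measure (MM n t) U"
proof -
  obtain V where V: "open V" "0 \<in> V" "\<And>x y. x \<in> V \<Longrightarrow> y \<in> V \<Longrightarrow> x - y \<in> U"
    using open_diff_nbhd[OF assms(1,2)] by blast
  obtain \<eta> V' K where \<eta>: "smooth \<eta>" "\<forall>x. 0 \<le> \<eta> x \<and> \<eta> x \<le> (1::real)" "0 \<in> V'" "\<forall>x\<in>V'. \<eta> x = 1"
    "K \<subseteq> V" "\<forall>x. x \<notin> K \<longrightarrow> \<eta> x = 0"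
    using cutoff_point[OF V(1,2)] by blast
  show ?thesis
  proof (rule uniform_small)
    show "continuous_on UNIV \<eta>" by (rule smooth_continuous_on[OF \<eta>(1)])
    show "x \<in> U" if "\<eta> (x + y) > 0" "\<eta> y > 0" for x y
    proof -
      have *: "z \<in> V" if "\<eta> z > 0" for z
        using \<eta>(5,6) that by (cases "z \<in> K") auto
      have "(x + y) - y \<in> U" by (intro V(3) * that)
      then show ?thesis by simp
    qed
  qed (use \<eta> assms in auto)
qed

text \<open>\<open>N\<close> steps of length \<open>s\<close> end between \<open>t1 / 2\<close> and
  \<open>t1\<close>. A bound of constant size on \<open>N\<close> times a quantity thereby becomes a
  bound of order \<open>s\<close> on the quantity.\<close>

lemma time_grid:
  assumes "0 < s" "s \<le> t1"
  obtains N where "N \<ge> 1" "real N * s \<le> t1" "t1 / (2 * s) \<le> real N"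
proof -
  define N where "N = nat \<lfloor>t1 / s\<rfloor>"
  have 1: "1 \<le> t1 / s" using assms by simp
  have N: "real N \<le> t1 / s" "t1 / s < real N + 1"
    using 1 unfolding N_def by (simp_all add: of_nat_nat)
  have "N \<ge> 1" using 1 by (simp add: N_def le_nat_iff)
  moreover have "real N * s \<le> t1" using N(1) assms by (simp add: field_simps)
  moreover have "t1 / (2 * s) \<le> real N"
  proof -
    have "t1 / (2 * s) = (t1 / s) / 2" by simp
    then show ?thesis using N(2) \<open>N \<ge> 1\<close> by linarith
  qed
  ultimately show ?thesis by (rule that)
qed

lemma mass_ge:
  assumes "B \<in> sets borel" shows "measure (MM n t) B \<le> measure (MM n t) UNIV"
  using assms by (intro S.finite_measure_mono) auto

text \<open>With \<open>- K + K - K\<close> inside \<open>U\<close>, every semigroup has mass at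
  least 19/20 on \<open>K\<close> at each time up to a common \<open>t1\<close>. By
  \<open>big_jump\<close>, \<open>N\<close> times the probability of a step out of \<open>U\<close>
  is then at most 1/5, and \<open>N\<close> is of order \<open>1 / s\<close>.\<close>

lemma tail_bound:
  assumes "open U" "0 \<in> U"
  shows "\<exists>C t0. C \<ge> 0 \<and> t0 > 0 \<and> (\<forall>n s. 0 < s \<longrightarrow> s \<le> t0 \<longrightarrow> measure (MM n s) (- U) \<le> C * s)"
proof -
  obtain K where K: "open K" "0 \<in> K" "\<And>x k z. x \<in> K \<Longrightarrow> k \<in> K \<Longrightarrow> z \<in> K \<Longrightarrow> - x + k - z \<in> U"
    using open_triple_nbhd[OF assms] by blast
  obtain t1 where t1: "t1 > 0" "\<And>n t. 0 \<le> t \<Longrightarrow> t \<le> t1 \<Longrightarrow> 1 - 1/20 \<le> measure (MM n t) K"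
    using small_times[OF K(1,2), of "1/20"] by auto
  have "measure (MM n s) (- U) \<le> (2 / 5 / t1) * s" if s: "0 < s" "s \<le> t1" for n s
  proof -
    obtain N where N: "N \<ge> 1" "real N * s \<le> t1" "t1 / (2 * s) \<le> real N" by (rule time_grid[OF s])
    have kt: "real k * s \<le> t1" if "k \<le> N" for k
    proof -
      have "real k * s \<le> real N * s" using that s by (intro mult_right_mono) auto
      then show ?thesis using N(2) by linarith
    qed
    have "real N * measure (MM n s) (- U) \<le> 4 * (1/20)"
    proof (rule S.big_jump[where K = K])
      show "y \<in> U" if "x \<in> K" "z \<in> K" "x + y + z \<in> K" for x y z
        using K(3)[OF that(1) that(3) that(2)] by (simp add: add.assoc[symmetric] del: add_uminus_conv_diff)
      show "4 / 5 \<le> measure (MM n (real k * s)) K" if "k \<le> N" for k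
        using t1(2)[OF _ kt[OF that], of n] s by simp
      show "measure (MM n (real k * s)) (- K) \<le> 1 / 20" if "k \<le> N" for k
        using t1(2)[OF _ kt[OF that], of n] s S.measure_complement[of K n "real k * s"] K(1) S.measure_le_1[of n "real k * s" UNIV] by simp
    qed (use K assms s in auto)
    moreover have "t1 / (2 * s) * measure (MM n s) (- U) \<le> real N * measure (MM n s) (- U)"
      using N(3) by (intro mult_right_mono) auto
    ultimately have "t1 / (2 * s) * measure (MM n s) (- U) \<le> 1 / 5" by linarith
    then show ?thesis using t1(1) s by (simp add: field_simps)
  qed
  then show ?thesis using t1(1) by (intro exI[of _ "2 / 5 / t1"] exI[of _ t1]) auto
qed

text \<open>Total mass is multiplicative in time, so the loss over a step of length \<open>s\<close>
  can be read off from the mass at time \<open>N * s\<close>, which is at least 1/2 for all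
  \<open>n\<close>.\<close>

lemma mass_bound:
  "\<exists>C t0. C \<ge> 0 \<and> t0 > 0 \<and> (\<forall>n s. 0 < s \<longrightarrow> s \<le> t0 \<longrightarrow> 1 - measure (MM n s) UNIV \<le> C * s)"
proof -
  obtain t1 where t1: "t1 > 0" "\<And>n t. 0 \<le> t \<Longrightarrow> t \<le> t1 \<Longrightarrow> 1 - 1/2 \<le> measure (MM n t) UNIV"
    using small_times[of UNIV "1/2"] by auto
  have "1 - measure (MM n s) UNIV \<le> (2 / t1) * s" if s: "0 < s" "s \<le> t1" for n s
  proof -
    obtain N where N: "N \<ge> 1" "real N * s \<le> t1" "t1 / (2 * s) \<le> real N" by (rule time_grid[OF s])
    define x where "x = 1 - measure (MM n s) UNIV"
    have x: "0 \<le> x" "x \<le> 1" by (simp_all add: x_def S.measure_le_1)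
    have half: "1 / 2 \<le> (1 - x) ^ N"
      using t1(2)[of "real N * s" n] s N S.mass_mult[of s n N] by (simp add: x_def)
    \<comment> \<open>Bernoulli's inequality for \<open>1 + x\<close>, multiplied by
      \<open>(1 - x) ^ N\<close>, bounds that power from above; for \<open>1 - x\<close> it would
      give a lower bound.\<close>
    have upper: "(1 - x) ^ N * (1 + real N * x) \<le> 1"
    proof -
      have "(1 - x) ^ N * (1 + real N * x) \<le> (1 - x) ^ N * (1 + x) ^ N"
        using x Bernoulli_inequality[of x N] by (intro mult_left_mono) auto
      also have "\<dots> = (1 - x\<^sup>2) ^ N" by (simp add: power_mult_distrib[symmetric] algebra_simps power2_eq_square)
      also have "\<dots> \<le> 1" using x by (intro power_le_one) (auto simp: power_le_one)
      finally show ?thesis .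
    qed
    have "(1 / 2) * (1 + real N * x) \<le> 1"
      by (rule order_trans[OF mult_right_mono[OF half] upper]) (use x in simp)
    then have "real N * x \<le> 1" by simp
    moreover have "t1 / (2 * s) * x \<le> real N * x" using N(3) x by (intro mult_right_mono) auto
    ultimately have "t1 / (2 * s) * x \<le> 1" by linarith
    then show ?thesis using t1(1) s by (simp add: x_def field_simps)
  qed
  then show ?thesis using t1(1) by (intro exI[of _ "2 / t1"] exI[of _ t1]) auto
qed

lemma compact_borel: "compact (K :: 'g set) \<Longrightarrow> K \<in> sets borel"
  by (simp add: borel_closed compact_imp_closed)

text \<open>A weakly convergent sequence is tight: a continuous cutoff carries tightness of the
  limit to all large \<open>n\<close>, and each of the others is tight by itself.\<close>

lemma tight_fixed_time:
  assumes "t \<ge> 0" "\<epsilon> > 0"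
  shows "\<exists>K. compact K \<and> (\<forall>n. measure (MM n t) (- K) \<le> \<epsilon>)"
proof -
  obtain \<eta> L where \<eta>L: "\<And>n. csupp_in UNIV (\<eta> n)" "\<And>n x. 0 \<le> \<eta> n x" "\<And>n x. \<eta> n x \<le> (1::real)"
    "\<And>n::nat. compact (L n)" "\<And>n x. x \<in> L n \<Longrightarrow> \<eta> n x = 1" "incseq L" "(\<Union>n. L n) = (UNIV :: 'g set)"
    using exhausting_cutoffs[OF open_UNIV] by metis
  have small: "\<exists>k. measure (MM n t) (- L k) < e" if "e > 0" for n e
  proof -
    have "(\<lambda>k. measure (MM n t) (L k)) \<longlonglongrightarrow> measure (MM n t) (\<Union>k. L k)"
      by (rule S.finite_Lim_measure_incseq) (use \<eta>L compact_borel in auto)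
    then have "\<forall>\<^sub>F k in sequentially. measure (MM n t) UNIV - e < measure (MM n t) (L k)"
      using that by (intro order_tendstoD) (auto simp: \<eta>L(7))
    then obtain k where "measure (MM n t) UNIV - e < measure (MM n t) (L k)"
      by (auto simp: eventually_sequentially)
    then show ?thesis using S.measure_complement[OF compact_borel[OF \<eta>L(4)], of n t k] by (intro exI[of _ k]) simp
  qed
  obtain k where k: "measure (MM 0 t) (- L k) < \<epsilon>" using small[OF \<open>\<epsilon> > 0\<close>] by blast
  obtain K0 where K0: "compact K0" "\<And>x. x \<notin> K0 \<Longrightarrow> \<eta> k x = 0" using \<eta>L(1)[of k] by (auto simp: csupp_in_def)
  \<comment> \<open>Bounded but not compactly supported: testing with it excludes an escape of mass
    to infinity.\<close>
  let ?f = "\<lambda>x. 1 - \<eta> k x"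
  have f: "continuous_on UNIV ?f" "bounded (range ?f)"
  proof -
    show "continuous_on UNIV ?f" using csupp_in_continuous[OF \<eta>L(1)] by (intro continuous_intros)
    show "bounded (range ?f)" using \<eta>L(2,3) by (auto simp: bounded_iff intro!: exI[of _ 1])
  qed
  note bf = bmeas_continuous[OF f]
  have "EE 0 t ?f \<le> EE 0 t (indicator (- L k))"
    using \<eta>L(2,5) compact_borel[OF \<eta>L(4)]
    by (intro S.E_mono bf bmeas_indicator) (auto simp: indicator_def)
  also have "\<dots> = measure (MM 0 t) (- L k)" using compact_borel[OF \<eta>L(4)] by (intro S.E_indicator) auto
  finally have "EE 0 t ?f < \<epsilon>" using k by simp
  then have "\<forall>\<^sub>F n in sequentially. EE n t ?f < \<epsilon>"
    by (rule order_tendstoD(2)[OF EE_tendsto[OF f \<open>t \<ge> 0\<close>]])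
  then obtain N where N: "\<And>n. n \<ge> N \<Longrightarrow> EE n t ?f < \<epsilon>" by (auto simp: eventually_sequentially)
  have large: "measure (MM n t) (- K0) \<le> \<epsilon>" if "n \<ge> N" for n
  proof -
    have "measure (MM n t) (- K0) = EE n t (indicator (- K0))"
      using compact_borel[OF K0(1)] by (intro S.E_indicator[symmetric]) auto
    also have "\<dots> \<le> EE n t ?f"
      using K0(2) \<eta>L(3) compact_borel[OF K0(1)]
      by (intro S.E_mono bf bmeas_indicator) (auto simp: indicator_def)
    finally show ?thesis using N[OF that] by simp
  qed
  obtain j where j: "\<And>n. measure (MM n t) (- L (j n)) < \<epsilon>" using small[OF \<open>\<epsilon> > 0\<close>] by metis
  define K where "K = K0 \<union> (\<Union>n<N. L (j n))"
  have K: "compact K" unfolding K_def using K0 \<eta>L(4) by (intro compact_Un compact_UN) auto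
  have "measure (MM n t) (- K) \<le> \<epsilon>" for n
  proof (cases "n < N")
    case True
    then have "measure (MM n t) (- K) \<le> measure (MM n t) (- L (j n))"
      using compact_borel[OF \<eta>L(4)] by (intro S.finite_measure_mono) (auto simp: K_def)
    then show ?thesis using j[of n] by simp
  next
    case False
    have "measure (MM n t) (- K) \<le> measure (MM n t) (- K0)"
      using compact_borel[OF K0(1)] by (intro S.finite_measure_mono) (auto simp: K_def)
    then show ?thesis using large[of n] False by simp
  qed
  then show ?thesis using K by blast
qed

text \<open>Tightness at the single time \<open>t1\<close> is carried back to earlier times: a walk
  outside \<open>K'\<close> at time \<open>t\<close> whose remaining increment lies in
  \<open>V\<close> is outside \<open>K\<close> at time \<open>t1\<close>, and the increment does so
  with probability at least 1/2. Then \<open>big_jump\<close> is applied with \<open>K'\<close>; as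
  the complement of \<open>K'\<close> can be made as improbable as desired, the factor in front of
  \<open>s\<close> becomes arbitrarily small.\<close>

lemma tail_tight:
  "\<exists>t0>0. \<forall>\<eta>>0. \<exists>W. compact W \<and> (\<forall>n s. 0 < s \<longrightarrow> s \<le> t0 \<longrightarrow> measure (MM n s) (- W) \<le> \<eta> * s)"
proof -
  obtain \<eta> V0 V where "smooth \<eta>" "\<forall>x. 0 \<le> \<eta> x \<and> \<eta> x \<le> (1::real)"
    and V0: "open V0" "0 \<in> V0" "\<forall>x\<in>V0. \<eta> x = 1" "compact V" "V \<subseteq> UNIV" "\<forall>x. x \<notin> V \<longrightarrow> \<eta> x = 0"
    using cutoff_point[OF open_UNIV UNIV_I[of 0]] by (elim exE conjE) (rule that)
  have V0V: "V0 \<subseteq> V"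
  proof
    fix x assume "x \<in> V0"
    then show "x \<in> V" using V0(3,6) by (cases "x \<in> V") auto
  qed
  obtain t1 where t1: "t1 > 0" "\<And>n t. 0 \<le> t \<Longrightarrow> t \<le> t1 \<Longrightarrow> 1 - 1/20 \<le> measure (MM n t) V0"
    using small_times[OF V0(1,2), of "1/20"] by auto
  have V: "19/20 \<le> measure (MM n t) V" if "0 \<le> t" "t \<le> t1" for n t
  proof -
    have "measure (MM n t) V0 \<le> measure (MM n t) V"
      using V0V compact_borel[OF V0(4)] by (intro S.finite_measure_mono) auto
    then show ?thesis using t1(2)[OF that, of n] by simp
  qed
  have "\<exists>W. compact W \<and> (\<forall>n s. 0 < s \<longrightarrow> s \<le> t1 \<longrightarrow> measure (MM n s) (- W) \<le> e * s)" if "e > 0" for e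
  proof -
    \<comment> \<open>\<open>big_jump\<close> asks for 1/20, and its bound
      \<open>4 * \<epsilon>\<close> must not exceed \<open>e * t1 / 2\<close>, which is
      \<open>t1 / (2 * s)\<close> times \<open>e * s\<close>.\<close>
    define \<epsilon> where "\<epsilon> = min (1/20) (e * t1 / 8)"
    have \<epsilon>: "\<epsilon> > 0" "\<epsilon> \<le> 1/20" "\<epsilon> \<le> e * t1 / 8" using that t1(1) by (auto simp: \<epsilon>_def)
    obtain K where K: "compact K" "\<And>n. measure (MM n t1) (- K) \<le> \<epsilon> / 2"
      using tight_fixed_time[of t1 "\<epsilon> / 2"] t1(1) \<epsilon> by auto
    \<comment> \<open>The point \<open>0\<close> is inserted because \<open>big_jump\<close> wants
      the identity in the set.\<close>
    define K' where "K' = insert 0 ((\<lambda>(k, v). k - v) ` (K \<times> V))"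
    have cK': "compact K'" unfolding K'_def split_beta diff_conv_add_uminus
      by (intro compact_insert compact_continuous_image compact_Times K V0 continuous_intros)
    define W where "W = (\<lambda>(x, k, z). - x + k - z) ` (K' \<times> K' \<times> K')"
    have cW: "compact W" unfolding W_def split_beta diff_conv_add_uminus
      by (intro compact_continuous_image compact_Times cK' continuous_intros)
    have out: "measure (MM n t) (- K') \<le> \<epsilon>" if t: "0 \<le> t" "t \<le> t1" for n t
    proof -
      have "measure (MM n t) (- K') * measure (MM n (t1 - t)) V \<le> measure (MM n (t + (t1 - t))) (- K)"
      proof (rule S.conv_lower)
        show "x + y \<in> - K" if "x \<in> - K'" "y \<in> V" for x y
        proof
          assume "x + y \<in> K"
          then have "(x + y) - y \<in> K'" using that unfolding K'_def by force
          then show False using that by simp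
        qed
      qed (use t compact_borel K(1) cK' V0(4) in auto)
      also have "\<dots> \<le> \<epsilon> / 2" using K(2)[of n] by simp
      finally have "measure (MM n t) (- K') * measure (MM n (t1 - t)) V \<le> \<epsilon> / 2" .
      moreover have "measure (MM n t) (- K') * (1 / 2) \<le> measure (MM n t) (- K') * measure (MM n (t1 - t)) V"
        using V[of "t1 - t" n] t by (intro mult_left_mono) auto
      ultimately show ?thesis by simp
    qed
    have "measure (MM n s) (- W) \<le> e * s" if s: "0 < s" "s \<le> t1" for n s
    proof -
      obtain N where N: "N \<ge> 1" "real N * s \<le> t1" "t1 / (2 * s) \<le> real N" by (rule time_grid[OF s])
      have kt: "0 \<le> real k * s" "real k * s \<le> t1" if "k \<le> N" for k
      proof -
        have "real k * s \<le> real N * s" using that s by (intro mult_right_mono) auto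
        then show "real k * s \<le> t1" using N(2) by linarith
      qed (use s in simp)
      have "real N * measure (MM n s) (- W) \<le> 4 * \<epsilon>"
      proof (rule S.big_jump[where K = K'])
        show "y \<in> W" if "x \<in> K'" "z \<in> K'" "x + y + z \<in> K'" for x y z
        proof -
          have "y = - x + (x + y + z) - z" by (simp add: add.assoc[symmetric] del: add_uminus_conv_diff)
          then show ?thesis unfolding W_def using that by force
        qed
        show "measure (MM n (real k * s)) (- K') \<le> \<epsilon>" if "k \<le> N" for k by (rule out[OF kt[OF that]])
        show "4 / 5 \<le> measure (MM n (real k * s)) K'" if "k \<le> N" for k
          using out[OF kt[OF that], of n] V[OF kt[OF that], of n] \<epsilon>(2)
            S.measure_complement[OF compact_borel[OF cK'], of n "real k * s"] mass_ge[OF compact_borel[OF V0(4)], of n "real k * s"]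
          by linarith
      qed (use cK' cW compact_borel s \<epsilon> in \<open>auto simp: K'_def\<close>)
      moreover have "t1 / (2 * s) * measure (MM n s) (- W) \<le> real N * measure (MM n s) (- W)"
        using N(3) by (intro mult_right_mono) auto
      ultimately have "t1 / (2 * s) * measure (MM n s) (- W) \<le> e * t1 / 2" using \<epsilon>(3) by linarith
      then have "(t1 / (2 * s)) * measure (MM n s) (- W) \<le> (t1 / (2 * s)) * (e * s)" using s by (simp add: mult.commute)
      then show ?thesis using t1(1) s by (subst (asm) mult_le_cancel_left_pos) auto
    qed
    then show ?thesis using cW by blast
  qed
  then show ?thesis using t1(1) by blast
qed

end

section \<open>Uniform convergence of difference quotients\<close>

lemma (in conv_semigroup) E_telescope:
  assumes f: "bmeas f" and s: "s \<ge> 0"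
  shows "E (real N * s) f - f 0 = (\<Sum>k<N. E (real k * s) (\<lambda>x. E s (\<lambda>y. f (x + y)) - f x))"
proof (induction N)
  case 0
  then show ?case using E_0[OF f] by simp
next
  case (Suc N)
  have "E (real N * s + s) f = E (real N * s) (\<lambda>x. E s (\<lambda>y. f (x + y)))"
    using s by (intro E_conv f) auto
  moreover have "E (real N * s) (\<lambda>x. E s (\<lambda>y. f (x + y)) - f x) =
      E (real N * s) (\<lambda>x. E s (\<lambda>y. f (x + y))) - E (real N * s) f"
    by (intro E_diff bmeas_E_translate f)
  ultimately show ?case using Suc by (simp add: algebra_simps)
qed

context lie_family
begin

lemma csupp_bmeas:
  assumes "csupp_in S f" shows "bmeas f"
proof -
  obtain C where C: "\<forall>x. norm (f x) \<le> C" using csupp_in_bounded[OF assms] by (elim exE conjE) (rule that)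
  have "f \<in> borel_measurable borel"
    by (rule borel_measurable_continuous_onI[OF csupp_in_continuous[OF assms]])
  then show ?thesis
    by (rule bmeasI) (rule C[rule_format])
qed

definition diff_quot :: "nat \<Rightarrow> real \<Rightarrow> ('g \<Rightarrow> 'b::euclidean_space) \<Rightarrow> 'b" where
  "diff_quot n s f = (EE n s f - f 0) /\<^sub>R s"

definition diff_quot_at :: "nat \<Rightarrow> real \<Rightarrow> ('g \<Rightarrow> 'b::euclidean_space) \<Rightarrow> 'g \<Rightarrow> 'b" where
  "diff_quot_at n s f x = (EE n s (\<lambda>y. f (x + y)) - f x) /\<^sub>R s"

text \<open>The absolute value stands outside the integral: this is the drift. The mean of
  \<open>\<bar>zeta i\<bar>\<close> over \<open>s\<close> would be unbounded already for Brownian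
  motion, where it grows like the inverse square root of \<open>s\<close>.\<close>

definition moments :: "nat \<Rightarrow> real \<Rightarrow> real" where
  "moments n s = (\<Sum>i<d. \<bar>EE n s (zeta i) / s\<bar>) + EE n s zeta_sq / s"

lemma bmeas_zeta: "bmeas (zeta i)"
  by (rule csupp_bmeas[OF csupp_in_zeta])

lemma bmeas_zeta_sq: "bmeas zeta_sq"
  unfolding zeta_sq_def[abs_def] by (rule bmeas_sum) (rule csupp_bmeas[OF csupp_in_zeta_sq])

lemma borel_B1: "B1 \<in> sets borel"
  using open_B1 by simp

lemma bmeas_taylor_rem:
  fixes f :: "'g \<Rightarrow> 'b::euclidean_space"
  assumes "bmeas f" shows "bmeas (taylor_rem f x)"
  unfolding taylor_rem_def[abs_def]
  by (rule bmeas_diff[OF bmeas_diff[OF bmeas_translate[OF assms] bmeas_const]])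
    (intro bmeas_sum bmeas_scaleR bmeas_zeta bmeas_const)

lemma E_taylor_weight:
  assumes "s > 0"
  shows "EE n s (\<lambda>y. c * (zeta_sq y + indicator (- B1) y)) = c * s * (EE n s zeta_sq / s + measure (MM n s) (- B1) / s)"
proof -
  have "EE n s (\<lambda>y. c * (zeta_sq y + indicator (- B1) y)) = c * (EE n s zeta_sq + measure (MM n s) (- B1))"
    using borel_B1 S.E_add[OF bmeas_zeta_sq bmeas_indicator[of "- B1"], of n s] by simp
  then show ?thesis using assms by (simp add: field_simps)
qed

lemma bmeas_weight: "bmeas (\<lambda>y. c * (zeta_sq y + indicator (- B1) y))"
  using borel_B1 by (intro bmeas_bounded_linear[OF bounded_linear_mult_right] bmeas_add bmeas_zeta_sq bmeas_indicator) auto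

text \<open>Drift, compensated jumps and killing, as in the Levy-Khintchine formula but for a
  positive time \<open>s\<close>; the killing term is the mass that \<open>MM n s\<close>
  lacks.\<close>

lemma diff_quot_at_expand:
  fixes f :: "'g \<Rightarrow> 'b::euclidean_space"
  assumes f: "bmeas f" and s: "s > 0"
  shows "diff_quot_at n s f x = (\<Sum>i<d. (EE n s (zeta i) / s) *\<^sub>R lfield i f x) + EE n s (taylor_rem f x) /\<^sub>R s -
    ((1 - measure (MM n s) UNIV) / s) *\<^sub>R f x"
proof -
  have "EE n s (\<lambda>y. f (x + y)) = EE n s (\<lambda>y. taylor_rem f x y + ((\<Sum>i<d. zeta i y *\<^sub>R lfield i f x) + f x))"
    by (simp add: taylor_rem_def)
  also have "\<dots> = EE n s (taylor_rem f x) + EE n s (\<lambda>y. (\<Sum>i<d. zeta i y *\<^sub>R lfield i f x) + f x)"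
    by (intro S.E_add bmeas_taylor_rem f bmeas_add bmeas_const bmeas_sum bmeas_scaleR bmeas_zeta)
  also have "EE n s (\<lambda>y. (\<Sum>i<d. zeta i y *\<^sub>R lfield i f x) + f x) =
      EE n s (\<lambda>y. (\<Sum>i<d. zeta i y *\<^sub>R lfield i f x)) + EE n s (\<lambda>y. f x)"
    by (intro S.E_add bmeas_const bmeas_sum bmeas_scaleR bmeas_zeta)
  also have "EE n s (\<lambda>y. (\<Sum>i<d. zeta i y *\<^sub>R lfield i f x)) = (\<Sum>i<d. EE n s (\<lambda>y. zeta i y *\<^sub>R lfield i f x))"
    by (intro S.E_sum bmeas_scaleR bmeas_zeta bmeas_const)
  also have "\<dots> = (\<Sum>i<d. EE n s (zeta i) *\<^sub>R lfield i f x)"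
    by (intro sum.cong refl S.E_bounded_linear[OF bounded_linear_scaleR_left] bmeas_zeta)
  finally have "EE n s (\<lambda>y. f (x + y)) - f x = EE n s (taylor_rem f x) + (\<Sum>i<d. EE n s (zeta i) *\<^sub>R lfield i f x)
      - (1 - measure (MM n s) UNIV) *\<^sub>R f x"
    by (simp add: algebra_simps)
  then show ?thesis
    by (simp add: diff_quot_at_def scaleR_add_right scaleR_diff_right scaleR_sum_right divide_inverse mult.commute)
qed

lemma moments_parts:
  assumes "s > 0"
  shows "0 \<le> EE n s zeta_sq / s" "0 \<le> moments n s"
proof -
  have "0 \<le> EE n s zeta_sq" by (rule Bochner_Integration.integral_nonneg) (rule zeta_sq_nonneg)
  then show "0 \<le> EE n s zeta_sq / s" using assms by simp
  then show "0 \<le> moments n s" unfolding moments_def by (intro add_nonneg_nonneg sum_nonneg abs_ge_zero)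
qed

text \<open>By telescoping, the quotient for \<open>N * s\<close> is the average over
  \<open>k < N\<close> of the mean of \<open>diff_quot_at n s f\<close> at time
  \<open>k * s\<close>, while the quotient for \<open>s\<close> is its value at the identity. Up to
  time \<open>t1\<close> the walk is near the identity except with probability \<epsilon>, and there
  the Taylor data of \<open>f\<close> are within \<epsilon> of those at the identity. Both errors
  carry the factor \<epsilon>; the moments come in because the Taylor data are integrated against
  \<open>MM n s\<close>.\<close>

lemma difference_quotient_step:
  fixes f :: "'g \<Rightarrow> 'b::euclidean_space"
  assumes f: "csupp_in UNIV f" and "\<delta> > 0"
  shows "\<exists>t1>0. \<forall>n N s. N \<ge> 1 \<longrightarrow> 0 < s \<longrightarrow> real N * s \<le> t1 \<longrightarrow>
    norm (diff_quot n (real N * s) f - diff_quot n s f) \<le> \<delta> * (moments n s + 1)"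
proof -
  obtain K where K: "smooth f" "compact K" "\<And>x. x \<notin> K \<Longrightarrow> f x = 0"
    using f by (auto simp: csupp_in_def)
  have bf: "bmeas f" by (rule csupp_bmeas[OF f])
  obtain C where C: "C \<ge> 0" "\<And>x y. norm (taylor_rem f x y) \<le> C * (zeta_sq y + indicator (- B1) y)"
    "\<And>x. norm (f x) \<le> C" "\<And>i x. i < d \<Longrightarrow> norm (lfield i f x) \<le> C"
    using taylor_bound[OF K] by blast
  obtain CB tB where CB: "CB \<ge> 0" "tB > 0" "\<And>n s. 0 < s \<Longrightarrow> s \<le> tB \<Longrightarrow> measure (MM n s) (- B1) \<le> CB * s"
    using tail_bound[OF open_B1 zero_in_B1] by blast
  obtain CM tM where CM: "CM \<ge> 0" "tM > 0" "\<And>n s. 0 < s \<Longrightarrow> s \<le> tM \<Longrightarrow> 1 - measure (MM n s) UNIV \<le> CM * s"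
    using mass_bound by blast
  define D where "D = 1 + CB + CM"
  have D: "D \<ge> 1" using CB CM by (simp add: D_def)
  \<comment> \<open>\<open>1 + 3 * C\<close> collects the errors: 1 from positions in
    \<open>U\<close>, \<open>2 * C\<close> from positions outside \<open>U\<close>, and
    \<open>C\<close> from the mass lost up to time \<open>k * s\<close>. \<open>D\<close> absorbs
    the tail and mass constants into \<open>moments n s + 1\<close>.\<close>
  define \<epsilon> where "\<epsilon> = \<delta> / ((1 + 3 * C) * D)"
  have \<epsilon>: "\<epsilon> > 0" using \<open>\<delta> > 0\<close> C(1) D by (simp add: \<epsilon>_def)
  obtain U where U: "open U" "0 \<in> U"
    "\<And>x y. x \<in> U \<Longrightarrow> norm (taylor_rem f x y - taylor_rem f 0 y) \<le> \<epsilon> * (zeta_sq y + indicator (- B1) y)"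
    "\<And>x. x \<in> U \<Longrightarrow> norm (f x - f 0) \<le> \<epsilon>"
    "\<And>x i. x \<in> U \<Longrightarrow> i < d \<Longrightarrow> norm (lfield i f x - lfield i f 0) \<le> \<epsilon>"
    using taylor_equicontinuous[OF K \<epsilon>] by blast
  obtain tU where tU: "tU > 0" "\<And>n t. 0 \<le> t \<Longrightarrow> t \<le> tU \<Longrightarrow> 1 - \<epsilon> \<le> measure (MM n t) U"
    using small_times[OF U(1,2) \<epsilon>] by blast
  define t1 where "t1 = min tU (min tB tM)"
  have "norm (diff_quot n (real N * s) f - diff_quot n s f) \<le> \<delta> * (moments n s + 1)"
    if N: "N \<ge> 1" "0 < s" "real N * s \<le> t1" for n N s
  proof -
    have "1 * s \<le> real N * s" using N by (intro mult_right_mono) auto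
    then have "s \<le> t1" using N(3) by linarith
    then have s: "s \<le> tB" "s \<le> tM" by (simp_all add: t1_def)
    define R where "R = moments n s + CB + CM"
    have R: "0 \<le> R" "R \<le> D * (moments n s + 1)"
    proof -
      show "0 \<le> R" using moments_parts[OF N(2)] CB CM by (simp add: R_def)
      have "0 \<le> (CB + CM) * moments n s" using moments_parts[OF N(2)] CB CM by (intro mult_nonneg_nonneg) auto
      then show "R \<le> D * (moments n s + 1)" by (simp add: R_def D_def algebra_simps)
    qed
    have tail: "measure (MM n s) (- B1) / s \<le> CB" "\<bar>(1 - measure (MM n s) UNIV) / s\<bar> \<le> CM"
      using CB(3)[OF N(2) s(1), of n] CM(3)[OF N(2) s(2), of n] S.measure_le_1[of n s UNIV] N(2)
      by (simp_all add: field_simps)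
    \<comment> \<open>Used twice: with \<open>e = C\<close> for the size of
      \<open>diff_quot_at\<close>, and with \<open>e = \<epsilon>\<close> for its variation over
      \<open>U\<close>.\<close>
    have general: "norm ((\<Sum>i<d. (EE n s (zeta i) / s) *\<^sub>R v i) + EE n s g /\<^sub>R s - ((1 - measure (MM n s) UNIV) / s) *\<^sub>R z) \<le> e * R"
      if "0 \<le> e" "\<And>i. i < d \<Longrightarrow> norm (v i) \<le> e" "\<And>y. norm (g y) \<le> e * (zeta_sq y + indicator (- B1) y)" "norm z \<le> e"
      for v :: "nat \<Rightarrow> 'b" and g z e
    proof -
      have "norm (\<Sum>i<d. (EE n s (zeta i) / s) *\<^sub>R v i) \<le> (\<Sum>i<d. \<bar>EE n s (zeta i) / s\<bar> * e)"
        by (rule order_trans[OF norm_sum], rule sum_mono)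
          (use that(2) in \<open>auto simp only: norm_scaleR lessThan_iff intro!: mult_left_mono\<close>)
      also have "\<dots> = e * (\<Sum>i<d. \<bar>EE n s (zeta i) / s\<bar>)" by (simp only: sum_distrib_left mult.commute)
      finally have 1: "norm (\<Sum>i<d. (EE n s (zeta i) / s) *\<^sub>R v i) \<le> e * (\<Sum>i<d. \<bar>EE n s (zeta i) / s\<bar>)" .
      have "norm (EE n s g) \<le> EE n s (\<lambda>y. e * (zeta_sq y + indicator (- B1) y))"
        by (rule S.E_norm_le[OF bmeas_weight that(3)])
      also have "\<dots> = e * s * (EE n s zeta_sq / s + measure (MM n s) (- B1) / s)"
        by (rule E_taylor_weight[OF N(2)])
      also have "\<dots> \<le> e * s * (EE n s zeta_sq / s + CB)"
        using tail(1) that(1) N(2) by (intro mult_left_mono add_left_mono) auto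
      finally have g: "norm (EE n s g) \<le> e * s * (EE n s zeta_sq / s + CB)" .
      have "norm (EE n s g /\<^sub>R s) = norm (EE n s g) / s" using N(2) by (simp add: divide_inverse mult.commute)
      also have "\<dots> \<le> e * s * (EE n s zeta_sq / s + CB) / s"
        using g N(2) by (intro divide_right_mono) auto
      also have "\<dots> = e * (EE n s zeta_sq / s + CB)" using N(2) by simp
      finally have 2: "norm (EE n s g /\<^sub>R s) \<le> e * (EE n s zeta_sq / s + CB)" .
      have 3: "norm (((1 - measure (MM n s) UNIV) / s) *\<^sub>R z) \<le> CM * e"
        unfolding norm_scaleR using tail(2) that(4) CM(1) by (intro mult_mono) auto
      have "norm ((\<Sum>i<d. (EE n s (zeta i) / s) *\<^sub>R v i) + EE n s g /\<^sub>R s - ((1 - measure (MM n s) UNIV) / s) *\<^sub>R z)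
        \<le> e * (\<Sum>i<d. \<bar>EE n s (zeta i) / s\<bar>) + e * (EE n s zeta_sq / s + CB) + CM * e"
        by (rule order_trans[OF norm_triangle_ineq4 add_mono[OF order_trans[OF norm_triangle_ineq add_mono[OF 1 2]] 3]])
      then show ?thesis by (simp add: R_def moments_def algebra_simps)
    qed
    have bound: "norm (diff_quot_at n s f x) \<le> C * R" for x
      unfolding diff_quot_at_expand[OF bf N(2)] by (rule general) (use C in auto)
    have diff: "norm (diff_quot_at n s f x - diff_quot_at n s f 0) \<le> \<epsilon> * R" if "x \<in> U" for x
    proof -
      have "diff_quot_at n s f x - diff_quot_at n s f 0 = (\<Sum>i<d. (EE n s (zeta i) / s) *\<^sub>R (lfield i f x - lfield i f 0)) +
          EE n s (\<lambda>y. taylor_rem f x y - taylor_rem f 0 y) /\<^sub>R s - ((1 - measure (MM n s) UNIV) / s) *\<^sub>R (f x - f 0)"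
        unfolding diff_quot_at_expand[OF bf N(2)] S.E_diff[OF bmeas_taylor_rem[OF bf] bmeas_taylor_rem[OF bf]]
          scaleR_diff_right sum_subtractf by simp
      also have "norm \<dots> \<le> \<epsilon> * R" by (rule general) (use U that \<epsilon> in auto)
      finally show ?thesis .
    qed
    have bA: "bmeas (diff_quot_at n s f)" unfolding diff_quot_at_def[abs_def]
      by (intro bmeas_scaleR_right bmeas_diff bf S.bmeas_E_translate)
    have term_le: "norm (EE n (real k * s) (diff_quot_at n s f) - diff_quot_at n s f 0) \<le> (1 + 3 * C) * \<epsilon> * R" if "k < N" for k
    proof -
      have "real k * s \<le> real N * s" using that N(2) by (intro mult_right_mono) auto
      then have "real k * s \<le> t1" using N(3) by linarith
      then have kt: "0 \<le> real k * s" "real k * s \<le> tU" using N(2) by (simp_all add: t1_def)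
      have mU: "1 - \<epsilon> \<le> measure (MM n (real k * s)) U" by (rule tU(2)[OF kt])
      have bU: "U \<in> sets borel" using U(1) by simp
      have mm: "1 - measure (MM n (real k * s)) UNIV \<le> \<epsilon>" "measure (MM n (real k * s)) (- U) \<le> \<epsilon>"
        using mU mass_ge[OF bU, of n "real k * s"] S.measure_complement[OF bU, of n "real k * s"]
          S.measure_le_1[of n "real k * s" UNIV] by linarith+
      have "norm (EE n (real k * s) (\<lambda>x. diff_quot_at n s f x - diff_quot_at n s f 0)) \<le>
          EE n (real k * s) (\<lambda>x. \<epsilon> * R + (2 * C * R) * indicator (- U) x)"
      proof (rule S.E_norm_le)
        show "bmeas (\<lambda>x. \<epsilon> * R + (2 * C * R) * indicator (- U) x)"
          using bU by (intro bmeas_add bmeas_const bmeas_bounded_linear[OF bounded_linear_mult_right] bmeas_indicator) auto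
        fix x
        have "norm (diff_quot_at n s f x - diff_quot_at n s f 0) \<le> C * R + C * R"
          by (rule order_trans[OF norm_triangle_ineq4 add_mono[OF bound bound]])
        moreover have "0 \<le> \<epsilon> * R" using \<epsilon> R by simp
        ultimately show "norm (diff_quot_at n s f x - diff_quot_at n s f 0) \<le> \<epsilon> * R + (2 * C * R) * indicator (- U) x"
          using diff[of x] by (cases "x \<in> U") auto
      qed
      also have "\<dots> = measure (MM n (real k * s)) UNIV * (\<epsilon> * R) + 2 * C * R * measure (MM n (real k * s)) (- U)"
        using bU by (subst S.E_add) (auto intro!: bmeas_bounded_linear[OF bounded_linear_mult_right] bmeas_indicator)
      also have "\<dots> \<le> 1 * (\<epsilon> * R) + 2 * C * R * \<epsilon>"
        using mm(2) S.measure_le_1[of n "real k * s" UNIV] R \<epsilon> C(1)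
        by (intro add_mono mult_right_mono mult_left_mono) auto
      finally have 1: "norm (EE n (real k * s) (\<lambda>x. diff_quot_at n s f x - diff_quot_at n s f 0)) \<le> \<epsilon> * R + 2 * C * R * \<epsilon>" by simp
      have "EE n (real k * s) (\<lambda>x. diff_quot_at n s f x - diff_quot_at n s f 0) =
          EE n (real k * s) (diff_quot_at n s f) - measure (MM n (real k * s)) UNIV *\<^sub>R diff_quot_at n s f 0"
        using S.E_diff[OF bA bmeas_const, of n "real k * s"] by simp
      then have eq: "EE n (real k * s) (diff_quot_at n s f) - diff_quot_at n s f 0 =
          EE n (real k * s) (\<lambda>x. diff_quot_at n s f x - diff_quot_at n s f 0) - (1 - measure (MM n (real k * s)) UNIV) *\<^sub>R diff_quot_at n s f 0"
        by (simp add: algebra_simps)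
      have "norm ((1 - measure (MM n (real k * s)) UNIV) *\<^sub>R diff_quot_at n s f 0) \<le> \<epsilon> * (C * R)"
        unfolding norm_scaleR using mm(1) S.measure_le_1[of n "real k * s" UNIV] bound \<epsilon> by (intro mult_mono) auto
      then have "norm (EE n (real k * s) (diff_quot_at n s f) - diff_quot_at n s f 0) \<le> (\<epsilon> * R + 2 * C * R * \<epsilon>) + \<epsilon> * (C * R)"
        unfolding eq using 1 by (intro order_trans[OF norm_triangle_ineq4] add_mono)
      then show ?thesis by (simp add: algebra_simps)
    qed
    have "EE n (real N * s) f - f 0 = (\<Sum>k<N. s *\<^sub>R EE n (real k * s) (diff_quot_at n s f))"
    proof -
      have "s *\<^sub>R EE n (real k * s) (diff_quot_at n s f) = EE n (real k * s) (\<lambda>x. EE n s (\<lambda>y. f (x + y)) - f x)" for k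
      proof -
        have "s *\<^sub>R EE n (real k * s) (diff_quot_at n s f) = EE n (real k * s) (\<lambda>x. s *\<^sub>R diff_quot_at n s f x)" by simp
        also have "(\<lambda>x. s *\<^sub>R diff_quot_at n s f x) = (\<lambda>x. EE n s (\<lambda>y. f (x + y)) - f x)"
          using N(2) by (simp add: diff_quot_at_def fun_eq_iff)
        finally show ?thesis .
      qed
      then show ?thesis using S.E_telescope[OF bf, of s n N] N(2) by simp
    qed
    then have tele: "EE n (real N * s) f - f 0 = s *\<^sub>R (\<Sum>k<N. EE n (real k * s) (diff_quot_at n s f))"
      by (simp add: scaleR_sum_right)
    have "diff_quot n (real N * s) f = (\<Sum>k<N. EE n (real k * s) (diff_quot_at n s f)) /\<^sub>R real N"
      unfolding diff_quot_def tele using N by simp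
    moreover have "diff_quot n s f = diff_quot_at n s f 0" by (simp add: diff_quot_def diff_quot_at_def)
    moreover have "(\<Sum>k<N. EE n (real k * s) (diff_quot_at n s f) - diff_quot_at n s f 0) =
        (\<Sum>k<N. EE n (real k * s) (diff_quot_at n s f)) - real N *\<^sub>R diff_quot_at n s f 0"
      by (simp add: sum_subtractf sum_constant_scaleR)
    ultimately have "diff_quot n (real N * s) f - diff_quot n s f = (\<Sum>k<N. EE n (real k * s) (diff_quot_at n s f) - diff_quot_at n s f 0) /\<^sub>R real N"
      using N(1) by (simp add: scaleR_diff_right)
    also have "norm \<dots> \<le> (\<Sum>k<N. (1 + 3 * C) * \<epsilon> * R) / real N"
    proof -
      have "norm (\<Sum>k<N. EE n (real k * s) (diff_quot_at n s f) - diff_quot_at n s f 0) \<le> (\<Sum>k<N. (1 + 3 * C) * \<epsilon> * R)"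
        by (rule order_trans[OF norm_sum], rule sum_mono) (use term_le in auto)
      then show ?thesis using N by (simp add: divide_inverse mult.commute[of _ "inverse _"] mult_left_mono)
    qed
    also have "\<dots> = (1 + 3 * C) * \<epsilon> * R" using N by simp
    also have "\<dots> \<le> (1 + 3 * C) * \<epsilon> * (D * (moments n s + 1))"
      using R(2) \<epsilon> C(1) by (intro mult_left_mono) auto
    also have "\<dots> = \<delta> * (moments n s + 1)"
      using C(1) D by (simp add: \<epsilon>_def)
    finally show ?thesis .
  qed
  moreover have "t1 > 0" using tU CB CM by (simp add: t1_def)
  ultimately show ?thesis by blast
qed

lemma finite_positive_min:
  fixes m :: nat
  assumes "\<And>i. i < m \<Longrightarrow> \<exists>t>0. \<forall>s. s \<le> t \<longrightarrow> P i s"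
  shows "\<exists>t>0::real. \<forall>i<m. \<forall>s. s \<le> t \<longrightarrow> P i s"
  using assms
proof (induction m)
  case (Suc m)
  then obtain t where t: "t > 0" "\<And>i s. i < m \<Longrightarrow> s \<le> t \<Longrightarrow> P i s" by (meson less_SucI)
  obtain t' where t': "t' > 0" "\<And>s. s \<le> t' \<Longrightarrow> P m s" using Suc.prems[of m] by auto
  show ?case using t t' by (intro exI[of _ "min t t'"]) (auto simp: less_Suc_eq)
qed (auto intro: exI[of _ 1])

text \<open>
  The estimate for the increment of the difference quotient involves \<open>moments\<close> only with a
  small factor; applied to the coordinate functions and their squares it therefore bounds them.
\<close>

lemma moments_bounded: "\<exists>C t0. t0 > 0 \<and> (\<forall>n s. 0 < s \<longrightarrow> s \<le> t0 \<longrightarrow> moments n s \<le> C)"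
proof -
  \<comment> \<open>The \<open>2 * d\<close> estimates, for the coordinates and for their squares,
    together contribute \<open>2 * d * \<delta>\<close> times \<open>moments n s + 1\<close>, which
    this choice makes at most half of \<open>moments n s + 1\<close>. The summand 1 covers dimension
    zero.\<close>
  define \<delta> where "\<delta> = 1 / (4 * real d + 1)"
  have \<delta>: "\<delta> > 0" by (simp add: \<delta>_def add_nonneg_pos)
  have unif: "\<exists>t1>0. \<forall>i<d. \<forall>t. t \<le> t1 \<longrightarrow> (\<forall>n N s. N \<ge> 1 \<longrightarrow> 0 < s \<longrightarrow> real N * s \<le> t \<longrightarrow>
    norm (diff_quot n (real N * s) (F i) - diff_quot n s (F i)) \<le> \<delta> * (moments n s + 1))"
    if "\<And>i. csupp_in UNIV (F i)" for F :: "nat \<Rightarrow> 'g \<Rightarrow> real"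
  proof (rule finite_positive_min)
    fix i
    from difference_quotient_step[OF that[of i] \<delta>] obtain t1 where
      "t1 > 0" "\<And>n N s. N \<ge> 1 \<Longrightarrow> 0 < s \<Longrightarrow> real N * s \<le> t1 \<Longrightarrow>
        norm (diff_quot n (real N * s) (F i) - diff_quot n s (F i)) \<le> \<delta> * (moments n s + 1)" by blast
    then show "\<exists>t>0. \<forall>s. s \<le> t \<longrightarrow> (\<forall>n N sa. N \<ge> 1 \<longrightarrow> 0 < sa \<longrightarrow> real N * sa \<le> s \<longrightarrow>
        norm (diff_quot n (real N * sa) (F i) - diff_quot n sa (F i)) \<le> \<delta> * (moments n sa + 1))"
      by (meson order_trans)
  qed
  obtain t1 where t1: "t1 > 0" "\<And>i n N s. i < d \<Longrightarrow> N \<ge> 1 \<Longrightarrow> 0 < s \<Longrightarrow> real N * s \<le> t1 \<Longrightarrow>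
    norm (diff_quot n (real N * s) (zeta i) - diff_quot n s (zeta i)) \<le> \<delta> * (moments n s + 1)"
    using unif[of zeta, OF csupp_in_zeta] by blast
  obtain t2 where t2: "t2 > 0" "\<And>i n N s. i < d \<Longrightarrow> N \<ge> 1 \<Longrightarrow> 0 < s \<Longrightarrow> real N * s \<le> t2 \<Longrightarrow>
    norm (diff_quot n (real N * s) (\<lambda>x. (zeta i x)\<^sup>2) - diff_quot n s (\<lambda>x. (zeta i x)\<^sup>2)) \<le> \<delta> * (moments n s + 1)"
    using unif[of "\<lambda>i x. (zeta i x)\<^sup>2", OF csupp_in_zeta_sq] by blast
  obtain Z where Z: "Z \<ge> 0" "\<And>i x. i < d \<Longrightarrow> \<bar>zeta i x\<bar> \<le> Z" using zeta_bounded by metis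
  define t where "t = min t1 t2"
  have t: "t > 0" using t1 t2 by (simp add: t_def)
  define B where "B = (real d * Z + real d * Z\<^sup>2) * (2 / t)"
  have "moments n s \<le> 2 * B + 1" if s: "0 < s" "s \<le> t" for n s
  proof -
    obtain N where N: "N \<ge> 1" "real N * s \<le> t" "t / (2 * s) \<le> real N" by (rule time_grid[OF s])
    have Ns: "real N * s \<ge> t / 2" using N(3) s by (simp add: field_simps)
    have Nt: "real N * s \<le> t1" "real N * s \<le> t2" using N(2) by (simp_all add: t_def)
    \<comment> \<open>At a time of at least \<open>t / 2\<close> the quotient is controlled by the
      sup norm alone.\<close>
    have big: "norm (diff_quot n (real N * s) g) \<le> c * (2 / t)" if "g 0 = 0" "\<And>x. norm (g x) \<le> c" for g :: "'g \<Rightarrow> real" and c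
    proof -
      have c: "0 \<le> c" using that(2)[of 0] norm_ge_zero order_trans by blast
      have "norm (diff_quot n (real N * s) g) = norm (EE n (real N * s) g) * inverse (real N * s)"
        using s by (simp add: diff_quot_def that(1) abs_mult)
      also have "\<dots> \<le> c * inverse (t / 2)"
        using Ns t c s(1) by (intro mult_mono S.E_norm_const that(2) le_imp_inverse_le) auto
      finally show ?thesis by simp
    qed
    have e0: "diff_quot n s (zeta i) = EE n s (zeta i) / s" for i by (simp add: diff_quot_def divide_inverse)
    have le: "\<bar>a\<bar> \<le> x + y" if "norm (b - a) \<le> y" "norm b \<le> x" for a b x y :: real
      using that by auto
    have 1: "\<bar>EE n s (zeta i) / s\<bar> \<le> Z * (2 / t) + \<delta> * (moments n s + 1)" if "i < d" for i
      unfolding e0[symmetric] by (rule le[OF t1(2)[OF that N(1) s(1) Nt(1)] big]) (use Z that in auto)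
    have 2: "\<bar>EE n s (\<lambda>x. (zeta i x)\<^sup>2) / s\<bar> \<le> Z\<^sup>2 * (2 / t) + \<delta> * (moments n s + 1)" if "i < d" for i
    proof -
      have "EE n s (\<lambda>x. (zeta i x)\<^sup>2) / s = diff_quot n s (\<lambda>x. (zeta i x)\<^sup>2)" by (simp add: diff_quot_def divide_inverse)
      moreover have "norm ((zeta i x)\<^sup>2) \<le> Z\<^sup>2" for x using power_mono[OF Z(2)[OF that, of x], of 2] by simp
      ultimately show ?thesis
        using le[OF t2(2)[OF that N(1) s(1) Nt(2)] big[of "\<lambda>x. (zeta i x)\<^sup>2" "Z\<^sup>2"]] by simp
    qed
    have "EE n s zeta_sq = (\<Sum>i<d. EE n s (\<lambda>x. (zeta i x)\<^sup>2))"
      unfolding zeta_sq_def[abs_def] by (intro S.E_sum csupp_bmeas[OF csupp_in_zeta_sq])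
    then have "moments n s = (\<Sum>i<d. \<bar>EE n s (zeta i) / s\<bar>) + (\<Sum>i<d. EE n s (\<lambda>x. (zeta i x)\<^sup>2) / s)"
      by (simp add: moments_def sum_divide_distrib)
    also have "\<dots> \<le> (\<Sum>i<d. Z * (2 / t) + \<delta> * (moments n s + 1)) + (\<Sum>i<d. Z\<^sup>2 * (2 / t) + \<delta> * (moments n s + 1))"
      by (intro add_mono sum_mono order_trans[OF abs_ge_self 2] 1) auto
    also have "\<dots> = B + (2 * real d * \<delta>) * (moments n s + 1)" by (simp add: B_def algebra_simps)
    also have "\<dots> \<le> B + (1 / 2) * (moments n s + 1)"
      using moments_parts(2)[OF s(1), of n] by (intro add_left_mono mult_right_mono) (auto simp: \<delta>_def field_simps)
    finally have "2 * moments n s \<le> 2 * B + (moments n s + 1)" by (simp add: field_simps)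
    then show ?thesis by simp
  qed
  then show ?thesis using t by blast
qed

lemma diff_quot_uniform:
  fixes f :: "'g \<Rightarrow> 'b::euclidean_space"
  assumes f: "csupp_in UNIV f" and "\<delta> > 0"
  shows "\<exists>t1>0. \<forall>n s N. 0 < s \<longrightarrow> s \<le> t1 \<longrightarrow> N \<ge> 1 \<longrightarrow> norm (diff_quot n s f - diff_quot n (s / real N) f) \<le> \<delta>"
proof -
  obtain C t0 where C: "t0 > 0" "\<And>n s. 0 < s \<Longrightarrow> s \<le> t0 \<Longrightarrow> moments n s \<le> C" using moments_bounded by blast
  have C0: "C + 1 > 0" using C(2)[of t0 0] moments_parts(2)[of t0 0] C(1) by linarith
  then have "\<delta> / (C + 1) > 0" using \<open>\<delta> > 0\<close> by simp
  from difference_quotient_step[OF f this] obtain t1 where t1: "t1 > 0"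
    "\<And>n N s. N \<ge> 1 \<Longrightarrow> 0 < s \<Longrightarrow> real N * s \<le> t1 \<Longrightarrow>
      norm (diff_quot n (real N * s) f - diff_quot n s f) \<le> \<delta> / (C + 1) * (moments n s + 1)" by blast
  have "norm (diff_quot n s f - diff_quot n (s / real N) f) \<le> \<delta>"
    if s: "0 < s" "s \<le> min t0 t1" "N \<ge> 1" for n s N
  proof -
    have sN: "0 < s / real N" "real N * (s / real N) = s" using s by simp_all
    have "s / real N \<le> s / 1" using s by (intro divide_left_mono) auto
    then have "moments n (s / real N) \<le> C" using s sN by (intro C(2)) auto
    have "norm (diff_quot n s f - diff_quot n (s / real N) f) \<le> \<delta> / (C + 1) * (moments n (s / real N) + 1)"
      using t1(2)[OF s(3) sN(1), of n] s sN(2) by simp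
    also have "\<dots> \<le> \<delta> / (C + 1) * (C + 1)"
      using \<open>moments n (s / real N) \<le> C\<close> C0 \<open>\<delta> > 0\<close> by (intro mult_left_mono) auto
    finally show ?thesis using C0 by simp
  qed
  then show ?thesis using C(1) t1(1) by (intro exI[of _ "min t0 t1"]) auto
qed

lemma EE_tendsto_euclidean:
  fixes f :: "'g \<Rightarrow> 'b::euclidean_space"
  assumes f: "continuous_on UNIV f" "bounded (range f)" and "t \<ge> 0"
  shows "(\<lambda>n. EE n t f) \<longlonglongrightarrow> EE 0 t f"
proof (subst tendsto_componentwise_iff, intro ballI)
  fix b :: 'b assume "b \<in> Basis"
  have bf: "bmeas f" by (rule bmeas_continuous[OF f])
  have eq: "EE n t f \<bullet> b = EE n t (\<lambda>x. f x \<bullet> b)" for n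
    by (rule S.E_bounded_linear[OF bounded_linear_inner_left bf, symmetric])
  show "(\<lambda>n. EE n t f \<bullet> b) \<longlonglongrightarrow> EE 0 t f \<bullet> b"
    unfolding eq
  proof (rule EE_tendsto[OF _ _ \<open>t \<ge> 0\<close>])
    show "continuous_on UNIV (\<lambda>x. f x \<bullet> b)" by (intro continuous_intros f)
    have "bounded ((\<lambda>x. x \<bullet> b) ` range f)" by (rule bounded_linear_image[OF f(2) bounded_linear_inner_left])
    then show "bounded (range (\<lambda>x. f x \<bullet> b))" by (simp add: image_image)
  qed
qed

text \<open>The bound of \<open>diff_quot_uniform\<close> is the same for every \<open>N\<close>, so
  \<open>N\<close> may tend to infinity with \<open>n\<close> and \<open>s\<close> fixed; the
  quotient for \<open>s / N\<close> then tends to \<open>L n\<close>.\<close>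

lemma generator_uniform:
  fixes f :: "'g \<Rightarrow> 'b::euclidean_space"
  assumes f: "csupp_in UNIV f" and L: "\<And>n. ((\<lambda>s. diff_quot n s f) \<longlongrightarrow> L n) (at_right 0)" and "\<delta> > 0"
  shows "\<exists>t1>0. \<forall>n s. 0 < s \<longrightarrow> s \<le> t1 \<longrightarrow> norm (diff_quot n s f - L n) \<le> \<delta>"
proof -
  obtain t1 where t1: "t1 > 0" "\<And>n s N. 0 < s \<Longrightarrow> s \<le> t1 \<Longrightarrow> N \<ge> 1 \<Longrightarrow> norm (diff_quot n s f - diff_quot n (s / real N) f) \<le> \<delta>"
    using diff_quot_uniform[OF f \<open>\<delta> > 0\<close>] by blast
  have "norm (diff_quot n s f - L n) \<le> \<delta>" if s: "0 < s" "s \<le> t1" for n s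
  proof (rule LIMSEQ_le_const2)
    have "(\<lambda>N. s * inverse (real (Suc N))) \<longlonglongrightarrow> s * 0"
      by (intro tendsto_mult tendsto_const LIMSEQ_inverse_real_of_nat)
    then have "filterlim (\<lambda>N. s / real (Suc N)) (at_right 0) sequentially"
      using s by (auto simp: filterlim_at divide_inverse intro!: always_eventually)
    from filterlim_compose[OF L this]
    have "(\<lambda>N. diff_quot n (s / real (Suc N)) f) \<longlonglongrightarrow> L n" .
    then show "(\<lambda>N. norm (diff_quot n s f - diff_quot n (s / real (Suc N)) f)) \<longlonglongrightarrow> norm (diff_quot n s f - L n)"
      by (intro tendsto_intros)
    show "\<exists>N. \<forall>k\<ge>N. norm (diff_quot n s f - diff_quot n (s / real (Suc k)) f) \<le> \<delta>"
      using t1(2)[OF s, of "Suc _"] by auto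
  qed
  then show ?thesis using t1(1) by blast
qed

text \<open>By uniformity one \<open>s\<close> serves all \<open>n\<close>, and at this fixed time
  weak convergence applies.\<close>

lemma generator_tendsto:
  fixes f :: "'g \<Rightarrow> 'b::euclidean_space"
  assumes f: "csupp_in UNIV f" and L: "\<And>n. ((\<lambda>s. diff_quot n s f) \<longlongrightarrow> L n) (at_right 0)"
  shows "L \<longlonglongrightarrow> L 0"
proof (rule metric_LIMSEQ_I)
  fix e :: real assume "e > 0"
  then have "e / 4 > 0" by simp
  from generator_uniform[OF f L this] obtain s where s: "s > 0" "\<And>n. norm (diff_quot n s f - L n) \<le> e / 4" by blast
  have "(\<lambda>n. EE n s f) \<longlonglongrightarrow> EE 0 s f"
  proof (rule EE_tendsto_euclidean)
    show "bounded (range f)" using csupp_bmeas[OF f] by (simp add: bmeas_def)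
  qed (use csupp_in_continuous[OF f] s in auto)
  then have "(\<lambda>n. diff_quot n s f) \<longlonglongrightarrow> diff_quot 0 s f" unfolding diff_quot_def by (intro tendsto_intros)
  from metric_LIMSEQ_D[OF this \<open>e / 4 > 0\<close>] obtain N where N: "\<And>n. n \<ge> N \<Longrightarrow> dist (diff_quot n s f) (diff_quot 0 s f) < e / 4" by blast
  have "dist (L n) (L 0) < e" if "n \<ge> N" for n
  proof -
    have "dist (L n) (L 0) \<le> dist (L n) (diff_quot n s f) + dist (diff_quot n s f) (diff_quot 0 s f) + dist (diff_quot 0 s f) (L 0)"
      using dist_triangle[of "L n" "L 0" "diff_quot n s f"] dist_triangle[of "diff_quot n s f" "L 0" "diff_quot 0 s f"] by linarith
    moreover have "dist (L n) (diff_quot n s f) \<le> e / 4" using s(2)[of n] by (simp add: dist_norm norm_minus_commute)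
    moreover have "dist (diff_quot 0 s f) (L 0) \<le> e / 4" using s(2)[of 0] by (simp add: dist_norm)
    ultimately show ?thesis using N[OF that] \<open>e > 0\<close> by linarith
  qed
  then show "\<exists>N. \<forall>n\<ge>N. dist (L n) (L 0) < e" by blast
qed

end

section \<open>Levy measures and the extension to \<open>C\<^sub>b\<^sup>2\<close>\<close>

locale lie_levy = lie_family d w crd A U0 \<phi>0 \<mu>
  for d w crd and A :: "('g::{topological_group_add, t2_space, second_countable_topology}, 'e::real_normed_vector) atlas"
    and U0 \<phi>0 and \<mu> :: "nat \<Rightarrow> real \<Rightarrow> 'g measure" +
  fixes P :: "nat \<Rightarrow> ('g \<Rightarrow> 'k::{real_normed_field, euclidean_space}) \<Rightarrow> 'k" and \<nu> :: "nat \<Rightarrow> 'g measure"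
  assumes levy: "\<And>n. levy_measure A (P n) (\<nu> n)"
    and gen: "\<And>n f. csupp_in UNIV f \<Longrightarrow> ((\<lambda>s. diff_quot n s f) \<longlongrightarrow> P n f) (at_right 0)"
begin

lemma sets_nu [measurable_cong, simp]: "sets (\<nu> n) = sets borel"
  using levy by (simp add: levy_measure_def)

lemma space_nu [simp]: "space (\<nu> n) = UNIV"
  using sets_eq_imp_space_eq[OF sets_nu] by simp

lemma borel_measurable_nu: "f \<in> borel_measurable borel \<Longrightarrow> f \<in> borel_measurable (\<nu> n)"
  using measurable_cong_sets[OF sets_nu refl] by blast

lemma csupp_nu:
  fixes p :: "'g \<Rightarrow> 'b::{banach, second_countable_topology}"
  assumes "csupp_in (- {0}) p"
  shows "integrable (\<nu> n) p"
proof -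
  obtain K where K: "compact K" "K \<subseteq> - {0}" "\<And>x. x \<notin> K \<Longrightarrow> p x = 0"
    using assms by (auto simp: csupp_in_def)
  obtain C where C: "C \<ge> 0" "\<And>x. norm (p x) \<le> C" using csupp_in_bounded[OF assms] by blast
  have fin: "emeasure (\<nu> n) K < \<infinity>" using levy[of n] K(1,2) by (auto simp: levy_measure_def)
  show ?thesis
  proof (rule Bochner_Integration.integrable_bound[of _ "\<lambda>x. C * indicator K x"])
    show "integrable (\<nu> n) (\<lambda>x. C * indicator K x)"
      using fin compact_borel[OF K(1)] by (intro integrable_mult_right integrable_real_indicator) auto
    show "p \<in> borel_measurable (\<nu> n)"
      by (intro borel_measurable_nu borel_measurable_continuous_onI csupp_in_continuous[OF assms])
    show "AE x in \<nu> n. norm (p x) \<le> norm (C * indicator K x)"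
    proof (rule AE_I2)
      fix x show "norm (p x) \<le> norm (C * indicator K x)"
        using C K(3)[of x] by (cases "x \<in> K") auto
    qed
  qed
qed

lemma csupp_P:
  assumes "csupp_in (- {0}) p" shows "P n p = (\<integral>x. p x \<partial>\<nu> n)"
proof -
  have "p \<in> test_functions A" using csupp_in_mono[OF assms] by (simp add: test_functions_eq)
  moreover have "\<exists>K. compact K \<and> 0 \<notin> K \<and> supported_in p K"
    using assms by (auto simp: csupp_in_def supported_in_def)
  ultimately show ?thesis using levy[of n] by (auto simp: levy_measure_def)
qed

text \<open>\<open>P n\<close> acts on functions with values in \<open>'k\<close>, whereas bounds on
  masses need real integrands; \<open>of_real\<close> mediates.\<close>

lemma csupp_real_limit:
  fixes p :: "'g \<Rightarrow> real"
  assumes p: "csupp_in (- {0}) p"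
  shows "((\<lambda>s. EE n s p / s) \<longlongrightarrow> (\<integral>x. p x \<partial>\<nu> n)) (at_right 0)"
proof -
  define q where "q x = (of_real (p x) :: 'k)" for x
  have q: "csupp_in (- {0}) q" unfolding q_def by (rule csupp_in_bounded_linear[OF bounded_linear_of_real p])
  have "p 0 = 0" using p by (auto simp: csupp_in_def)
  then have "diff_quot n s q = of_real (EE n s p / s)" for s
    unfolding diff_quot_def q_def S.E_bounded_linear[OF bounded_linear_of_real csupp_bmeas[OF p]]
    by (simp add: scaleR_conv_of_real divide_inverse mult.commute)
  moreover have "P n q = of_real (\<integral>x. p x \<partial>\<nu> n)"
    unfolding csupp_P[OF q] unfolding q_def by (rule integral_bounded_linear[OF bounded_linear_of_real csupp_nu[OF p]])
  ultimately have "((\<lambda>s. of_real (EE n s p / s) :: 'k) \<longlongrightarrow> of_real (\<integral>x. p x \<partial>\<nu> n)) (at_right 0)"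
    using gen[OF csupp_in_mono[OF q], of n] by simp
  then show ?thesis by (simp only: tendsto_of_real_iff)
qed

text \<open>Away from the identity \<open>\<nu> n\<close> is the limit of
  \<open>\<mu> n s / s\<close> on test functions, so bounds linear in \<open>s\<close> pass to it.
  Cutoffs that exhaust \<open>O'\<close> and monotone convergence reach all of \<open>O'\<close>
  with the same constant, even if \<open>O'\<close> is unbounded or accumulates at the
  identity.\<close>

lemma nu_bound:
  fixes g :: "'g \<Rightarrow> real"
  assumes g: "smooth g" "\<And>x. 0 \<le> g x" "bmeas g" and O': "open O'" "0 \<notin> O'"
    and "t0 > 0" and le: "\<And>s. 0 < s \<Longrightarrow> s \<le> t0 \<Longrightarrow> EE n s (\<lambda>x. indicator O' x *\<^sub>R g x) \<le> C * s"
  shows "(\<integral>\<^sup>+x. ennreal (g x) * indicator O' x \<partial>\<nu> n) \<le> ennreal C"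
proof -
  obtain \<eta> L where \<eta>L: "\<And>k. csupp_in O' (\<eta> k)" "\<And>k x. 0 \<le> \<eta> k x" "\<And>k x. \<eta> k x \<le> (1::real)"
    "\<And>k::nat. compact (L k)" "\<And>k. L k \<subseteq> O'" "\<And>k x. x \<in> L k \<Longrightarrow> \<eta> k x = 1" "incseq L" "(\<Union>k. L k) = O'"
    using exhausting_cutoffs[OF O'(1)] by metis
  have O0: "O' \<subseteq> - {0}" using O'(2) by auto
  have gm: "g \<in> borel_measurable borel"
    by (rule borel_measurable_continuous_onI[OF smooth_continuous_on[OF g(1)]])
  have each: "(\<integral>\<^sup>+x. ennreal (g x) * indicator (L k) x \<partial>\<nu> n) \<le> ennreal C" for k
  proof -
    define p where "p x = \<eta> k x *\<^sub>R g x" for x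
    have p: "csupp_in O' p" unfolding p_def by (rule csupp_in_scaleR[OF \<eta>L(1) g(1)])
    then have p0: "csupp_in (- {0}) p" by (rule csupp_in_mono[OF _ O0])
    have p_out: "p x = 0" if "x \<notin> O'" for x using p that by (auto simp: csupp_in_def)
    have p_nonneg: "0 \<le> p x" for x using \<eta>L(2) g(2) by (simp add: p_def)
    have "(\<integral>x. p x \<partial>\<nu> n) \<le> C"
    proof (rule tendsto_upperbound[OF csupp_real_limit[OF p0]])
      show "\<forall>\<^sub>F s in at_right 0. EE n s p / s \<le> C"
        unfolding eventually_at_right_field
      proof (intro exI[of _ t0] conjI allI impI)
        fix s :: real assume s: "0 < s" "s < t0"
        have "EE n s p \<le> EE n s (\<lambda>x. indicator O' x *\<^sub>R g x)"
        proof (rule S.E_mono[OF csupp_bmeas[OF p] bmeas_scaleR[OF bmeas_indicator g(3)]])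
          show "O' \<in> sets borel" using O' by simp
          fix x show "p x \<le> indicator O' x *\<^sub>R g x"
            using p_out[of x] mult_right_mono[OF \<eta>L(3)[of k x] g(2)[of x]] by (cases "x \<in> O'") (auto simp: p_def)
        qed
        then have "EE n s p \<le> C * s" using le[of s] s by simp
        then show "EE n s p / s \<le> C" using s by (simp add: pos_divide_le_eq)
      qed (rule \<open>t0 > 0\<close>)
    qed simp
    have "(\<integral>\<^sup>+x. ennreal (g x) * indicator (L k) x \<partial>\<nu> n) \<le> (\<integral>\<^sup>+x. ennreal (p x) \<partial>\<nu> n)"
    proof (rule nn_integral_mono)
      fix x show "ennreal (g x) * indicator (L k) x \<le> ennreal (p x)"
        using \<eta>L(6)[of x k] by (cases "x \<in> L k") (auto simp: p_def)
    qed
    also have "\<dots> = ennreal (\<integral>x. p x \<partial>\<nu> n)"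
      by (rule nn_integral_eq_integral[OF csupp_nu[OF p0]]) (use p_nonneg in auto)
    also have "\<dots> \<le> ennreal C" using \<open>(\<integral>x. p x \<partial>\<nu> n) \<le> C\<close> by (rule ennreal_leI)
    finally show ?thesis .
  qed
  have "(\<integral>\<^sup>+x. ennreal (g x) * indicator O' x \<partial>\<nu> n) = (\<integral>\<^sup>+x. (SUP k. ennreal (g x) * indicator (L k) x) \<partial>\<nu> n)"
  proof (rule nn_integral_cong)
    fix x
    show "ennreal (g x) * indicator O' x = (SUP k. ennreal (g x) * indicator (L k) x)"
    proof (cases "x \<in> O'")
      case True
      then obtain k where "x \<in> L k" using \<eta>L(8) by blast
      then have "ennreal (g x) \<le> (SUP k. ennreal (g x) * indicator (L k) x)"
        by (intro SUP_upper2[of k]) auto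
      moreover have "(SUP k. ennreal (g x) * indicator (L k) x) \<le> ennreal (g x)"
        by (intro SUP_least) (auto simp: indicator_def)
      ultimately show ?thesis using True by simp
    next
      case False
      then have "x \<notin> L k" for k using \<eta>L(5) by blast
      then show ?thesis using False by simp
    qed
  qed
  also have "\<dots> = (SUP k. \<integral>\<^sup>+x. ennreal (g x) * indicator (L k) x \<partial>\<nu> n)"
  proof (rule nn_integral_monotone_convergence_SUP)
    show "incseq (\<lambda>k x. ennreal (g x) * indicator (L k) x)"
      using \<eta>L(7) by (auto simp: incseq_def le_fun_def indicator_def subset_iff)
    show "(\<lambda>x. ennreal (g x) * indicator (L k) x) \<in> borel_measurable (\<nu> n)" for k
      by (intro borel_measurable_nu borel_measurable_times_ennreal measurable_compose[OF gm measurable_ennreal]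
          borel_measurable_indicator compact_borel \<eta>L(4))
  qed
  also have "\<dots> \<le> ennreal C" by (rule SUP_least[OF each])
  finally show ?thesis .
qed

text \<open>In the limit the bound on second moments becomes the integrability condition on Levy
  measures near the identity, uniformly in \<open>n\<close>.\<close>

lemma bound_zeta_sq:
  "\<exists>C t0. C \<ge> 0 \<and> t0 > 0 \<and> (\<forall>n s. 0 < s \<longrightarrow> s \<le> t0 \<longrightarrow> EE n s zeta_sq \<le> C * s) \<and>
    (\<forall>n. (\<integral>\<^sup>+x. ennreal (zeta_sq x) \<partial>\<nu> n) \<le> ennreal C)"
proof -
  obtain C t0 where C: "t0 > 0" "\<And>n s. 0 < s \<Longrightarrow> s \<le> t0 \<Longrightarrow> moments n s \<le> C" using moments_bounded by blast
  have "0 \<le> C" using C(2)[of t0 0] moments_parts(2)[of t0 0] C(1) by linarith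
  have zeta_sq: "EE n s zeta_sq \<le> C * s" if s: "0 < s" "s \<le> t0" for n s
  proof -
    have "EE n s zeta_sq / s \<le> moments n s" unfolding moments_def by (simp add: sum_nonneg)
    then have "EE n s zeta_sq / s \<le> C" using C(2)[OF s, of n] by linarith
    then show ?thesis using s by (simp add: pos_divide_le_eq)
  qed
  have "(\<integral>\<^sup>+x. ennreal (zeta_sq x) * indicator (- {0}) x \<partial>\<nu> n) \<le> ennreal C" for n
  proof (rule nu_bound[OF smooth_zeta_sq zeta_sq_nonneg bmeas_zeta_sq _ _ C(1)])
    fix s :: real assume s: "0 < s" "s \<le> t0"
    have "EE n s (\<lambda>x. indicator (- {0}) x *\<^sub>R zeta_sq x) \<le> EE n s zeta_sq"
      by (rule S.E_mono[OF bmeas_scaleR[OF bmeas_indicator bmeas_zeta_sq] bmeas_zeta_sq]) (auto simp: indicator_def)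
    then show "EE n s (\<lambda>x. indicator (- {0}) x *\<^sub>R zeta_sq x) \<le> C * s" using zeta_sq[OF s, of n] by linarith
  qed auto
  moreover have "ennreal (zeta_sq x) * indicator (- {0}) x = ennreal (zeta_sq x)" for x
    by (cases "x = 0") (auto simp: zeta_sq_def)
  ultimately show ?thesis using \<open>0 \<le> C\<close> C(1) zeta_sq by (intro exI[of _ C] exI[of _ t0]) auto
qed

lemma bound_tail:
  "\<exists>t0>0. \<forall>\<eta>>0. \<exists>W. compact W \<and> 0 \<in> W \<and> (\<forall>n s. 0 < s \<longrightarrow> s \<le> t0 \<longrightarrow> measure (MM n s) (- W) \<le> \<eta> * s) \<and>
    (\<forall>n. emeasure (\<nu> n) (- W) \<le> ennreal \<eta>)"
proof -
  obtain t0 where t0: "t0 > 0" "\<And>\<eta>. \<eta> > 0 \<Longrightarrow> \<exists>W. compact W \<and>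
      (\<forall>n s. 0 < s \<longrightarrow> s \<le> t0 \<longrightarrow> measure (MM n s) (- W) \<le> \<eta> * s)"
    using tail_tight by blast
  have "\<exists>W. compact W \<and> 0 \<in> W \<and> (\<forall>n s. 0 < s \<longrightarrow> s \<le> t0 \<longrightarrow> measure (MM n s) (- W) \<le> \<eta> * s) \<and>
    (\<forall>n. emeasure (\<nu> n) (- W) \<le> ennreal \<eta>)" if \<eta>: "\<eta> > 0" for \<eta>
  proof -
    obtain W0 where W0: "compact W0" "\<And>n s. 0 < s \<Longrightarrow> s \<le> t0 \<Longrightarrow> measure (MM n s) (- W0) \<le> \<eta> * s"
      using t0(2)[OF \<eta>] by blast
    \<comment> \<open>The identity is added so that the complement avoids it, as
      \<open>nu_bound\<close> requires.\<close>
    define W where "W = insert 0 W0"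
    have W: "compact W" "0 \<in> W" using W0(1) by (auto simp: W_def)
    have bW: "- W \<in> sets borel" using compact_borel[OF W(1)] by auto
    have mu: "measure (MM n s) (- W) \<le> \<eta> * s" if "0 < s" "s \<le> t0" for n s
    proof -
      have "measure (MM n s) (- W) \<le> measure (MM n s) (- W0)"
        using compact_borel[OF W0(1)] by (intro S.finite_measure_mono) (auto simp: W_def)
      then show ?thesis using W0(2)[OF that, of n] by linarith
    qed
    have "emeasure (\<nu> n) (- W) \<le> ennreal \<eta>" for n
    proof -
      have "(\<integral>\<^sup>+x. ennreal 1 * indicator (- W) x \<partial>\<nu> n) \<le> ennreal \<eta>"
      proof (rule nu_bound[OF smooth_const _ bmeas_const _ _ t0(1)])
        show "open (- W)" using compact_imp_closed[OF W(1)] by auto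
        show "EE n s (\<lambda>x. indicator (- W) x *\<^sub>R 1) \<le> \<eta> * s" if "0 < s" "s \<le> t0" for s
          using mu[OF that, of n] bW by simp
      qed (use W in auto)
      then show ?thesis using bW by simp
    qed
    then show ?thesis using W mu by blast
  qed
  then show ?thesis using t0(1) by blast
qed

text \<open>The complement of \<open>K'\<close> is a neighbourhood of the identity, so
  \<open>tail_bound\<close> applies to \<open>K'\<close>. The cutoff \<eta> lies between the
  indicators of \<open>K\<close> and \<open>K'\<close> and serves as the smooth weight in
  \<open>nu_bound\<close>.\<close>

lemma bound_compact:
  assumes K: "compact K" "0 \<notin> K"
  shows "\<exists>C t0. C \<ge> 0 \<and> t0 > 0 \<and> (\<forall>n s. 0 < s \<longrightarrow> s \<le> t0 \<longrightarrow> measure (MM n s) K \<le> C * s) \<and>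
    (\<forall>n. emeasure (\<nu> n) K \<le> ennreal C)"
proof -
  have "open (- {0 :: 'g})" "K \<subseteq> - {0}" using K by auto
  obtain \<eta> V K' where \<eta>: "smooth \<eta>" "\<And>x. 0 \<le> \<eta> x" "\<And>x. \<eta> x \<le> (1::real)"
    and V: "open V" "K \<subseteq> V" "\<And>x. x \<in> V \<Longrightarrow> \<eta> x = 1"
    and K': "compact K'" "K' \<subseteq> - {0}" "\<And>x. x \<notin> K' \<Longrightarrow> \<eta> x = 0"
    by (rule cutoff[OF \<open>open (- {0})\<close> K(1) \<open>K \<subseteq> - {0}\<close>]) (rule that)
  have "open (- K')" "0 \<in> - K'" using compact_imp_closed[OF K'(1)] K'(2) by auto
  from tail_bound[OF this] obtain C t0 where C: "C \<ge> 0" "t0 > 0"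
    "\<And>n s. 0 < s \<Longrightarrow> s \<le> t0 \<Longrightarrow> measure (MM n s) K' \<le> C * s"
    by (auto simp: double_compl)
  have KK': "K \<subseteq> K'" using V(2,3) K'(3) by fastforce
  have bK': "K' \<in> sets borel" by (rule compact_borel[OF K'(1)])
  have bK: "K \<in> sets borel" by (rule compact_borel[OF K(1)])
  have mu: "measure (MM n s) K \<le> C * s" if "0 < s" "s \<le> t0" for n s
  proof -
    have "measure (MM n s) K \<le> measure (MM n s) K'"
      using KK' bK' by (intro S.finite_measure_mono) auto
    then show ?thesis using C(3)[OF that, of n] by linarith
  qed
  have "emeasure (\<nu> n) K \<le> ennreal C" for n
  proof -
    have "(\<integral>\<^sup>+x. ennreal (\<eta> x) * indicator (- {0}) x \<partial>\<nu> n) \<le> ennreal C"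
    proof (rule nu_bound[OF \<eta>(1,2) _ _ _ C(2)])
      show b\<eta>: "bmeas \<eta>"
        using \<eta> by (intro bmeasI[of _ 1] borel_measurable_continuous_onI smooth_continuous_on) auto
      fix s :: real assume s: "0 < s" "s \<le> t0"
      have "EE n s (\<lambda>x. indicator (- {0}) x *\<^sub>R \<eta> x) \<le> EE n s (indicator K')"
      proof (rule S.E_mono[OF bmeas_scaleR[OF bmeas_indicator b\<eta>] bmeas_indicator[OF bK']])
        fix x show "indicator (- {0}) x *\<^sub>R \<eta> x \<le> indicator K' x"
          using \<eta>(3)[of x] K'(3)[of x] by (cases "x \<in> K'"; cases "x = 0") auto
      qed simp
      then show "EE n s (\<lambda>x. indicator (- {0}) x *\<^sub>R \<eta> x) \<le> C * s" using C(3)[OF s, of n] bK' by simp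
    qed auto
    moreover have "(\<integral>\<^sup>+x. indicator K x \<partial>\<nu> n) \<le> (\<integral>\<^sup>+x. ennreal (\<eta> x) * indicator (- {0}) x \<partial>\<nu> n)"
    proof (rule nn_integral_mono)
      fix x show "indicator K x \<le> ennreal (\<eta> x) * indicator (- {0}) x"
      proof (cases "x \<in> K")
        case True
        then have "\<eta> x = 1" "x \<noteq> 0" using V(2,3) K(2) by auto
        then show ?thesis using True by simp
      qed simp
    qed
    ultimately show ?thesis using bK by simp
  qed
  then show ?thesis using C mu by (intro exI[of _ C] exI[of _ t0]) auto
qed

text \<open>
  Near the identity \<open>h\<close> is small compared with \<open>zeta_sq\<close>, far away the measures have little mass, and on the
  compact set in between the Stone-Weierstrass theorem applies.
\<close>

lemma flat_approx:
  fixes h :: "'g \<Rightarrow> 'k"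
  assumes h: "continuous_on UNIV h" "bounded (range h)"
    and flat: "\<And>\<epsilon>. \<epsilon> > 0 \<Longrightarrow> \<exists>U. open U \<and> 0 \<in> U \<and> (\<forall>y\<in>U. norm (h y) \<le> \<epsilon> * zeta_sq y)"
    and int: "\<And>n. integrable (\<nu> n) h" and "\<delta> > 0"
  shows "\<exists>p t0. csupp_in (- {0}) p \<and> t0 > 0 \<and> (\<forall>n. norm ((\<integral>x. h x \<partial>\<nu> n) - P n p) \<le> \<delta>) \<and>
    (\<forall>n s. 0 < s \<longrightarrow> s \<le> t0 \<longrightarrow> norm (EE n s h /\<^sub>R s - EE n s p /\<^sub>R s) \<le> \<delta>)"
proof -
  have bh: "bmeas h" by (rule bmeas_continuous[OF h])
  obtain H where H: "H \<ge> 0" "\<And>x. norm (h x) \<le> H" using bmeas_bound[OF bh] by blast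
  obtain C1 t1 where C1: "C1 \<ge> 0" "t1 > 0" "\<And>n s. 0 < s \<Longrightarrow> s \<le> t1 \<Longrightarrow> EE n s zeta_sq \<le> C1 * s"
    "\<And>n. (\<integral>\<^sup>+x. ennreal (zeta_sq x) \<partial>\<nu> n) \<le> ennreal C1"
    using bound_zeta_sq by blast
  \<comment> \<open>Each of the three regions, near the identity, far away and in between, is
    allowed \<open>\<delta> / 3\<close>; the summand 1 in the three denominators covers constants
    that vanish.\<close>
  define \<epsilon>1 where "\<epsilon>1 = \<delta> / (3 * (C1 + 1))"
  have \<epsilon>1: "\<epsilon>1 > 0" "\<epsilon>1 * C1 \<le> \<delta> / 3" using C1(1) \<open>\<delta> > 0\<close> by (auto simp: \<epsilon>1_def field_simps)
  obtain U where U: "open U" "0 \<in> U" "\<And>y. y \<in> U \<Longrightarrow> norm (h y) \<le> \<epsilon>1 * zeta_sq y" using flat[OF \<epsilon>1(1)] by blast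
  define \<eta> where "\<eta> = \<delta> / (3 * (H + 1))"
  have \<eta>: "\<eta> > 0" "H * \<eta> \<le> \<delta> / 3" using H(1) \<open>\<delta> > 0\<close> by (auto simp: \<eta>_def field_simps)
  obtain t2 W where W: "t2 > 0" "compact W" "0 \<in> W" "\<And>n s. 0 < s \<Longrightarrow> s \<le> t2 \<Longrightarrow> measure (MM n s) (- W) \<le> \<eta> * s"
    "\<And>n. emeasure (\<nu> n) (- W) \<le> ennreal \<eta>"
    using bound_tail \<eta>(1) by metis
  define K where "K = W - U"
  have K: "compact K" "K \<subseteq> - {0}" using W(2) U(1,2) by (auto simp: K_def compact_diff)
  have "open (- {0 :: 'g})" by auto
  obtain \<theta> V L where \<theta>: "smooth \<theta>" "\<And>x. 0 \<le> \<theta> x" "\<And>x. \<theta> x \<le> (1::real)"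
    and V: "open V" "K \<subseteq> V" "\<And>x. x \<in> V \<Longrightarrow> \<theta> x = 1"
    and L: "compact L" "L \<subseteq> - {0}" "\<And>x. x \<notin> L \<Longrightarrow> \<theta> x = 0"
    by (rule cutoff[OF \<open>open (- {0})\<close> K]) (rule that)
  define F where "F x = \<theta> x *\<^sub>R h x" for x
  have "continuous_on UNIV F" unfolding F_def by (intro continuous_intros smooth_continuous_on \<theta> h)
  moreover have "F x = 0" if "x \<notin> L" for x using L(3)[OF that] by (simp add: F_def)
  ultimately obtain K' where K': "compact K'" "K' \<subseteq> - {0}" "\<And>e. e > 0 \<Longrightarrow> \<exists>p. smooth p \<and>
    (\<forall>x. x \<notin> K' \<longrightarrow> F x = 0 \<and> p x = 0) \<and> (\<forall>x. norm (F x - p x) \<le> e)"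
    using csupp_uniform_approx[of F L "- {0}"] L(1,2) \<open>open (- {0})\<close> by blast
  obtain C3 t3 where C3: "C3 \<ge> 0" "t3 > 0" "\<And>n s. 0 < s \<Longrightarrow> s \<le> t3 \<Longrightarrow> measure (MM n s) K' \<le> C3 * s"
    "\<And>n. emeasure (\<nu> n) K' \<le> ennreal C3"
    using bound_compact[OF K'(1)] K'(2) by blast
  define \<epsilon>3 where "\<epsilon>3 = \<delta> / (3 * (C3 + 1))"
  have \<epsilon>3: "\<epsilon>3 > 0" "\<epsilon>3 * C3 \<le> \<delta> / 3" using C3(1) \<open>\<delta> > 0\<close> by (auto simp: \<epsilon>3_def field_simps)
  obtain p where p: "smooth p" "\<And>x. x \<notin> K' \<Longrightarrow> F x = 0 \<and> p x = 0" "\<And>x. norm (F x - p x) \<le> \<epsilon>3"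
    using K'(3)[OF \<epsilon>3(1)] by blast
  have cp: "csupp_in (- {0}) p" using p K' by (auto simp: csupp_in_def)
  have bp: "bmeas p" by (rule csupp_bmeas[OF cp])
  \<comment> \<open>One pointwise majorant of \<open>norm (h x - p x)\<close> serves the integrals
    against \<open>\<mu> n s / s\<close> and, in extended nonnegative form, those against
    \<open>\<nu> n\<close>.\<close>
  define g where "g x = (\<epsilon>1 *\<^sub>R zeta_sq x + H *\<^sub>R indicator (- W) x) + \<epsilon>3 *\<^sub>R (indicator K' x :: real)" for x
  have bW: "- W \<in> sets borel" using compact_borel[OF W(2)] by auto
  have bK': "K' \<in> sets borel" by (rule compact_borel[OF K'(1)])
  have g_parts: "bmeas (\<lambda>x. \<epsilon>1 *\<^sub>R zeta_sq x)" "bmeas (\<lambda>x. H *\<^sub>R indicator (- W) x :: real)"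
    "bmeas (\<lambda>x. \<epsilon>3 *\<^sub>R (indicator K' x :: real))"
    by (intro bmeas_scaleR_right bmeas_zeta_sq bmeas_indicator bW bK')+
  have pw: "norm (h x - p x) \<le> g x" for x
  proof -
    have "norm (h x - F x) \<le> \<epsilon>1 * zeta_sq x + H * indicator (- W) x"
    proof (cases "x \<in> K")
      case True
      then have "F x = h x" using V by (auto simp: F_def)
      then show ?thesis using \<epsilon>1(1) H(1) by simp
    next
      case False
      have "h x - F x = (1 - \<theta> x) *\<^sub>R h x" by (simp add: F_def scaleR_diff_left)
      then have "norm (h x - F x) \<le> 1 * norm (h x)"
        using \<theta>(2,3)[of x] by (simp add: mult_left_le_one_le)
      moreover have "norm (h x) \<le> \<epsilon>1 * zeta_sq x + H * indicator (- W) x"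
      proof (cases "x \<in> U")
        case True
        have "0 \<le> H * indicator (- W) x" using H(1) by simp
        then show ?thesis using U(3)[OF True] by linarith
      next
        case xU: False
        then have "x \<notin> W" using False by (simp add: K_def)
        moreover have "0 \<le> \<epsilon>1 * zeta_sq x" using \<epsilon>1(1) by simp
        ultimately show ?thesis using H(2)[of x] by simp
      qed
      ultimately show ?thesis by linarith
    qed
    moreover have "norm (F x - p x) \<le> \<epsilon>3 * indicator K' x"
      using p(2,3)[of x] by (cases "x \<in> K'") auto
    ultimately have "norm ((h x - F x) + (F x - p x)) \<le> (\<epsilon>1 * zeta_sq x + H * indicator (- W) x) + \<epsilon>3 * indicator K' x"
      by (rule order_trans[OF norm_triangle_ineq add_mono])
    then show ?thesis by (simp add: g_def)
  qed
  have mu: "norm (EE n s h /\<^sub>R s - EE n s p /\<^sub>R s) \<le> \<delta>" if s: "0 < s" "s \<le> min t1 (min t2 t3)" for n s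
  proof -
    have "norm (EE n s h - EE n s p) \<le> EE n s g"
      unfolding S.E_diff[OF bh bp, symmetric]
      by (rule S.E_norm_le[OF _ pw]) (simp only: g_def[abs_def] bmeas_add g_parts)
    also have "EE n s g = EE n s (\<lambda>x. \<epsilon>1 *\<^sub>R zeta_sq x + H *\<^sub>R indicator (- W) x) + EE n s (\<lambda>x. \<epsilon>3 *\<^sub>R (indicator K' x :: real))"
      unfolding g_def[abs_def] by (intro S.E_add bmeas_add g_parts)
    also have "EE n s (\<lambda>x. \<epsilon>1 *\<^sub>R zeta_sq x + H *\<^sub>R indicator (- W) x) = EE n s (\<lambda>x. \<epsilon>1 *\<^sub>R zeta_sq x) + EE n s (\<lambda>x. H *\<^sub>R indicator (- W) x)"
      by (intro S.E_add g_parts)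
    also have "EE n s (\<lambda>x. \<epsilon>1 *\<^sub>R zeta_sq x) + EE n s (\<lambda>x. H *\<^sub>R indicator (- W) x) + EE n s (\<lambda>x. \<epsilon>3 *\<^sub>R (indicator K' x :: real))
        = \<epsilon>1 * EE n s zeta_sq + H * measure (MM n s) (- W) + \<epsilon>3 * measure (MM n s) K'"
      using bW bK' by simp
    also have "\<dots> \<le> \<epsilon>1 * (C1 * s) + H * (\<eta> * s) + \<epsilon>3 * (C3 * s)"
      using C1(3)[of s n] W(4)[of s n] C3(3)[of s n] s \<epsilon>1(1) H(1) \<epsilon>3(1)
      by (intro add_mono mult_left_mono) auto
    also have "\<dots> = (\<epsilon>1 * C1 + H * \<eta> + \<epsilon>3 * C3) * s" by (simp add: algebra_simps)
    also have "\<dots> \<le> \<delta> * s" using \<epsilon>1(2) \<eta>(2) \<epsilon>3(2) s by (intro mult_right_mono) auto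
    finally have *: "norm (EE n s h - EE n s p) \<le> \<delta> * s" .
    have "norm (EE n s h /\<^sub>R s - EE n s p /\<^sub>R s) = norm (EE n s h - EE n s p) / s"
      using s by (simp add: scaleR_diff_right[symmetric] divide_inverse mult.commute)
    then show ?thesis using * s by (simp add: pos_divide_le_eq)
  qed
  have nu: "norm ((\<integral>x. h x \<partial>\<nu> n) - P n p) \<le> \<delta>" for n
  proof -
    have "ennreal (norm (\<integral>x. h x - p x \<partial>\<nu> n)) \<le> (\<integral>\<^sup>+x. ennreal (norm (h x - p x)) \<partial>\<nu> n)"
      by (rule integral_norm_bound_ennreal[OF Bochner_Integration.integrable_diff[OF int csupp_nu[OF cp]]])
    also have "\<dots> \<le> (\<integral>\<^sup>+x. (ennreal \<epsilon>1 * ennreal (zeta_sq x) + ennreal H * indicator (- W) x) + ennreal \<epsilon>3 * indicator K' x \<partial>\<nu> n)"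
    proof (rule nn_integral_mono)
      fix x
      have "ennreal (norm (h x - p x)) \<le> ennreal (g x)" by (rule ennreal_leI[OF pw])
      also have "\<dots> = (ennreal \<epsilon>1 * ennreal (zeta_sq x) + ennreal H * indicator (- W) x) + ennreal \<epsilon>3 * indicator K' x"
        using \<epsilon>1(1) H(1) \<epsilon>3(1) by (auto simp: g_def ennreal_plus ennreal_mult indicator_def)
      finally show "ennreal (norm (h x - p x)) \<le> (ennreal \<epsilon>1 * ennreal (zeta_sq x) + ennreal H * indicator (- W) x) + ennreal \<epsilon>3 * indicator K' x" .
    qed
    also have "\<dots> = ennreal \<epsilon>1 * (\<integral>\<^sup>+x. ennreal (zeta_sq x) \<partial>\<nu> n) + ennreal H * emeasure (\<nu> n) (- W) + ennreal \<epsilon>3 * emeasure (\<nu> n) K'"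
    proof -
      have rrm: "(\<lambda>x. ennreal (zeta_sq x)) \<in> borel_measurable (\<nu> n)"
        using bmeas_zeta_sq by (intro borel_measurable_nu) (simp add: bmeas_def)
      have i1: "(indicator (- W) :: 'g \<Rightarrow> ennreal) \<in> borel_measurable (\<nu> n)"
        "(indicator K' :: 'g \<Rightarrow> ennreal) \<in> borel_measurable (\<nu> n)"
        using bW bK' by auto
      show ?thesis
        using rrm i1 bW bK' by (simp add: nn_integral_add nn_integral_cmult)
    qed
    also have "\<dots> \<le> ennreal \<epsilon>1 * ennreal C1 + ennreal H * ennreal \<eta> + ennreal \<epsilon>3 * ennreal C3"
      by (intro add_mono mult_left_mono C1(4) W(5) C3(4)) auto
    also have "\<dots> = ennreal (\<epsilon>1 * C1 + H * \<eta> + \<epsilon>3 * C3)"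
      using \<epsilon>1(1) \<epsilon>3(1) C1(1) C3(1) H(1) \<eta>(1) by (simp add: ennreal_plus ennreal_mult)
    also have "\<dots> \<le> ennreal \<delta>" using \<epsilon>1(2) \<eta>(2) \<epsilon>3(2) by (intro ennreal_leI) linarith
    finally have "norm (\<integral>x. h x - p x \<partial>\<nu> n) \<le> \<delta>" using \<open>\<delta> > 0\<close> by simp
    then show ?thesis
      unfolding csupp_P[OF cp] by (simp add: Bochner_Integration.integral_diff[OF int csupp_nu[OF cp]])
  qed
  show ?thesis
    using cp nu mu C1(2) W(1) C3(2) by (intro exI[of _ p] exI[of _ "min t1 (min t2 t3)"]) auto
qed

text \<open>The approximant \<open>p\<close> serves all \<open>n\<close> and all small
  \<open>s\<close> at once, so both limits are inherited from the test function
  \<open>p\<close>.\<close>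

lemma flat_limits:
  fixes h :: "'g \<Rightarrow> 'k"
  assumes h: "continuous_on UNIV h" "bounded (range h)"
    and flat: "\<And>\<epsilon>. \<epsilon> > 0 \<Longrightarrow> \<exists>U. open U \<and> 0 \<in> U \<and> (\<forall>y\<in>U. norm (h y) \<le> \<epsilon> * zeta_sq y)"
    and int: "\<And>n. integrable (\<nu> n) h"
  shows "((\<lambda>s. EE n s h /\<^sub>R s) \<longlongrightarrow> (\<integral>x. h x \<partial>\<nu> n)) (at_right 0)"
    and "(\<lambda>n. \<integral>x. h x \<partial>\<nu> n) \<longlonglongrightarrow> (\<integral>x. h x \<partial>\<nu> 0)"
proof -
  have tri: "dist a b < e" if "norm (a - c) \<le> e / 4" "dist c c' < e / 4" "norm (b - c') \<le> e / 4" "e > 0" for a b c c' :: 'k and e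
  proof -
    have "dist a b \<le> dist a c + dist c c' + dist c' b"
      using dist_triangle[of a b c] dist_triangle[of c b c'] by linarith
    then show ?thesis using that by (simp add: dist_norm norm_minus_commute)
  qed
  show "((\<lambda>s. EE n s h /\<^sub>R s) \<longlongrightarrow> (\<integral>x. h x \<partial>\<nu> n)) (at_right 0)"
  proof (rule tendstoI)
    fix e :: real assume "e > 0"
    then have e4: "e / 4 > 0" by simp
    obtain p t0 where p: "csupp_in (- {0}) p" "t0 > 0" "\<And>n. norm ((\<integral>x. h x \<partial>\<nu> n) - P n p) \<le> e / 4"
      "\<And>n s. 0 < s \<Longrightarrow> s \<le> t0 \<Longrightarrow> norm (EE n s h /\<^sub>R s - EE n s p /\<^sub>R s) \<le> e / 4"
      using flat_approx[OF h flat int e4] by blast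
    have p0: "p 0 = 0" using p(1) by (auto simp: csupp_in_def)
    have "\<forall>\<^sub>F s in at_right 0. dist (diff_quot n s p) (P n p) < e / 4"
      by (rule tendstoD[OF gen[OF csupp_in_mono[OF p(1) subset_UNIV]] e4])
    moreover have "\<forall>\<^sub>F s in at_right 0. 0 < s \<and> s \<le> t0"
      unfolding eventually_at_right_field using p(2) by (intro exI[of _ t0]) auto
    ultimately show "\<forall>\<^sub>F s in at_right 0. dist (EE n s h /\<^sub>R s) (\<integral>x. h x \<partial>\<nu> n) < e"
    proof eventually_elim
      case (elim s)
      have "diff_quot n s p = EE n s p /\<^sub>R s" by (simp add: diff_quot_def p0)
      then have 1: "dist (EE n s p /\<^sub>R s) (P n p) < e / 4" using elim(1) by (simp only:)
      have 2: "norm (EE n s h /\<^sub>R s - EE n s p /\<^sub>R s) \<le> e / 4" using elim(2) p(4) by blast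
      show ?case by (rule tri[OF 2 1 p(3) \<open>e > 0\<close>])
    qed
  qed
  show "(\<lambda>n. \<integral>x. h x \<partial>\<nu> n) \<longlonglongrightarrow> (\<integral>x. h x \<partial>\<nu> 0)"
  proof (rule metric_LIMSEQ_I)
    fix e :: real assume "e > 0"
    then have e4: "e / 4 > 0" by simp
    obtain p where p: "csupp_in (- {0}) p" "\<And>n. norm ((\<integral>x. h x \<partial>\<nu> n) - P n p) \<le> e / 4"
      using flat_approx[OF h flat int e4] by blast
    have "(\<lambda>n. P n p) \<longlonglongrightarrow> P 0 p"
      using csupp_in_mono[OF p(1) subset_UNIV] by (intro generator_tendsto[of p] gen)
    from metric_LIMSEQ_D[OF this e4] obtain N where N: "\<And>n. n \<ge> N \<Longrightarrow> dist (P n p) (P 0 p) < e / 4" by blast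
    have "dist (\<integral>x. h x \<partial>\<nu> n) (\<integral>x. h x \<partial>\<nu> 0) < e" if "n \<ge> N" for n
      by (rule tri[OF p(2)[of n] N[OF that] p(2)[of 0] \<open>e > 0\<close>])
    then show "\<exists>N. \<forall>n\<ge>N. dist (\<integral>x. h x \<partial>\<nu> n) (\<integral>x. h x \<partial>\<nu> 0) < e" by blast
  qed
qed

text \<open>The first limit says that \<open>Q n\<close> remains the derivative of the semigroup at
  time zero on all of \<open>Cb2\<close>; this is what identifies it with the generator in
  \<open>rep_generator\<close>. The second is the convergence itself.\<close>

lemma Cb2_limits:
  fixes f :: "'g \<Rightarrow> 'k"
  assumes X: "\<And>j. j < d \<Longrightarrow> X j = lfield j" and Q: "\<And>n. Cb2_extension A d X (P n) (\<nu> n) (Q n)"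
    and f: "f \<in> Cb2 A d X"
  shows "((\<lambda>s. diff_quot n s f) \<longlongrightarrow> Q n f) (at_right 0)" and "(\<lambda>n. Q n f) \<longlonglongrightarrow> Q 0 f"
proof -
  have f2: "Ck_fun A 2 f" using f by (simp add: Cb2_def)
  obtain g where g: "smooth g" "\<forall>x. x \<notin> K1 \<longrightarrow> g x = 0" "jet_zero (\<lambda>x. f x - g x)"
    using jet_matching[OF f2] by blast
  have cg: "csupp_in UNIV g" using g compact_K1 by (auto simp: csupp_in_def)
  have gC: "g \<in> Cb2 A d X" by (rule csupp_in_Cb2[OF X cg])
  define h where "h x = f x - g x" for x
  have hC: "h \<in> Cb2 A d X" unfolding h_def by (rule Cb2_diff[OF X f gC])
  have h2: "Ck_fun A 2 h" using hC by (simp add: Cb2_def)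
  have jet: "jet_zero h" using g(3) by (simp add: h_def[abs_def])
  have hc: "continuous_on UNIV h" "bounded (range h)" by (rule Cb2_continuous[OF hC], rule Cb2_bounded[OF hC])
  have h0: "h 0 = 0" using jet by (simp add: jet_zero_def)
  have vanish: "\<forall>j<d. X j h 0 = 0" "\<forall>j<d. \<forall>k<d. X j (X k h) 0 = 0"
    using jet_zero_lfield[OF h2 jet] X by auto
  have Qh: "integrable (\<nu> n) h" "Q n h = (\<integral>x. h x \<partial>\<nu> n)" for n
    using Q[of n] hC h0 vanish unfolding Cb2_extension_def by blast+
  have Qf: "Q n f = P n g + (\<integral>x. h x \<partial>\<nu> n)" for n
  proof -
    have "Q n (\<lambda>x. g x + h x) = Q n g + Q n h"
      using Q[of n] gC hC by (auto simp: Cb2_extension_def linear_functional_on_def)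
    moreover have "(\<lambda>x. g x + h x) = f" by (simp add: h_def fun_eq_iff)
    moreover have "Q n g = P n g" using Q[of n] cg by (auto simp: Cb2_extension_def test_functions_eq)
    ultimately show ?thesis using Qh(2) by simp
  qed
  have flat: "\<exists>U. open U \<and> 0 \<in> U \<and> (\<forall>y\<in>U. norm (h y) \<le> \<epsilon> * zeta_sq y)" if "\<epsilon> > 0" for \<epsilon>
    using jet_zero_small[OF h2 jet that] by blast
  note lims = flat_limits[OF hc flat Qh(1)]
  have "diff_quot n s f = diff_quot n s g + EE n s h /\<^sub>R s" for n s
  proof -
    have "EE n s f = EE n s (\<lambda>x. g x + h x)" by (simp add: h_def)
    also have "\<dots> = EE n s g + EE n s h"
      by (rule S.E_add[OF csupp_bmeas[OF cg] bmeas_continuous[OF hc]])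
    finally show ?thesis using h0 by (simp add: diff_quot_def h_def algebra_simps)
  qed
  then show "((\<lambda>s. diff_quot n s f) \<longlongrightarrow> Q n f) (at_right 0)"
    using tendsto_add[OF gen[OF cg, of n] lims(1)[of n]] by (simp add: Qf)
  show "(\<lambda>n. Q n f) \<longlonglongrightarrow> Q 0 f"
    unfolding Qf by (intro tendsto_add lims(2) generator_tendsto[OF cg gen[OF cg]])
qed

end

text \<open>\<open>gen_pairing\<close> makes sense for every \<open>u\<close> in
  \<open>C2_vectors\<close>, the generator with values in the Banach space only for vectors of its
  domain. The second conjunct covers those \<open>u\<close> that lie in the domain for every
  \<open>n\<close>, with image \<open>w n\<close>.\<close>

theorem corollary3p8:
  fixes A :: "('g::{topological_group_add, t2_space, second_countable_topology},
               'e::real_normed_vector) atlas"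
    and d :: nat
    and X :: "nat \<Rightarrow> ('g \<Rightarrow> 'k::{real_normed_field, euclidean_space}) \<Rightarrow> 'g \<Rightarrow> 'k"
    and P Q :: "nat \<Rightarrow> ('g \<Rightarrow> 'k) \<Rightarrow> 'k"
    and \<nu> :: "nat \<Rightarrow> 'g measure"
    and \<mu> :: "nat \<Rightarrow> real \<Rightarrow> 'g measure"
    and smul :: "'k \<Rightarrow> 'x::banach \<Rightarrow> 'x"
    and \<pi> :: "'g \<Rightarrow> 'x \<Rightarrow>\<^sub>L 'x"
  assumes "lie_group A"
    and "left_invariant_basis A d X"
    and "\<And>n. dissipative A d X (P n)"
    and "\<And>n. levy_measure A (P n) (\<nu> n)"
    and "\<And>n. Cb2_extension A d X (P n) (\<nu> n) (Q n)"
    and "\<And>n. convolution_semigroup A (P n) (\<mu> n)"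
    and "\<And>(f :: 'g \<Rightarrow> 'k) t. f \<in> bcontfun \<Longrightarrow> t > 0 \<Longrightarrow>
           (\<lambda>n. \<integral>x. f x \<partial>\<mu> n t) \<longlonglongrightarrow> (\<integral>x. f x \<partial>\<mu> 0 t)"
    and "banach_over smul"
    and "strongly_continuous_rep smul \<pi>"
    and "\<And>n. \<exists>U. open U \<and> 0 \<in> U \<and> (\<integral>\<^sup>+x\<in>-U. ennreal (norm (\<pi> x)) \<partial>\<nu> n) < \<infinity>"
  shows "\<forall>u\<in>C2_vectors A d X smul \<pi>. \<forall>v\<in>dual smul.
           (\<lambda>n. gen_pairing (Q n) \<pi> u v) \<longlonglongrightarrow> gen_pairing (Q 0) \<pi> u v \<and>
           (\<forall>w. (\<forall>n. rep_generator smul \<pi> (\<mu> n) u (w n)) \<longrightarrow>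
              (\<lambda>n. v (w n)) \<longlonglongrightarrow> v (w 0))"
proof -
  obtain U0 \<phi>0 w where chart: "(U0, \<phi>0) \<in> A" "0 \<in> U0"
    and w: "inj_on w {..<d}" "independent (w ` {..<d})" "span (w ` {..<d}) = UNIV"
    and X: "\<And>j. j < d \<Longrightarrow> X j = left_invariant_field U0 \<phi>0 (w j)"
    using assms(2) unfolding left_invariant_basis_def by blast
  obtain crd where "finite_basis d w crd" using finite_basis_exists[OF w] by blast
  then interpret finite_basis d w crd .
  interpret lie_chart d w crd A U0 \<phi>0
    by unfold_locales (use assms(1) chart in auto)
  \<comment> \<open>The hypotheses speak of functions with values in \<open>'k\<close>, the
    estimates on masses of real ones; \<open>of_real\<close> carries the former over to the
    latter.\<close>
  have real_bcontfun: "(\<lambda>x. of_real (f x) :: 'k) \<in> bcontfun"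
    if "continuous_on UNIV f" "bounded (range f)" for f :: "'g \<Rightarrow> real"
    using that by (auto simp: bcontfun_def bounded_iff intro!: continuous_intros)
  \<comment> \<open>The map that sends \<open>z\<close> to \<open>z \<bullet> 1\<close> divided by
    \<open>1 \<bullet> 1\<close> is a left inverse of \<open>of_real\<close>. With it the identity
    holds for every \<open>f\<close>, as \<open>f\<close> and its image are then integrable
    together.\<close>
  have int_real: "(\<integral>x. of_real (f x) \<partial>\<mu> n t) = (of_real (\<integral>x. f x \<partial>\<mu> n t) :: 'k)" for f :: "'g \<Rightarrow> real" and n t
    by (rule integral_bounded_linear'[OF bounded_linear_of_real
          bounded_linear_scaleR_right[THEN bounded_linear_compose, OF bounded_linear_inner_left[of "1 :: 'k"],
            of "inverse (1 \<bullet> (1 :: 'k))"]])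
      (simp add: of_real_def)
  have sg: "conv_semigroup (\<mu> n)" for n
    unfolding conv_semigroup_def
  proof (intro conjI allI impI)
    note cs = assms(6)[of n, unfolded convolution_semigroup_def]
    show "sets (\<mu> n t) = sets borel" "subprob_space (\<mu> n t)" if "t > 0" for t
      using cs that by blast+
    show "distr (\<mu> n s \<Otimes>\<^sub>M \<mu> n t) borel (\<lambda>(x, y). x + y) = \<mu> n (s + t)" if "s > 0" "t > 0" for s t
      using cs that by blast
    fix f :: "'g \<Rightarrow> real" assume f: "continuous_on UNIV f" "bounded (range f)"
    have "((\<lambda>t. \<integral>x. of_real (f x) \<partial>\<mu> n t) \<longlongrightarrow> (of_real (f 0) :: 'k)) (at_right 0)"
      using cs real_bcontfun[OF f] by blast
    then show "((\<lambda>t. \<integral>x. f x \<partial>\<mu> n t) \<longlongrightarrow> f 0) (at_right 0)"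
      unfolding int_real by (simp only: tendsto_of_real_iff)
  qed
  interpret conv_family \<mu>
    unfolding conv_family_def
  proof (intro conjI allI impI sg)
    fix f :: "'g \<Rightarrow> real" and t :: real assume f: "continuous_on UNIV f" "bounded (range f)" "t > 0"
    from assms(7)[OF real_bcontfun[OF f(1,2)] f(3)]
    show "(\<lambda>n. \<integral>x. f x \<partial>\<mu> n t) \<longlonglongrightarrow> (\<integral>x. f x \<partial>\<mu> 0 t)"
      unfolding int_real by (simp only: tendsto_of_real_iff)
  qed
  interpret lie_family d w crd A U0 \<phi>0 \<mu> ..
  have diff_quot_mu: "\<forall>\<^sub>F t in at_right 0. ((\<integral>x. f x \<partial>\<mu> n t) - f 0) /\<^sub>R t = diff_quot n t f" for f :: "'g \<Rightarrow> 'k" and n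
    by (rule eventually_mono[OF eventually_at_right_less[of 0]]) (simp add: diff_quot_def S.M_def)
  interpret lie_levy d w crd A U0 \<phi>0 \<mu> P \<nu>
  proof
    show "levy_measure A (P n) (\<nu> n)" for n by (rule assms(4))
    fix n and f :: "'g \<Rightarrow> 'k" assume "csupp_in UNIV f"
    then have "((\<lambda>t. ((\<integral>x. f x \<partial>\<mu> n t) - f 0) /\<^sub>R t) \<longlongrightarrow> P n f) (at_right 0)"
      using assms(6)[of n] by (auto simp: convolution_semigroup_def test_functions_eq)
    then show "((\<lambda>s. diff_quot n s f) \<longlongrightarrow> P n f) (at_right 0)"
      by (rule Lim_transform_eventually[OF _ diff_quot_mu])
  qed
  note lims = Cb2_limits[OF X assms(5)]
  show ?thesis
  proof (intro ballI conjI allI impI)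
    fix u v assume u: "u \<in> C2_vectors A d X smul \<pi>" and v: "v \<in> dual smul"
    define f where "f = coeff_fun \<pi> u v"
    have f: "f \<in> Cb2 A d X" using u v by (auto simp: C2_vectors_def f_def)
    show "(\<lambda>n. gen_pairing (Q n) \<pi> u v) \<longlonglongrightarrow> gen_pairing (Q 0) \<pi> u v"
      unfolding gen_pairing_def f_def[symmetric] by (rule lims(2)[OF _ f])
    fix z assume z: "\<forall>n. rep_generator smul \<pi> (\<mu> n) u (z n)"
    have bv: "bounded_linear v" using v by (simp add: dual_def)
    have f0: "f 0 = v u" using assms(9) by (simp add: f_def coeff_fun_def strongly_continuous_rep_def)
    \<comment> \<open>Both sides are the limit of the difference quotient of \<open>f\<close>: the
      left one through the generator and the continuity of \<open>v\<close>, the right one by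
      \<open>Cb2_limits\<close>.\<close>
    have "v (z n) = Q n f" for n
    proof -
      obtain T where T: "\<And>t. t > 0 \<Longrightarrow> rep_integral smul \<pi> (\<mu> n t) u (T t)"
        "((\<lambda>t. (T t - u) /\<^sub>R t) \<longlongrightarrow> z n) (at_right 0)"
        using z unfolding rep_generator_def by blast
      have "((\<lambda>t. v ((T t - u) /\<^sub>R t)) \<longlongrightarrow> v (z n)) (at_right 0)"
        by (rule bounded_linear.tendsto[OF bv T(2)])
      moreover have "\<forall>\<^sub>F t in at_right 0. v ((T t - u) /\<^sub>R t) = ((\<integral>x. f x \<partial>\<mu> n t) - f 0) /\<^sub>R t"
      proof (rule eventually_mono[OF eventually_at_right_less[of 0]])
        fix t :: real assume "t > 0"
        then have "v (T t) = (\<integral>x. f x \<partial>\<mu> n t)"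
          using T(1) v by (simp add: rep_integral_def f_def)
        then show "v ((T t - u) /\<^sub>R t) = ((\<integral>x. f x \<partial>\<mu> n t) - f 0) /\<^sub>R t"
          using bv by (simp add: linear_simps f0)
      qed
      ultimately have "((\<lambda>t. ((\<integral>x. f x \<partial>\<mu> n t) - f 0) /\<^sub>R t) \<longlongrightarrow> v (z n)) (at_right 0)"
        by (rule Lim_transform_eventually)
      then have "((\<lambda>t. diff_quot n t f) \<longlongrightarrow> v (z n)) (at_right 0)"
        by (rule Lim_transform_eventually[OF _ diff_quot_mu])
      from tendsto_unique[OF _ this lims(1)[OF _ f]] show ?thesis by simp
    qed
    then show "(\<lambda>n. v (z n)) \<longlonglongrightarrow> v (z 0)" using lims(2)[OF _ f] by simp
  qed
qed

end
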